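(* There is an absolute constant $C$ such that $$\|\pi_Ke^{\mathrm in\tau|\nabla|}f\|_{\ell^2_{\tau,N}L^\infty}\le C\sqrt{K\tau+\log(1+KN\tau)}\,\|f\|_{\dot H^1},$$ $$\Big\|\tau\sum_{k=0}^N\pi_Ke^{-\mathrm ik\tau|\nabla|}F_k\Big\|_{\dot H^{-1}}\le C\sqrt{K\tau+\log(1+KN\tau)}\,\|F\|_{\ell^2_{\tau,N}L^1}$$ for all $\tau\in(0,1]$, $K\ge\tau^{-1}$, $N\in\mathbb N_0$, $f\in\dot H^1$, and $F=(F_k)_{k\in\mathbb Z}\in\ell^2(\mathbb Z,L^1)$.
   Context: All spaces are over $\mathbb R^3$. $\hat w=\mathcal Fw$ is the Fourier transform, $\|w\|_{\dot H^s}=\||\xi|^s\hat w\|_{L^2}$, $\dot H^s=\{w\in\mathcal S':\hat w\in L^1_{\mathrm{loc}},\|w\|_{\dot H^s}<\infty\}$. $e^{\mathrm it|\nabla|}=\mathcal F^{-1}e^{\mathrm it|\xi|}\mathcal F$ and $\pi_K=\mathcal F^{-1}\mathbf 1_{B(0,K)}\mathcal F$. For a sequence $(F_n)$ in a Banach space $X$ and $N\in\mathbb N_0$, $\|F_n\|_{\ell^p_{\tau,N}X}=(\tau\sum_{n=0}^N\|F_n\|_X^p)^{1/p}$, the summation being over the variable $n$. *)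

theory Defs
  imports "HOL-Analysis.Analysis" "HOL-Probability.Essential_Supremum"
begin

type_synonym R3 = "real^3"

section \<open>Smooth functions, test functions, Schwartz functions\<close>

definition partial :: "3 \<Rightarrow> (R3 \<Rightarrow> complex) \<Rightarrow> R3 \<Rightarrow> complex" where
  "partial i \<phi> x = frechet_derivative \<phi> (at x) (axis i 1)"

text \<open>Iterated partial derivatives; a list of coordinate indices plays the role of a multi-index.\<close>

fun partials :: "3 list \<Rightarrow> (R3 \<Rightarrow> complex) \<Rightarrow> R3 \<Rightarrow> complex" where
  "partials [] \<phi> = \<phi>"
| "partials (i # is) \<phi> = partial i (partials is \<phi>)"

definition smooth :: "(R3 \<Rightarrow> complex) \<Rightarrow> bool" where
  "smooth \<phi> \<longleftrightarrow> (\<forall>is x. partials is \<phi> differentiable (at x))"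

definition test_function :: "(R3 \<Rightarrow> complex) \<Rightarrow> bool" where
  "test_function \<phi> \<longleftrightarrow> smooth \<phi> \<and> (\<exists>S. compact S \<and> (\<forall>x. x \<notin> S \<longrightarrow> \<phi> x = 0))"

definition schwartz :: "(R3 \<Rightarrow> complex) set" where
  "schwartz = {\<phi>. smooth \<phi> \<and>
     (\<forall>m is. bdd_above (range (\<lambda>x. (1 + norm x) ^ m * norm (partials is \<phi> x))))}"

definition schwartz_seminorm :: "nat \<Rightarrow> 3 list \<Rightarrow> (R3 \<Rightarrow> complex) \<Rightarrow> real" where
  "schwartz_seminorm m is \<phi> = (SUP x. (1 + norm x) ^ m * norm (partials is \<phi> x))"


section \<open>Tempered distributions\<close>

text \<open>A distribution is a functional on functions, of which only the values on Schwartz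
  functions are meaningful; all notions below refer to these values only.\<close>

type_synonym dist3 = "(R3 \<Rightarrow> complex) \<Rightarrow> complex"

definition tempered :: "dist3 set" where
  "tempered = {u.
     (\<forall>\<phi>\<in>schwartz. \<forall>\<psi>\<in>schwartz. u (\<lambda>x. \<phi> x + \<psi> x) = u \<phi> + u \<psi>) \<and>
     (\<forall>c. \<forall>\<phi>\<in>schwartz. u (\<lambda>x. c * \<phi> x) = c * u \<phi>) \<and>
     (\<exists>C m. \<forall>\<phi>\<in>schwartz.
        norm (u \<phi>) \<le> C * (\<Sum>is\<in>{is. length is \<le> m}. schwartz_seminorm m is \<phi>))}"

definition fun_dist :: "(R3 \<Rightarrow> complex) \<Rightarrow> dist3" where
  "fun_dist g \<phi> = (LINT x|lborel. g x * \<phi> x)"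

text \<open>Functions are taken Borel measurable; every almost-everywhere class of Lebesgue
  measurable functions has such a representative.\<close>

definition locally_integrable :: "(R3 \<Rightarrow> complex) \<Rightarrow> bool" where
  "locally_integrable g \<longleftrightarrow>
     g \<in> borel_measurable borel \<and> (\<forall>S. compact S \<longrightarrow> set_integrable lborel S g)"

definition represents :: "(R3 \<Rightarrow> complex) \<Rightarrow> dist3 \<Rightarrow> bool" where
  "represents g u \<longleftrightarrow>
     locally_integrable g \<and> (\<forall>\<phi>. test_function \<phi> \<longrightarrow> u \<phi> = fun_dist g \<phi>)"

text \<open>The locally integrable function representing a distribution, if there is one. It is
  determined up to a null set, and it is only used where the choice of a representative does
  not matter.\<close>

definition dist_fun :: "dist3 \<Rightarrow> R3 \<Rightarrow> complex" where
  "dist_fun u = (SOME g. represents g u)"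


section \<open>Fourier transform and Fourier multipliers\<close>

definition fourier :: "(R3 \<Rightarrow> complex) \<Rightarrow> R3 \<Rightarrow> complex" where
  "fourier \<phi> \<xi> = (LINT x|lborel. cis (- (x \<bullet> \<xi>)) * \<phi> x)"

definition inv_fourier :: "(R3 \<Rightarrow> complex) \<Rightarrow> R3 \<Rightarrow> complex" where
  "inv_fourier \<phi> x = of_real (1 / (2 * pi) ^ 3) * (LINT \<xi>|lborel. cis (x \<bullet> \<xi>) * \<phi> \<xi>)"

definition fourier_dist :: "dist3 \<Rightarrow> dist3" where
  "fourier_dist u \<phi> = u (fourier \<phi>)"

definition inv_fourier_dist :: "dist3 \<Rightarrow> dist3" where
  "inv_fourier_dist u \<phi> = u (inv_fourier \<phi>)"

text \<open>The operator with symbol \<open>a\<close>, for distributions whose Fourier transform is a locally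
  integrable function (so that the product with a bounded, possibly discontinuous symbol makes
  sense).\<close>

definition multiplier :: "(R3 \<Rightarrow> complex) \<Rightarrow> dist3 \<Rightarrow> dist3" where
  "multiplier a u =
     inv_fourier_dist (fun_dist (\<lambda>\<xi>. a \<xi> * dist_fun (fourier_dist u) \<xi>))"

definition half_wave :: "real \<Rightarrow> dist3 \<Rightarrow> dist3" where
  "half_wave t = multiplier (\<lambda>\<xi>. cis (t * norm \<xi>))"

definition freq_proj :: "real \<Rightarrow> dist3 \<Rightarrow> dist3" where
  "freq_proj K = multiplier (indicator (ball 0 K))"


section \<open>Function spaces and norms\<close>

text \<open>For \<open>s < 0\<close> the weight is \<open>0\<close> at the origin because of \<open>0 powr s = 0\<close>; this
  concerns a null set only.\<close>

definition hdot :: "real \<Rightarrow> dist3 set" where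
  "hdot s = {u \<in> tempered. (\<exists>g. represents g (fourier_dist u)) \<and>
     integrable lborel (\<lambda>\<xi>. (norm \<xi> powr s * norm (dist_fun (fourier_dist u) \<xi>))\<^sup>2)}"

definition hdot_norm :: "real \<Rightarrow> dist3 \<Rightarrow> real" where
  "hdot_norm s u =
     sqrt (LINT \<xi>|lborel. (norm \<xi> powr s * norm (dist_fun (fourier_dist u) \<xi>))\<^sup>2)"

definition Linfty_enorm :: "dist3 \<Rightarrow> ennreal" where
  "Linfty_enorm u = esssup lborel (\<lambda>x. ennreal (norm (dist_fun u x)))"

definition Linfty :: "dist3 set" where
  "Linfty = {u \<in> tempered. (\<exists>g. represents g u) \<and> Linfty_enorm u < \<infinity>}"

definition Linfty_norm :: "dist3 \<Rightarrow> real" where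
  "Linfty_norm u = enn2real (Linfty_enorm u)"

definition L1 :: "(R3 \<Rightarrow> complex) set" where
  "L1 = {g. integrable lborel g}"

definition L1_norm :: "(R3 \<Rightarrow> complex) \<Rightarrow> real" where
  "L1_norm g = (LINT x|lborel. norm (g x))"

definition l2_L1 :: "(int \<Rightarrow> R3 \<Rightarrow> complex) set" where
  "l2_L1 = {F. (\<forall>k. F k \<in> L1) \<and> (\<lambda>k. (L1_norm (F k))\<^sup>2) summable_on UNIV}"

text \<open>The norm of \<open>\<ell>\<^sup>p\<^bsub>\<tau>,N\<^esub>X\<close>, where \<open>nrm\<close> is the norm of \<open>X\<close>.\<close>

definition disc_norm :: "real \<Rightarrow> real \<Rightarrow> nat \<Rightarrow> ('x \<Rightarrow> real) \<Rightarrow> (nat \<Rightarrow> 'x) \<Rightarrow> real" where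
  "disc_norm p \<tau> N nrm F = (\<tau> * (\<Sum>n=0..N. nrm (F n) powr p)) powr (1 / p)"

end

theory Submission
  imports Defs "HOL-Probability.Probability"
begin

text \<open>By duality and the \<open>T T\<^sup>*\<close> argument both estimates reduce to bounding the Gram matrices of
  finitely many functions on the frequency ball, one for each time \<open>k \<tau>\<close> and one point in space
  (Dirac masses replace the functions in \<open>L\<^sup>1\<close>). For \<open>e\<^sup>i\<^sup>t\<^sup>|\<^sup>\<nabla>\<^sup>|\<close> the relevant kernel of
  \<open>|\<nabla>|\<^sup>-\<^sup>2\<close> exceeds \<open>1 / t\<close> by a logarithm near the light cone, but for \<open>cos (t |\<nabla>|)\<close> it is a
  difference of two values of the bounded sine integral divided by the radius, and hence
  \<open>O(min K (1 / t))\<close>. Splitting \<open>e\<^sup>i\<^sup>t\<^sup>|\<^sup>\<nabla>\<^sup>|\<close> into cosine and sine, whose Gram matrices only involve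
  this kernel at times \<open>(k \<plusminus> l) \<tau>\<close>, Schur's test produces \<open>K \<tau>\<close> from the diagonal and a
  harmonic sum from the rest.\<close>

section \<open>Integration of functions of \<open>(|\<xi>|, \<xi>\<^sub>3)\<close>\<close>

text \<open>The logarithm in the half-wave kernel comes from its sine part: there cosine integrals
  take the place of sine integrals, and log |(t + \<rho>) / (t - \<rho>)| appears at distance
  \<rho>. Row sums over the times l \<tau> could then cost the square of the logarithm, so the
  exponential has to be split before the Gram matrix is formed. The cosine bound is uniform in
  space; hence the evaluation point may vary freely with the time, and a point where a function
  nearly attains its supremum can stand for its supremum norm. The hypothesis K \<ge> 1 / \<tau>
  makes the weights decrease in the time difference, and in the form 1 \<le> K \<tau> it absorbs the
  constant next to the logarithm of the harmonic sum. All norms are defined through some chosen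
  function that represents a distribution; uniqueness of that function and Fourier inversion on test
  functions identify it with the explicit symbols of the operators.\<close>

lemma distinct3: "(1::3) \<noteq> 2" "(1::3) \<noteq> 3" "(2::3) \<noteq> 3"
  by (simp_all)

lemma prod_Basis_R3:
  fixes f :: "R3 \<Rightarrow> 'a::comm_monoid_mult"
  shows "(\<Prod>b\<in>Basis. f b) = f (axis 1 1) * f (axis 2 1) * f (axis 3 1)"
proof -
  have "(\<Prod>b\<in>Basis. f b) = (\<Prod>i\<in>(UNIV::3 set). f (axis i 1))"
    by (rule prod.reindex_bij_witness[of _ "\<lambda>i. axis i 1" "\<lambda>b. THE i. b = axis i 1"])
       (auto simp: Basis_vec_def axis_eq_axis)
  also have "\<dots> = f (axis 1 1) * f (axis 2 1) * f (axis 3 1)"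
    unfolding UNIV_3 using distinct3
  by (simp add: mult.assoc)
  finally show ?thesis .
qed

text \<open>The grouping separates the horizontal plane from the height \<open>\<xi> $ 3\<close>, so
  that Fubini can integrate over whole planes first.\<close>

definition R3_of :: "(real \<times> real) \<times> real \<Rightarrow> R3" where
  "R3_of p = (\<chi> i. if i = 1 then fst (fst p) else if i = 2 then snd (fst p) else snd p)"

lemma R3_of_nth [simp]:
  "R3_of p $ 1 = fst (fst p)" "R3_of p $ 2 = snd (fst p)" "R3_of p $ 3 = snd p"
  by (simp_all add: R3_of_def)

lemma R3_of_measurable [measurable]: "R3_of \<in> borel_measurable borel"
proof -
  have "continuous_on UNIV R3_of"
  proof (rule continuous_on_componentwise[THEN iffD2], rule ballI)
    fix b :: R3 assume "b \<in> Basis"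
    then obtain i where b: "b = axis i 1" by (auto simp: Basis_vec_def)
    have *: "(\<lambda>p. R3_of p \<bullet> b) = (\<lambda>p. if i = 1 then fst (fst p) else if i = 2 then snd (fst p) else snd p)"
      by (rule ext) (simp add: R3_of_def b inner_axis)
    show "continuous_on UNIV (\<lambda>p. R3_of p \<bullet> b)"
      unfolding * by (cases "i = 1"; cases "i = 2") (auto intro!: continuous_intros)
  qed
  then show ?thesis by (rule borel_measurable_continuous_onI)
qed

lemma distr_R3_of: "distr lborel borel R3_of = lborel"
proof (rule sym, rule lborel_eqI)
  fix l u :: R3
  assume le: "\<And>b. b \<in> Basis \<Longrightarrow> l \<bullet> b \<le> u \<bullet> b"
  have le': "l $ i \<le> u $ i" for i
    using le[of "axis i 1"] by (auto simp: inner_axis Basis_vec_def)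
  have "R3_of -` box l u = ({l$1<..<u$1} \<times> {l$2<..<u$2}) \<times> {l$3<..<u$3}"
    by (auto simp: mem_box_cart forall_3)
  then have "emeasure (distr lborel borel R3_of) (box l u)
     = emeasure ((lborel \<Otimes>\<^sub>M lborel) \<Otimes>\<^sub>M lborel) (({l$1<..<u$1} \<times> {l$2<..<u$2}) \<times> {l$3<..<u$3})"
    by (subst emeasure_distr) (simp_all add: lborel_prod)
  also have "\<dots> = emeasure (lborel \<Otimes>\<^sub>M lborel) ({l$1<..<u$1} \<times> {l$2<..<u$2}) * emeasure lborel {l$3<..<u$3}"
    by (rule lborel.emeasure_pair_measure_Times) simp_all
  also have "emeasure (lborel \<Otimes>\<^sub>M lborel) ({l$1<..<u$1} \<times> {l$2<..<u$2})
     = emeasure lborel {l$1<..<u$1} * emeasure lborel {l$2<..<u$2}"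
    by (rule lborel.emeasure_pair_measure_Times) simp_all
  also have "emeasure lborel {l$1<..<u$1} * emeasure lborel {l$2<..<u$2} * emeasure lborel {l$3<..<u$3}
     = ennreal ((u$1 - l$1) * (u$2 - l$2) * (u$3 - l$3))"
    using le'[of 1] le'[of 2] le'[of 3] by (simp add: ennreal_mult)
  also have "\<dots> = ennreal (prod ((\<bullet>) (u - l)) Basis)"
    unfolding prod_Basis_R3 by (simp add: inner_axis)
  finally show "emeasure (distr lborel borel R3_of) (box l u) = ennreal (prod ((\<bullet>) (u - l)) Basis)" .
qed simp

text \<open>A half-line pulls back to a disc, whose area is \<pi> times its squared radius. The
  minus sign makes these the upper half-lines \<open>{x<..}\<close>, which get finite measure and
  determine the measure.\<close>

lemma distr_norm_square_plane:
  "distr (lborel :: (real \<times> real) measure) borel (\<lambda>\<eta>. - (norm \<eta>)\<^sup>2)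
     = density lborel (\<lambda>v. ennreal pi * indicator {..0} v)"
  (is "?M = ?N")
proof (rule measure_eqI_lessThan)
  have M: "emeasure ?M {x<..} = ennreal (pi * max 0 (- x))" for x :: real
  proof -
    have "emeasure ?M {x<..} = emeasure lborel ({\<eta> :: real \<times> real. (norm \<eta>)\<^sup>2 < - x})"
      by (subst emeasure_distr) (auto intro!: arg_cong2[where f=emeasure])
    also have "{\<eta> :: real \<times> real. (norm \<eta>)\<^sup>2 < - x} = ball 0 (sqrt (max 0 (- x)))"
    proof (cases "x < 0")
      case True
      have "(norm \<eta>)\<^sup>2 < - x \<longleftrightarrow> norm \<eta> < sqrt (- x)" for \<eta> :: "real \<times> real"
        using real_sqrt_less_iff[of "(norm \<eta>)\<^sup>2" "- x"] by simp
      with True show ?thesis by (auto simp: max_def)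
    next
      case False
      then have "\<not> (norm \<eta>)\<^sup>2 < - x" for \<eta> :: "real \<times> real"
        using zero_le_power2[of "norm \<eta>"] by linarith
      with False show ?thesis by (auto simp: max_def)
    qed
    also have "emeasure lborel \<dots> = ennreal (pi * max 0 (- x))"
      by (subst emeasure_ball) (auto simp: unit_ball_vol_numeral eval_unit_ball_vol)
    finally show ?thesis .
  qed
  have N: "emeasure ?N {x<..} = ennreal (pi * max 0 (- x))" for x :: real
  proof -
    have "emeasure ?N {x<..} = (\<integral>\<^sup>+v. ennreal pi * indicator {x<..0} v \<partial>lborel)"
      by (subst emeasure_density) (auto intro!: nn_integral_cong split: split_indicator)
    also have "\<dots> = ennreal pi * emeasure lborel {x<..0}"
      by (rule nn_integral_cmult_indicator) auto
    also have "\<dots> = ennreal (pi * max 0 (- x))"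
      by (cases "x \<le> 0") (auto simp: ennreal_mult'[symmetric] max_def)
    finally show ?thesis .
  qed
  show "emeasure ?M {x<..} < \<infinity>" for x by (simp add: M)
  show "emeasure ?M {x<..} = emeasure ?N {x<..}" for x by (simp add: M N)
qed simp_all

text \<open>A substitute for polar coordinates: on each horizontal plane \<open>|\<eta>|\<^sup>2\<close> is distributed as \<open>\<pi>\<close>
  times Lebesgue measure, so passing to \<open>|\<xi>|\<^sup>2 = |\<eta>|\<^sup>2 + \<xi>\<^sub>3\<^sup>2\<close> is a mere translation.\<close>

lemma nn_integral_norm_square_height:
  fixes \<Psi> :: "real \<times> real \<Rightarrow> ennreal"
  assumes [measurable]: "\<Psi> \<in> borel_measurable borel"
  shows "(\<integral>\<^sup>+\<xi>. \<Psi> ((norm \<xi>)\<^sup>2, \<xi> $ 3) \<partial>(lborel :: R3 measure))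
       = (\<integral>\<^sup>+p. ennreal pi * indicator {p. (snd p)\<^sup>2 \<le> fst p} p * \<Psi> p \<partial>lborel)"
proof -
  have nrm: "(norm (R3_of (\<eta>, s)))\<^sup>2 = (norm \<eta>)\<^sup>2 + s\<^sup>2" for \<eta> s
    by (simp add: norm_vec_def L2_set_def sum_3 real_sqrt_pow2 sum_nonneg norm_prod_def)
  have [measurable]: "\<Psi> \<in> borel_measurable (borel \<Otimes>\<^sub>M borel)"
    by (simp add: borel_prod)
  have [measurable]: "(\<lambda>p. ((norm (R3_of p))\<^sup>2, snd p)) \<in> borel_measurable borel"
    by (intro borel_measurable_Pair) (auto intro!: borel_measurable_continuous_onI continuous_intros)
  have [measurable]: "(\<lambda>p. \<Psi> ((norm (R3_of p))\<^sup>2, snd p)) \<in> borel_measurable borel"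
    by measurable
  have [measurable]: "(\<lambda>\<xi>::R3. ((norm \<xi>)\<^sup>2, \<xi> $ 3)) \<in> borel_measurable borel"
    by (intro borel_measurable_continuous_onI continuous_intros)
  have "(\<integral>\<^sup>+\<xi>. \<Psi> ((norm \<xi>)\<^sup>2, \<xi> $ 3) \<partial>(lborel :: R3 measure))
     = (\<integral>\<^sup>+\<xi>. \<Psi> ((norm \<xi>)\<^sup>2, \<xi> $ 3) \<partial>distr lborel borel R3_of)"
    by (simp add: distr_R3_of)
  also have "\<dots> = (\<integral>\<^sup>+p. \<Psi> ((norm (R3_of p))\<^sup>2, snd p) \<partial>(lborel \<Otimes>\<^sub>M lborel))"
    by (subst nn_integral_distr) (auto simp: lborel_prod)
  also have "\<dots> = (\<integral>\<^sup>+s. \<integral>\<^sup>+\<eta>. \<Psi> ((norm (R3_of (\<eta>, s)))\<^sup>2, s) \<partial>lborel \<partial>lborel)"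
    by (subst lborel_pair.nn_integral_snd[symmetric]) (auto simp: lborel_prod)
  \<comment> \<open>This form exposes the variable v = -|\<eta>|^2, whose law is known; below, w =
    s^2 - v is the new name of |\<xi>|^2.\<close>
  also have "\<dots> = (\<integral>\<^sup>+s. \<integral>\<^sup>+\<eta>. \<Psi> (s\<^sup>2 - (- (norm \<eta>)\<^sup>2), s) \<partial>(lborel :: (real \<times> real) measure) \<partial>lborel)"
    by (simp add: nrm add.commute)
  also have "\<dots> = (\<integral>\<^sup>+s. \<integral>\<^sup>+v. \<Psi> (s\<^sup>2 - v, s)
        \<partial>(distr (lborel :: (real \<times> real) measure) borel (\<lambda>\<eta>. - (norm \<eta>)\<^sup>2)) \<partial>lborel)"
    by (subst nn_integral_distr) auto
  also have "\<dots> = (\<integral>\<^sup>+s. \<integral>\<^sup>+v. ennreal pi * indicator {..0} v * \<Psi> (s\<^sup>2 - v, s) \<partial>lborel \<partial>lborel)"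
    unfolding distr_norm_square_plane by (subst nn_integral_density) auto
  also have "\<dots> = (\<integral>\<^sup>+s. \<integral>\<^sup>+w. ennreal pi * indicator {s\<^sup>2..} w * \<Psi> (w, s) \<partial>lborel \<partial>lborel)"
  proof (rule nn_integral_cong)
    fix s :: real
    have "(\<integral>\<^sup>+w. ennreal pi * indicator {s\<^sup>2..} w * \<Psi> (w, s) \<partial>lborel)
       = (\<integral>\<^sup>+v. ennreal pi * indicator {s\<^sup>2..} (s\<^sup>2 + (- 1) * v) * \<Psi> (s\<^sup>2 + (- 1) * v, s) \<partial>lborel)"
      by (subst nn_integral_real_affine[where c="-1" and t="s\<^sup>2"]) auto
    then show "(\<integral>\<^sup>+v. ennreal pi * indicator {..0} v * \<Psi> (s\<^sup>2 - v, s) \<partial>lborel)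
      = (\<integral>\<^sup>+w. ennreal pi * indicator {s\<^sup>2..} w * \<Psi> (w, s) \<partial>lborel)"
      by (auto intro!: nn_integral_cong split: split_indicator)
  qed
  also have "\<dots> = (\<integral>\<^sup>+s. \<integral>\<^sup>+w. ennreal pi * indicator {p. (snd p)\<^sup>2 \<le> fst p} (w, s) * \<Psi> (w, s) \<partial>lborel \<partial>lborel)"
    by (auto intro!: nn_integral_cong split: split_indicator)
  also have "\<dots> = (\<integral>\<^sup>+p. ennreal pi * indicator {p. (snd p)\<^sup>2 \<le> fst p} p * \<Psi> p \<partial>(lborel \<Otimes>\<^sub>M lborel))"
    by (rule lborel_pair.nn_integral_snd) measurable
  finally show ?thesis by (simp add: lborel_prod)
qed

text \<open>The same fact as an equality of measures: the oscillating complex integrands of the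
  kernel call for Bochner integrals instead of nonnegative ones.\<close>

lemma distr_norm_square_height:
  "distr lborel borel (\<lambda>\<xi>::R3. ((norm \<xi>)\<^sup>2, \<xi> $ 3))
     = density lborel (\<lambda>p. ennreal pi * indicator {p. (snd p)\<^sup>2 \<le> fst p} p)"
proof (rule measure_eqI)
  fix A assume "A \<in> sets (distr lborel borel (\<lambda>\<xi>::R3. ((norm \<xi>)\<^sup>2, \<xi> $ 3)))"
  then have [measurable]: "A \<in> sets borel" by simp
  have [measurable]: "(\<lambda>\<xi>::R3. ((norm \<xi>)\<^sup>2, \<xi> $ 3)) \<in> borel_measurable borel"
    by (intro borel_measurable_continuous_onI continuous_intros)
  have [measurable]: "{p :: real \<times> real. (snd p)\<^sup>2 \<le> fst p} \<in> sets borel"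
    by (auto intro!: borel_closed closed_Collect_le continuous_intros)
  have "emeasure (distr lborel borel (\<lambda>\<xi>::R3. ((norm \<xi>)\<^sup>2, \<xi> $ 3))) A
      = (\<integral>\<^sup>+\<xi>. indicator A ((norm \<xi>)\<^sup>2, \<xi> $ 3) \<partial>(lborel :: R3 measure))"
    by (subst nn_integral_indicator[symmetric], simp, subst nn_integral_distr) auto
  also have "\<dots> = emeasure (density lborel (\<lambda>p. ennreal pi * indicator {p. (snd p)\<^sup>2 \<le> fst p} p)) A"
    by (subst nn_integral_norm_square_height) (auto simp: emeasure_density)
  finally show "emeasure (distr lborel borel (\<lambda>\<xi>::R3. ((norm \<xi>)\<^sup>2, \<xi> $ 3))) A =
    emeasure (density lborel (\<lambda>p. ennreal pi * indicator {p. (snd p)\<^sup>2 \<le> fst p} p)) A" .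
qed simp

text \<open>Orthogonal images keep the volume of boxes, and box volumes determine Lebesgue measure.
  This serves to turn an arbitrary point z into a multiple of the third unit vector.\<close>

lemma orthogonal_transformation_distr_lborel:
  fixes T :: "R3 \<Rightarrow> R3"
  assumes T: "orthogonal_transformation T"
  shows "distr lborel borel T = lborel"
proof (rule sym, rule lborel_eqI)
  fix l u :: R3
  assume le: "\<And>b. b \<in> Basis \<Longrightarrow> l \<bullet> b \<le> u \<bullet> b"
  have lin: "linear T" using T by (rule orthogonal_transformation_linear)
  have [measurable]: "T \<in> borel_measurable borel"
    using lin by (intro borel_measurable_continuous_onI linear_continuous_on) (simp add: linear_linear)
  have iT: "orthogonal_transformation (inv T)" using T by (rule orthogonal_transformation_inv)
  have eq: "T -` box l u = inv T ` box l u"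
    using T by (simp add: bij_vimage_eq_inv_image orthogonal_transformation_bij)
  have "emeasure (distr lborel borel T) (box l u) = emeasure lborel (T -` box l u)"
    by (subst emeasure_distr) auto
  also have "\<dots> = emeasure lebesgue (T -` box l u)"
    using measurable_sets_borel[OF \<open>T \<in> borel_measurable borel\<close>, of "box l u"] by simp
  also have "\<dots> = emeasure lebesgue (inv T ` box l u)" by (simp add: eq)
  also have "\<dots> = ennreal (measure lebesgue (inv T ` box l u))"
    using measurable_orthogonal_image[OF iT lmeasurable_box, of l u]
    by (intro emeasure_eq_measure2) (auto simp: fmeasurable_def less_top)
  also have "\<dots> = ennreal (measure lebesgue (box l u))"
    by (subst measure_orthogonal_image[OF iT]) auto
  also have "\<dots> = ennreal (prod ((\<bullet>) (u - l)) Basis)"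
    using le by (simp add: measure_lborel_box_eq)
  finally show "emeasure (distr lborel borel T) (box l u) = ennreal (prod ((\<bullet>) (u - l)) Basis)" .
qed simp

section \<open>The kernel of \<open>\<pi>\<^sub>K cos (t |\<nabla>|) |\<nabla>|\<^sup>-\<^sup>2\<close>\<close>

lemma indicator_ball_measurable [measurable]: "indicator (ball 0 K) \<in> borel_measurable (borel :: R3 measure)"
  by (intro borel_measurable_indicator) simp

lemma indicator_ball_norm_square:
  fixes \<xi> :: "'a::real_normed_vector"
  assumes "0 \<le> K"
  shows "indicator (ball 0 K) \<xi> = indicator {..<K\<^sup>2} ((norm \<xi>)\<^sup>2)"
  using assms real_sqrt_less_iff[of "(norm \<xi>)\<^sup>2" "K\<^sup>2"] by (auto simp: indicator_def)

text \<open>The inverse square is integrable at the origin in three dimensions: at |\<xi>|^2 = w the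
  heights |s| \<le> sqrt w contribute 2 \<pi> / sqrt w, and w = r^2 turns this into the constant
  density 4 \<pi> on [0, K].\<close>

lemma nn_integral_inverse_square_ball:
  assumes K: "0 \<le> K"
  shows "(\<integral>\<^sup>+\<xi>. ennreal (indicator (ball 0 K) \<xi> / (norm \<xi>)\<^sup>2) \<partial>(lborel :: R3 measure)) = ennreal (4 * pi * K)"
proof -
  define f :: "real \<Rightarrow> real" where "f = (\<lambda>w. 2 * pi * sqrt w / w)"
  have [measurable]: "f \<in> borel_measurable borel" unfolding f_def by measurable
  have [measurable]: "{p :: real \<times> real. (snd p)\<^sup>2 \<le> fst p} \<in> sets borel"
    by (auto intro!: borel_closed closed_Collect_le continuous_intros)
  have [measurable]: "(\<lambda>p::real \<times> real. ennreal (indicator {..<K\<^sup>2} (fst p) / fst p)) \<in> borel_measurable borel"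
  proof -
    have [measurable]: "(fst :: real \<times> real \<Rightarrow> real) \<in> borel_measurable borel"
      by (intro borel_measurable_continuous_onI continuous_intros)
    show ?thesis by measurable
  qed
  have "(\<integral>\<^sup>+\<xi>. ennreal (indicator (ball 0 K) \<xi> / (norm \<xi>)\<^sup>2) \<partial>(lborel :: R3 measure))
     = (\<integral>\<^sup>+\<xi>. ennreal (indicator {..<K\<^sup>2} ((norm \<xi>)\<^sup>2) / (norm \<xi>)\<^sup>2) \<partial>(lborel :: R3 measure))"
    by (simp only: indicator_ball_norm_square[OF K])
  also have "\<dots> = (\<integral>\<^sup>+p. ennreal pi * indicator {p. (snd p)\<^sup>2 \<le> fst p} p
       * ennreal (indicator {..<K\<^sup>2} (fst p) / fst p) \<partial>(lborel :: (real \<times> real) measure))"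
    by (subst nn_integral_norm_square_height[symmetric, where \<Psi>="\<lambda>p. ennreal (indicator {..<K\<^sup>2} (fst p) / fst p)"]) simp_all
  also have "\<dots> = (\<integral>\<^sup>+w. \<integral>\<^sup>+s. ennreal pi * indicator {p. (snd p)\<^sup>2 \<le> fst p} (w, s)
       * ennreal (indicator {..<K\<^sup>2} w / w) \<partial>lborel \<partial>lborel)"
    by (subst lborel.nn_integral_fst[symmetric, of _ lborel, unfolded lborel_prod]) simp_all
  also have "\<dots> = (\<integral>\<^sup>+w. ennreal (f w * indicator {0\<^sup>2..K\<^sup>2} w) \<partial>lborel)"
  proof (rule nn_integral_cong_AE)
    \<comment> \<open>The ball is open while the substitution rule wants a closed interval; the two
      differ at this single value.\<close>
    have "AE w in lborel. w \<noteq> K\<^sup>2" by (rule AE_lborel_singleton)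
    then show "AE w in lborel. (\<integral>\<^sup>+s. ennreal pi * indicator {p. (snd p)\<^sup>2 \<le> fst p} (w, s)
       * ennreal (indicator {..<K\<^sup>2} w / w) \<partial>lborel) = ennreal (f w * indicator {0\<^sup>2..K\<^sup>2} w)"
    proof (eventually_elim)
      fix w :: real assume w: "w \<noteq> K\<^sup>2"
      show "(\<integral>\<^sup>+s. ennreal pi * indicator {p. (snd p)\<^sup>2 \<le> fst p} (w, s)
       * ennreal (indicator {..<K\<^sup>2} w / w) \<partial>lborel) = ennreal (f w * indicator {0\<^sup>2..K\<^sup>2} w)"
      proof (cases "0 \<le> w \<and> w < K\<^sup>2")
        case True
        have "s\<^sup>2 \<le> w \<longleftrightarrow> - sqrt w \<le> s \<and> s \<le> sqrt w" for s
          using real_sqrt_le_iff[of "s\<^sup>2" w] by auto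
        then have "(\<integral>\<^sup>+s. ennreal pi * indicator {p. (snd p)\<^sup>2 \<le> fst p} (w, s)
            * ennreal (indicator {..<K\<^sup>2} w / w) \<partial>lborel)
          = (\<integral>\<^sup>+s. ennreal (pi / w) * indicator {- sqrt w..sqrt w} s \<partial>lborel)"
          using True by (intro nn_integral_cong) (auto simp: ennreal_mult[symmetric] split: split_indicator)
        also have "\<dots> = ennreal (pi / w) * ennreal (2 * sqrt w)"
          using True by (subst nn_integral_cmult_indicator) auto
        also have "\<dots> = ennreal (f w * indicator {0\<^sup>2..K\<^sup>2} w)"
          using True by (simp add: ennreal_mult[symmetric] f_def field_simps)
        finally show ?thesis .
      next
        case False
        have "\<not> s\<^sup>2 \<le> w" if "w < 0" for s using that zero_le_power2[of s] by linarith
        with False w have "(\<integral>\<^sup>+s. ennreal pi * indicator {p. (snd p)\<^sup>2 \<le> fst p} (w, s)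
            * ennreal (indicator {..<K\<^sup>2} w / w) \<partial>lborel) = (\<integral>\<^sup>+s. 0 \<partial>(lborel :: real measure))"
          by (intro nn_integral_cong) (auto split: split_indicator)
        then show ?thesis using False w by (auto split: split_indicator)
      qed
    qed
  qed
  also have "\<dots> = (\<integral>\<^sup>+r. ennreal (f (r\<^sup>2) * (2 * r) * indicator {0..K} r) \<partial>lborel)"
    using K by (intro nn_integral_substitution) (auto intro!: derivative_eq_intros continuous_intros simp: set_borel_measurable_def)
  also have "\<dots> = (\<integral>\<^sup>+r. ennreal (4 * pi) * indicator {0..K} r \<partial>lborel)"
    by (intro nn_integral_cong_AE, use AE_lborel_singleton[of "0::real"] in eventually_elim)
       (auto simp: f_def power2_eq_square split: split_indicator)
  also have "\<dots> = ennreal (4 * pi * K)"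
    using K by (subst nn_integral_cmult_indicator) (auto simp: ennreal_mult)
  finally show ?thesis .
qed

lemma inverse_square_ball:
  assumes K: "0 \<le> K"
  shows "integrable (lborel :: R3 measure) (\<lambda>\<xi>. indicator (ball 0 K) \<xi> / (norm \<xi>)\<^sup>2 :: real)"
    and "(LINT \<xi>|(lborel :: R3 measure). indicator (ball 0 K) \<xi> / (norm \<xi>)\<^sup>2) = 4 * pi * K"
proof -
  show i: "integrable (lborel :: R3 measure) (\<lambda>\<xi>. indicator (ball 0 K) \<xi> / (norm \<xi>)\<^sup>2 :: real)"
    using nn_integral_inverse_square_ball[OF K] by (intro integrableI_nn_integral_finite[where x="4 * pi * K"]) auto
  show "(LINT \<xi>|(lborel :: R3 measure). indicator (ball 0 K) \<xi> / (norm \<xi>)\<^sup>2) = 4 * pi * K"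
    using nn_integral_inverse_square_ball[OF K] K
    by (subst integral_eq_nn_integral) auto
qed

text \<open>The normalising factor of the inverse Fourier transform is left out, to match the
  unnormalised pairings in the Gram matrix. At \<xi> = 0 the quotient is 0 by convention.\<close>

definition wave_kernel :: "real \<Rightarrow> real \<Rightarrow> R3 \<Rightarrow> complex" where
  "wave_kernel K t z = (LINT \<xi>|lborel.
     complex_of_real (indicator (ball 0 K) \<xi> * cos (t * norm \<xi>) / (norm \<xi>)\<^sup>2) * cis (z \<bullet> \<xi>))"

lemma measurable_cis [measurable]: "cis \<in> borel_measurable borel"
  by (intro borel_measurable_continuous_onI continuous_intros)

lemma wave_kernel_integrand_le:
  fixes z \<xi> :: R3
  shows "norm (complex_of_real (indicator (ball 0 K) \<xi> * cos (t * norm \<xi>) / (norm \<xi>)\<^sup>2) * cis (z \<bullet> \<xi>))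
    \<le> indicator (ball 0 K) \<xi> / (norm \<xi>)\<^sup>2"
  unfolding norm_mult norm_cis norm_of_real
  by (auto simp: abs_mult abs_divide intro!: divide_right_mono split: split_indicator)

lemma wave_kernel_integrable:
  fixes z :: R3
  assumes K: "0 \<le> K"
  shows "integrable lborel (\<lambda>\<xi>.
     complex_of_real (indicator (ball 0 K) \<xi> * cos (t * norm \<xi>) / (norm \<xi>)\<^sup>2) * cis (z \<bullet> \<xi>))"
  by (rule Bochner_Integration.integrable_bound[OF inverse_square_ball(1)[OF K]])
     (use wave_kernel_integrand_le[of K _ t z] in \<open>auto intro!: AE_I2 intro: order_trans[OF _ abs_ge_self]\<close>)

lemma wave_kernel_le:
  assumes K: "0 \<le> K"
  shows "norm (wave_kernel K t z) \<le> 4 * pi * K"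
  unfolding wave_kernel_def inverse_square_ball(2)[OF K, symmetric]
  by (rule Bochner_Integration.integral_norm_bound_integral[OF wave_kernel_integrable[OF K] inverse_square_ball(1)[OF K] wave_kernel_integrand_le])

lemma integral_cis_symmetric_interval:
  fixes a \<rho> :: real
  assumes a: "0 \<le> a"
  shows "(LINT s|lborel. indicator {-a..a} s *\<^sub>R cis (\<rho> * s)) = complex_of_real (2 * a * sinc (\<rho> * a))"
proof (cases "\<rho> = 0")
  case True
  then show ?thesis using a by (simp add: scaleR_conv_of_real)
next
  case False
  have "(LINT s|lborel. indicator {-a..a} s *\<^sub>R cis (\<rho> * s)) = cis (\<rho> * a) / (\<i> * \<rho>) - cis (\<rho> * (- a)) / (\<i> * \<rho>)"
  proof (rule integral_FTC_Icc)
    fix x assume "-a \<le> x" "x \<le> a"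
    have "((\<lambda>x. exp (\<i> * (\<rho> * x)) / (\<i> * \<rho>)) has_field_derivative exp (\<i> * (\<rho> * complex_of_real x))) (at (complex_of_real x))"
      using False by (auto intro!: derivative_eq_intros simp: field_simps)
    from has_vector_derivative_real_field[OF this]
    show "((\<lambda>x. cis (\<rho> * x) / (\<i> * \<rho>)) has_vector_derivative cis (\<rho> * x)) (at x within {-a..a})"
      by (simp add: cis_conv_exp)
  qed (use a in \<open>auto intro!: continuous_intros\<close>)
  also have "\<dots> = (cis (\<rho> * a) - cis (\<rho> * (- a))) / (\<i> * \<rho>)" by (rule diff_divide_distrib[symmetric])
  also have "cis (\<rho> * a) - cis (\<rho> * (- a)) = \<i> * complex_of_real (2 * sin (\<rho> * a))"
    by (simp add: complex_eq_iff)
  also have "\<dots> / (\<i> * \<rho>) = complex_of_real (2 * a * sinc (\<rho> * a))"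
    using False by (cases "a = 0") auto
  finally show ?thesis .
qed

text \<open>For a vertical point the integrand depends on |\<xi>|^2 and the height only. Integrating
  out the height gives 2 sqrt w sinc(\<rho> sqrt w), and with w = r^2 the factors \<pi> / r^2, 2 r
  and 2 r combine to 4 \<pi>.\<close>

lemma wave_kernel_polar:
  assumes K: "0 \<le> K" and \<rho>: "0 \<le> \<rho>"
  shows "wave_kernel K t (axis 3 \<rho>)
    = complex_of_real (4 * pi * (LINT r|lborel. cos (t * r) * sinc (\<rho> * r) * indicator {0..K} r))"
proof -
  define \<Psi> where "\<Psi> = (\<lambda>p::real \<times> real. complex_of_real (indicator {..<K\<^sup>2} (fst p) * cos (t * sqrt (fst p)) / fst p) * cis (\<rho> * snd p))"
  define D where "D = {p :: real \<times> real. (snd p)\<^sup>2 \<le> fst p}"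
  define f where "f = (\<lambda>w. pi * cos (t * sqrt w) / w * (2 * sqrt w * sinc (\<rho> * sqrt w)))"
  have [measurable]: "(fst :: real \<times> real \<Rightarrow> real) \<in> borel_measurable borel"
    "(snd :: real \<times> real \<Rightarrow> real) \<in> borel_measurable borel"
    by (intro borel_measurable_continuous_onI continuous_intros)+
  have [measurable]: "D \<in> sets borel" unfolding D_def
    by (auto intro!: borel_closed closed_Collect_le continuous_intros)
  have [measurable]: "\<Psi> \<in> borel_measurable borel" unfolding \<Psi>_def by measurable
  have [measurable]: "(\<lambda>\<xi>::R3. ((norm \<xi>)\<^sup>2, \<xi> $ 3)) \<in> borel_measurable borel"
    by (intro borel_measurable_continuous_onI continuous_intros)
  have eq: "complex_of_real (indicator (ball 0 K) \<xi> * cos (t * norm \<xi>) / (norm \<xi>)\<^sup>2) * cis ((axis 3 \<rho> :: R3) \<bullet> \<xi>)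
     = \<Psi> ((norm \<xi>)\<^sup>2, \<xi> $ 3)" for \<xi> :: R3
    by (simp add: \<Psi>_def inner_axis' indicator_ball_norm_square[OF K])
  have dens: "distr lborel borel (\<lambda>\<xi>::R3. ((norm \<xi>)\<^sup>2, \<xi> $ 3)) = density lborel (\<lambda>p. ennreal (pi * indicator D p))"
    unfolding distr_norm_square_height D_def by (intro arg_cong2[where f=density]) (auto split: split_indicator)
  have "integrable (distr lborel borel (\<lambda>\<xi>::R3. ((norm \<xi>)\<^sup>2, \<xi> $ 3))) \<Psi>"
    using wave_kernel_integrable[OF K, of t "axis 3 \<rho>"] unfolding eq by (subst integrable_distr_eq) auto
  then have int: "integrable (lborel \<Otimes>\<^sub>M lborel) (\<lambda>p. (pi * indicator D p) *\<^sub>R \<Psi> p)"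
    unfolding dens lborel_prod by (subst (asm) integrable_density) auto
  have inner: "(LINT s|lborel. (pi * indicator D (w, s)) *\<^sub>R \<Psi> (w, s)) = complex_of_real (indicator {0..<K\<^sup>2} w * f w)" for w
  proof (cases "0 \<le> w")
    case True
    have "s\<^sup>2 \<le> w \<longleftrightarrow> - sqrt w \<le> s \<and> s \<le> sqrt w" for s
      using True real_sqrt_le_iff[of "s\<^sup>2" w] by auto
    then have "(LINT s|lborel. (pi * indicator D (w, s)) *\<^sub>R \<Psi> (w, s))
      = (LINT s|lborel. complex_of_real (pi * indicator {..<K\<^sup>2} w * cos (t * sqrt w) / w) * (indicator {- sqrt w..sqrt w} s *\<^sub>R cis (\<rho> * s)))"
      by (intro Bochner_Integration.integral_cong) (auto simp: D_def \<Psi>_def scaleR_conv_of_real split: split_indicator)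
    also have "\<dots> = complex_of_real (pi * indicator {..<K\<^sup>2} w * cos (t * sqrt w) / w) * complex_of_real (2 * sqrt w * sinc (\<rho> * sqrt w))"
      using True by (subst integral_mult_right_zero, subst integral_cis_symmetric_interval) auto
    also have "\<dots> = complex_of_real (indicator {0..<K\<^sup>2} w * f w)"
      using True unfolding of_real_mult[symmetric] f_def by (intro arg_cong[where f=complex_of_real]) (auto split: split_indicator)
    finally show ?thesis .
  next
    case False
    have "\<not> s\<^sup>2 \<le> w" for s using False zero_le_power2[of s] by linarith
    then show ?thesis using False by (simp add: D_def)
  qed
  have AE1: "AE w in lborel. indicator {0..<K\<^sup>2} w * f w = indicator {0\<^sup>2..K\<^sup>2} w * f w"
    using AE_lborel_singleton[of "K\<^sup>2"] by eventually_elim (auto split: split_indicator)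
  have [measurable]: "f \<in> borel_measurable borel" unfolding f_def by measurable
  have "integrable lborel (\<lambda>w. complex_of_real (indicator {0..<K\<^sup>2} w * f w))"
    using lborel_pair.integrable_fst'[OF int] unfolding inner .
  then have "integrable lborel (\<lambda>w. indicator {0..<K\<^sup>2} w * f w)"
    unfolding complex_of_real_integrable_eq .
  then have setint: "set_integrable lborel {0\<^sup>2..K\<^sup>2} f"
    unfolding set_integrable_def real_scaleR_def
    by (subst integrable_cong_AE[OF _ _ AE1, symmetric]) auto
  have "wave_kernel K t (axis 3 \<rho>) = (LINT \<xi>|(lborel :: R3 measure). \<Psi> ((norm \<xi>)\<^sup>2, \<xi> $ 3))"
    unfolding wave_kernel_def eq ..
  also have "\<dots> = (LINT p|distr lborel borel (\<lambda>\<xi>::R3. ((norm \<xi>)\<^sup>2, \<xi> $ 3)). \<Psi> p)"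
    by (subst integral_distr) auto
  also have "\<dots> = (LINT p|(lborel \<Otimes>\<^sub>M lborel). (pi * indicator D p) *\<^sub>R \<Psi> p)"
    unfolding dens lborel_prod by (subst integral_density) auto
  also have "\<dots> = (LINT w|lborel. LINT s|lborel. (pi * indicator D (w, s)) *\<^sub>R \<Psi> (w, s))"
    by (rule lborel_pair.integral_fst'[symmetric]) (rule int)
  also have "\<dots> = complex_of_real (LINT w|lborel. indicator {0..<K\<^sup>2} w * f w)"
    unfolding inner by (rule integral_complex_of_real)
  also have "(LINT w|lborel. indicator {0..<K\<^sup>2} w * f w) = (LINT w|lborel. f w * indicator {0\<^sup>2..K\<^sup>2} w)"
    using AE1 by (intro integral_cong_AE) (auto simp: mult.commute)
  also have "\<dots> = (LINT r|lborel. f (r\<^sup>2) * (2 * r) * indicator {0..K} r)"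
    using K setint by (intro integral_substitution) (auto intro!: derivative_eq_intros continuous_intros)
  also have "\<dots> = (LINT r|lborel. 4 * pi * (cos (t * r) * sinc (\<rho> * r) * indicator {0..K} r))"
  proof (rule integral_cong_AE)
    show "AE r in lborel. f (r\<^sup>2) * (2 * r) * indicator {0..K} r = 4 * pi * (cos (t * r) * sinc (\<rho> * r) * indicator {0..K} r)"
      using AE_lborel_singleton[of "0::real"] by eventually_elim (auto simp: f_def field_simps power2_eq_square split: split_indicator)
  qed auto
  finally show ?thesis by simp
qed

text \<open>The product formula for cos(t r) sin(\<rho> r) yields two values of the sine integral
  divided by 2 \<rho>. Boundedness suffices as long as \<rho> \<ge> t / 2; for smaller \<rho> the
  division is dangerous, but then the two values are close to each other.\<close>

lemma sine_integral_decay: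
  "\<exists>B\<ge>0. \<forall>K \<rho> t::real. 0 \<le> K \<longrightarrow> 0 \<le> \<rho> \<longrightarrow> 0 < t \<longrightarrow>
     \<bar>LINT r|lborel. cos (t * r) * sinc (\<rho> * r) * indicator {0..K} r\<bar> \<le> B / t"
proof -
  obtain B where B: "\<bar>Si T\<bar> \<le> B" for T using bounded_Si by blast
  have B0: "0 \<le> B" using B[of 0] by linarith
  \<comment> \<open>The summand 2 B serves the range \<rho> \<ge> t / 2, the summand 2 the range
    below, including \<rho> = 0.\<close>
  have "\<bar>LINT r|lborel. cos (t * r) * sinc (\<rho> * r) * indicator {0..K} r\<bar> \<le> (2 * B + 2) / t"
    if K: "0 \<le> K" and \<rho>: "0 \<le> \<rho>" and t: "0 < t" for K \<rho> t :: real
  proof (cases "\<rho> = 0")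
    case True
    have "(LINT r|lborel. indicator {0..K} r *\<^sub>R cos (t * r)) = sin (t * K) / t - sin (t * 0) / t"
    proof (rule integral_FTC_Icc)
      fix x show "((\<lambda>x. sin (t * x) / t) has_vector_derivative cos (t * x)) (at x within {0..K})"
        unfolding has_real_derivative_iff_has_vector_derivative[symmetric]
        using t by (auto intro!: derivative_eq_intros)
    qed (use K in \<open>auto intro!: continuous_intros\<close>)
    then have "(LINT r|lborel. cos (t * r) * sinc (\<rho> * r) * indicator {0..K} r) = sin (t * K) / t"
      using True by (simp add: mult.commute)
    also have "\<bar>sin (t * K) / t\<bar> \<le> 1 / t" using t by (simp add: divide_right_mono)
    also have "\<dots> \<le> (2 * B + 2) / t" using t B0 by (intro divide_right_mono) auto
    finally show ?thesis .
  next
    case False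
    then have \<rho>0: "0 < \<rho>" using \<rho> by simp
    have LB: "(LINT r|lborel. g r * indicator {0..K} r) = (LBINT r=0..K. g r)" for g :: "real \<Rightarrow> real"
      using K by (simp add: interval_integral_Icc set_lebesgue_integral_def zero_ereal_def mult.commute)
    have "(LINT r|lborel. cos (t * r) * sinc (\<rho> * r) * indicator {0..K} r)
       = (LINT r|lborel. (sin (r * (\<rho> + t)) / r + sin (r * (\<rho> - t)) / r) / (2 * \<rho>) * indicator {0..K} r)"
    proof (rule integral_cong_AE)
      show "AE r in lborel. cos (t * r) * sinc (\<rho> * r) * indicator {0..K} r
          = (sin (r * (\<rho> + t)) / r + sin (r * (\<rho> - t)) / r) / (2 * \<rho>) * indicator {0..K} r"
        using AE_lborel_singleton[of "0::real"]
      proof eventually_elim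
        fix r :: real assume "r \<noteq> 0"
        moreover have "sin (r * (\<rho> + t)) + sin (r * (\<rho> - t)) = 2 * sin (\<rho> * r) * cos (t * r)"
          by (simp add: distrib_left right_diff_distrib sin_add sin_diff mult.commute)
        ultimately show "cos (t * r) * sinc (\<rho> * r) * indicator {0..K} r
          = (sin (r * (\<rho> + t)) / r + sin (r * (\<rho> - t)) / r) / (2 * \<rho>) * indicator {0..K} r"
          using \<rho>0 by (simp add: add_divide_distrib[symmetric] mult_ac)
      qed
    qed auto
    also have "\<dots> = (LBINT r=0..K. (sin (r * (\<rho> + t)) / r + sin (r * (\<rho> - t)) / r) / (2 * \<rho>))"
      by (rule LB)
    also have "\<dots> = ((LBINT r=0..K. sin (r * (\<rho> + t)) / r) + (LBINT r=0..K. sin (r * (\<rho> - t)) / r)) / (2 * \<rho>)"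
      using K integrable_sinc'[of K] by (subst interval_lebesgue_integral_divide, subst interval_lebesgue_integral_add) (auto simp: zero_ereal_def)
    \<comment> \<open>On the light cone \<rho> = t the second term vanishes because sgn 0 = 0;
      nothing blows up there.\<close>
    also have "\<dots> = (Si (K * (\<rho> + t)) + sgn (\<rho> - t) * Si (K * \<bar>\<rho> - t\<bar>)) / (2 * \<rho>)"
      using K \<rho>0 t by (simp add: LBINT_I0c_sin_scale_divide)
    finally have eq: "(LINT r|lborel. cos (t * r) * sinc (\<rho> * r) * indicator {0..K} r)
       = (Si (K * (\<rho> + t)) + sgn (\<rho> - t) * Si (K * \<bar>\<rho> - t\<bar>)) / (2 * \<rho>)" .
    show ?thesis
    proof (cases "t \<le> 2 * \<rho>")
      case True
      have le: "\<bar>Si (K * (\<rho> + t)) + sgn (\<rho> - t) * Si (K * \<bar>\<rho> - t\<bar>)\<bar> \<le> 2 * B"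
        using B[of "K * (\<rho> + t)"] B[of "K * \<bar>\<rho> - t\<bar>"] by (auto simp: sgn_if)
      then have "\<bar>(Si (K * (\<rho> + t)) + sgn (\<rho> - t) * Si (K * \<bar>\<rho> - t\<bar>)) / (2 * \<rho>)\<bar> \<le> (2 * B) / (2 * \<rho>)"
        using divide_right_mono[OF le, of "2 * \<rho>"] \<rho>0 by (simp add: abs_divide)
      also have "\<dots> \<le> (2 * B) / t" using True t B0 by (intro divide_left_mono) auto
      also have "\<dots> \<le> (2 * B + 2) / t" using t by (intro divide_right_mono) auto
      finally show ?thesis unfolding eq .
    next
      case False
      show ?thesis
      proof (cases "K = 0")
        \<comment> \<open>Oddness of the sine integral at 0 is used to get Si 0 = 0.\<close>
        case True then show ?thesis using t B0 Si_neg[of 0] unfolding eq by simp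
      next
        case K0: False
        have lt: "K * (t - \<rho>) < K * (t + \<rho>)" using K K0 \<rho>0 by simp
        \<comment> \<open>Here sgn(\<rho> - t) = -1, so the values are subtracted. The mean value
          theorem supplies a factor 2 K \<rho> that cancels the small denominator, and |sinc x|
          \<le> 2 / (K t) since x lies beyond K (t - \<rho>) \<ge> K t / 2.\<close>
        obtain x where x: "K * (t - \<rho>) < x" "x < K * (t + \<rho>)"
          and mv: "Si (K * (t + \<rho>)) - Si (K * (t - \<rho>)) = (K * (t + \<rho>) - K * (t - \<rho>)) * sinc x"
          using MVT2[OF lt DERIV_Si] by blast
        have xt: "K * (t / 2) \<le> K * (t - \<rho>)" using False K by (intro mult_left_mono) auto
        have pos: "0 < K * (t / 2)" using K K0 t by simp
        have "\<bar>sinc x\<bar> \<le> 1 / x" using x xt pos by (auto simp: divide_right_mono)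
        also have "\<dots> \<le> 1 / (K * (t / 2))" using x xt pos by (intro divide_left_mono) auto
        finally have s: "\<bar>sinc x\<bar> \<le> 1 / (K * (t / 2))" .
        have "\<bar>(Si (K * (\<rho> + t)) + sgn (\<rho> - t) * Si (K * \<bar>\<rho> - t\<bar>)) / (2 * \<rho>)\<bar>
            = \<bar>Si (K * (t + \<rho>)) - Si (K * (t - \<rho>))\<bar> / (2 * \<rho>)"
        proof -
          have "Si (K * (\<rho> + t)) + sgn (\<rho> - t) * Si (K * \<bar>\<rho> - t\<bar>) = Si (K * (t + \<rho>)) - Si (K * (t - \<rho>))"
            using False \<rho>0 by (simp add: sgn_if add.commute)
          then show ?thesis using \<rho>0 by (simp add: abs_divide)
        qed
        also have "\<dots> = K * \<bar>sinc x\<bar>" unfolding mv using \<rho>0 K by (simp add: abs_mult right_diff_distrib distrib_left)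
        also have "\<dots> \<le> K * (1 / (K * (t / 2)))" using s K by (intro mult_left_mono) auto
        also have "\<dots> = 2 / t" using K0 by simp
        also have "\<dots> \<le> (2 * B + 2) / t" using t B0 by (intro divide_right_mono) auto
        finally show ?thesis unfolding eq .
      qed
    qed
  qed
  then show ?thesis using B0 by (intro exI[of _ "2 * B + 2"]) auto
qed

lemma wave_kernel_rotate:
  assumes T: "orthogonal_transformation T"
  shows "wave_kernel K t (T z) = wave_kernel K t z"
proof -
  have lin: "linear T" using T by (rule orthogonal_transformation_linear)
  have [measurable]: "T \<in> borel_measurable borel"
    using lin by (intro borel_measurable_continuous_onI linear_continuous_on) (simp add: linear_linear)
  have "wave_kernel K t (T z) = (LINT \<xi>|distr lborel borel T.
     complex_of_real (indicator (ball 0 K) \<xi> * cos (t * norm \<xi>) / (norm \<xi>)\<^sup>2) * cis (T z \<bullet> \<xi>))"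
    unfolding wave_kernel_def orthogonal_transformation_distr_lborel[OF T] ..
  also have "\<dots> = (LINT \<xi>|lborel.
     complex_of_real (indicator (ball 0 K) (T \<xi>) * cos (t * norm (T \<xi>)) / (norm (T \<xi>))\<^sup>2) * cis (T z \<bullet> T \<xi>))"
    by (subst integral_distr) auto
  also have "\<dots> = wave_kernel K t z"
    using T unfolding wave_kernel_def
    by (intro Bochner_Integration.integral_cong)
       (auto simp: orthogonal_transformation_norm orthogonal_transformation_def split: split_indicator)
  finally show ?thesis .
qed

lemma wave_kernel_bound:
  "\<exists>C\<ge>1. \<forall>K t z. 0 \<le> K \<longrightarrow> norm (wave_kernel K t z) \<le> C * K \<and> (0 < t \<longrightarrow> norm (wave_kernel K t z) \<le> C / t)"
proof -
  obtain B where B0: "0 \<le> B" and B: "\<And>K \<rho> t::real. 0 \<le> K \<Longrightarrow> 0 \<le> \<rho> \<Longrightarrow> 0 < t \<Longrightarrow>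
     \<bar>LINT r|lborel. cos (t * r) * sinc (\<rho> * r) * indicator {0..K} r\<bar> \<le> B / t"
    using sine_integral_decay by blast
  have pi1: "4 * pi \<ge> 1" using pi_ge_two by linarith
  \<comment> \<open>Dominates both the 4 \<pi> of the trivial bound and the 4 \<pi> B of the
    decay.\<close>
  define C where "C = 4 * pi * (B + 1)"
  have C4: "4 * pi \<le> C" unfolding C_def using B0 by simp
  have "norm (wave_kernel K t z) \<le> C / t" if K: "0 \<le> K" and t: "0 < t" for K t z
  proof -
    obtain T :: "R3 \<Rightarrow> R3" where T: "orthogonal_transformation T" and Tz: "T (axis 3 (norm z)) = z"
      by (rule orthogonal_transformation_exists[of "axis 3 (norm z)" z]) (auto simp: norm_eq_sqrt_inner inner_axis_axis)
    have "norm (wave_kernel K t z) = norm (wave_kernel K t (axis 3 (norm z)))"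
      using wave_kernel_rotate[OF T, of K t "axis 3 (norm z)"] Tz by simp
    also have "\<dots> = 4 * pi * \<bar>LINT r|lborel. cos (t * r) * sinc (norm z * r) * indicator {0..K} r\<bar>"
      unfolding wave_kernel_polar[OF K norm_ge_zero] norm_of_real by (simp add: abs_mult)
    also have "\<dots> \<le> 4 * pi * (B / t)" using B[OF K norm_ge_zero t, of z] by (intro mult_left_mono) auto
    also have "\<dots> \<le> C / t" unfolding C_def using t by (simp add: divide_right_mono)
    finally show ?thesis .
  qed
  moreover have "norm (wave_kernel K t z) \<le> C * K" if K: "0 \<le> K" for K t z
    using wave_kernel_le[OF K, of t z] mult_right_mono[OF C4 K] by linarith
  ultimately show ?thesis using C4 pi1 by (intro exI[of _ C]) auto
qed

section \<open>Gram matrices\<close>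

lemma integrable_mult_L2:
  fixes f g :: "'a \<Rightarrow> complex"
  assumes [measurable]: "f \<in> borel_measurable M" "g \<in> borel_measurable M"
    and f: "integrable M (\<lambda>x. (norm (f x))\<^sup>2)" and g: "integrable M (\<lambda>x. (norm (g x))\<^sup>2)"
  shows "integrable M (\<lambda>x. f x * g x)"
proof (rule Bochner_Integration.integrable_bound[OF Bochner_Integration.integrable_add[OF f g]])
  show "AE x in M. norm (f x * g x) \<le> norm ((norm (f x))\<^sup>2 + (norm (g x))\<^sup>2)"
  proof (rule AE_I2)
    fix x
    have "2 * norm (f x) * norm (g x) \<le> (norm (f x))\<^sup>2 + (norm (g x))\<^sup>2"
      by (rule sum_squares_bound)
    moreover have "0 \<le> norm (f x) * norm (g x)" by simp
    ultimately show "norm (f x * g x) \<le> norm ((norm (f x))\<^sup>2 + (norm (g x))\<^sup>2)"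
      unfolding norm_mult real_norm_def by linarith
  qed
qed simp

text \<open>The integral of (x |f| - |g|)^2 is a nonnegative quadratic in x; it is evaluated at its
  minimum c / a, or shown to be constant when a = 0.\<close>

lemma Cauchy_Schwarz_L2:
  fixes f g :: "'a \<Rightarrow> complex"
  assumes [measurable]: "f \<in> borel_measurable M" "g \<in> borel_measurable M"
    and f: "integrable M (\<lambda>x. (norm (f x))\<^sup>2)" and g: "integrable M (\<lambda>x. (norm (g x))\<^sup>2)"
  shows "(norm (LINT x|M. f x * g x))\<^sup>2 \<le> (LINT x|M. (norm (f x))\<^sup>2) * (LINT x|M. (norm (g x))\<^sup>2)"
proof -
  define a b c where "a = (LINT x|M. (norm (f x))\<^sup>2)" and "b = (LINT x|M. (norm (g x))\<^sup>2)"
    and "c = (LINT x|M. norm (f x) * norm (g x))"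
  have fg: "integrable M (\<lambda>x. norm (f x) * norm (g x))"
    using integrable_norm[OF integrable_mult_L2[OF assms]] by (simp add: norm_mult)
  have q: "0 \<le> a * x\<^sup>2 - 2 * c * x + b" for x
  proof -
    have "0 \<le> (LINT y|M. (x * norm (f y) - norm (g y))\<^sup>2)" by simp
    also have "\<dots> = (LINT y|M. x\<^sup>2 * (norm (f y))\<^sup>2 - (2 * x) * (norm (f y) * norm (g y)) + (norm (g y))\<^sup>2)"
      by (intro Bochner_Integration.integral_cong) (auto simp: power2_eq_square algebra_simps)
    also have "\<dots> = x\<^sup>2 * a - (2 * x) * c + b"
      unfolding a_def b_def c_def using f g fg by simp
    finally show ?thesis by (simp add: mult_ac)
  qed
  have c0: "0 \<le> c" unfolding c_def by simp
  have a0: "0 \<le> a" unfolding a_def by simp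
  have "c\<^sup>2 \<le> a * b"
  proof (cases "a = 0")
    case True
    have "c = 0"
    proof (rule ccontr)
      assume "c \<noteq> 0"
      \<comment> \<open>With a = 0 the quadratic is linear and takes the value -1 at this
        point.\<close>
      then show False using q[of "(b + 1) / (2 * c)"] True by simp
    qed
    then show ?thesis using True by simp
  next
    case False
    then have "0 \<le> a * (a * (c / a)\<^sup>2 - 2 * c * (c / a) + b)"
      using q[of "c / a"] a0 by simp
    also have "\<dots> = a * b - c\<^sup>2" using False by (simp add: field_simps power2_eq_square)
    finally show ?thesis by simp
  qed
  moreover have "norm (LINT x|M. f x * g x) \<le> c"
    unfolding c_def norm_mult[symmetric] by (rule integral_norm_bound)
  then have "(norm (LINT x|M. f x * g x))\<^sup>2 \<le> c\<^sup>2" by (intro power_mono) auto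
  ultimately show ?thesis unfolding a_def b_def by linarith
qed

lemma measurable_cnj [measurable]: "cnj \<in> borel_measurable borel"
  by (intro borel_measurable_continuous_onI continuous_intros)

text \<open>The \<open>T T\<^sup>*\<close> argument for the analysis operator \<open>h \<mapsto> (\<integral> e\<^sub>k h)\<^sub>k\<close>,
  followed by Schur's test for the Gram matrix of the \<open>e\<^sub>k\<close>.\<close>

lemma analysis_operator_bound:
  fixes e :: "nat \<Rightarrow> 'a \<Rightarrow> complex" and h :: "'a \<Rightarrow> complex" and m :: "nat \<Rightarrow> nat \<Rightarrow> real"
  assumes [measurable]: "\<And>k. e k \<in> borel_measurable M" "h \<in> borel_measurable M"
    and e: "\<And>k. integrable M (\<lambda>x. (norm (e k x))\<^sup>2)" and h: "integrable M (\<lambda>x. (norm (h x))\<^sup>2)"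
    and gram: "\<And>k l. norm (LINT x|M. e k x * cnj (e l x)) \<le> m k l"
    and sym: "\<And>k l. m k l = m l k"
    and row: "\<And>k. k \<le> N \<Longrightarrow> (\<Sum>l\<le>N. m k l) \<le> R"
  shows "(\<Sum>k\<le>N. (norm (LINT x|M. e k x * h x))\<^sup>2) \<le> R * (LINT x|M. (norm (h x))\<^sup>2)"
proof -
  define a where "a k = (LINT x|M. e k x * h x)" for k
  \<comment> \<open>W is synthesised from the coefficients themselves: paired with h it gives s,
    while its squared norm is a Gram form bounded by R s, so that Cauchy-Schwarz leaves one factor s
    to cancel.\<close>
  define W where "W x = (\<Sum>k\<le>N. cnj (a k) * e k x)" for x
  define s where "s = (\<Sum>k\<le>N. (norm (a k))\<^sup>2)"
  have [measurable]: "W \<in> borel_measurable M" unfolding W_def by measurable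
  have eh: "integrable M (\<lambda>x. e k x * h x)" for k
    by (rule integrable_mult_L2) (auto intro: e h)
  have ee: "integrable M (\<lambda>x. e k x * cnj (e l x))" for k l
    by (rule integrable_mult_L2) (auto intro: e)
  have m0: "0 \<le> m k l" for k l using gram[of k l] norm_ge_zero order_trans by blast
  have s0: "0 \<le> s" unfolding s_def by (intro sum_nonneg) auto
  have R0: "0 \<le> R" using row[of 0] sum_nonneg[of "{..N}" "m 0"] m0 by force
  have "(LINT x|M. W x * h x) = (\<Sum>k\<le>N. cnj (a k) * a k)"
    unfolding W_def a_def sum_distrib_right mult.assoc
    by (subst Bochner_Integration.integral_sum) (auto intro: eh)
  also have "\<dots> = complex_of_real s"
    unfolding s_def of_real_sum by (intro sum.cong refl) (simp only: complex_norm_square mult.commute)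
  finally have Wh: "(LINT x|M. W x * h x) = complex_of_real s" .
  have WW: "complex_of_real ((norm (W x))\<^sup>2) = (\<Sum>k\<le>N. \<Sum>l\<le>N. (cnj (a k) * a l) * (e k x * cnj (e l x)))" for x
    unfolding complex_norm_square W_def cnj_sum sum_product by (simp add: mult_ac)
  have Wc: "integrable M (\<lambda>x. complex_of_real ((norm (W x))\<^sup>2))"
    unfolding WW by (intro Bochner_Integration.integrable_sum integrable_mult_right ee)
  then have Wint: "integrable M (\<lambda>x. (norm (W x))\<^sup>2)" unfolding complex_of_real_integrable_eq .
  have "complex_of_real (LINT x|M. (norm (W x))\<^sup>2) = (LINT x|M. complex_of_real ((norm (W x))\<^sup>2))"
    by (rule integral_complex_of_real[symmetric])
  also have "\<dots> = (\<Sum>k\<le>N. \<Sum>l\<le>N. (cnj (a k) * a l) * (LINT x|M. e k x * cnj (e l x)))"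
    unfolding WW by (subst Bochner_Integration.integral_sum, (intro Bochner_Integration.integrable_sum integrable_mult_right ee)[1],
       subst Bochner_Integration.integral_sum, (intro integrable_mult_right ee)[1], simp)
  finally have "norm (complex_of_real (LINT x|M. (norm (W x))\<^sup>2))
      = norm (\<Sum>k\<le>N. \<Sum>l\<le>N. (cnj (a k) * a l) * (LINT x|M. e k x * cnj (e l x)))" by simp
  also have "\<dots> \<le> (\<Sum>k\<le>N. \<Sum>l\<le>N. norm ((cnj (a k) * a l) * (LINT x|M. e k x * cnj (e l x))))"
    by (intro order_trans[OF norm_sum] sum_mono norm_sum)
  \<comment> \<open>Schur's test: a product of two coefficients is at most half the sum of their
    squares, and the symmetry of m makes the two resulting double sums equal.\<close>
  also have "\<dots> \<le> (\<Sum>k\<le>N. \<Sum>l\<le>N. ((norm (a k))\<^sup>2 * m k l + (norm (a l))\<^sup>2 * m k l) / 2)"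
  proof (intro sum_mono)
    fix k l
    have "norm ((cnj (a k) * a l) * (LINT x|M. e k x * cnj (e l x))) \<le> (norm (a k) * norm (a l)) * m k l"
      using gram[of k l] by (simp add: norm_mult mult_left_mono)
    also have "\<dots> \<le> (((norm (a k))\<^sup>2 + (norm (a l))\<^sup>2) / 2) * m k l"
      using sum_squares_bound[of "norm (a k)" "norm (a l)"] m0[of k l] by (intro mult_right_mono) auto
    finally show "norm ((cnj (a k) * a l) * (LINT x|M. e k x * cnj (e l x)))
      \<le> ((norm (a k))\<^sup>2 * m k l + (norm (a l))\<^sup>2 * m k l) / 2" by (simp add: distrib_right)
  qed
  also have "\<dots> = ((\<Sum>k\<le>N. \<Sum>l\<le>N. (norm (a k))\<^sup>2 * m k l) + (\<Sum>k\<le>N. \<Sum>l\<le>N. (norm (a l))\<^sup>2 * m k l)) / 2"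
    by (simp add: sum.distrib sum_divide_distrib[symmetric])
  also have "(\<Sum>k\<le>N. \<Sum>l\<le>N. (norm (a l))\<^sup>2 * m k l) = (\<Sum>k\<le>N. \<Sum>l\<le>N. (norm (a k))\<^sup>2 * m k l)"
    by (subst sum.swap) (simp add: sym)
  also have "((\<Sum>k\<le>N. \<Sum>l\<le>N. (norm (a k))\<^sup>2 * m k l) + (\<Sum>k\<le>N. \<Sum>l\<le>N. (norm (a k))\<^sup>2 * m k l)) / 2
      = (\<Sum>k\<le>N. (norm (a k))\<^sup>2 * (\<Sum>l\<le>N. m k l))"
    unfolding sum_distrib_left by simp
  also have "\<dots> \<le> (\<Sum>k\<le>N. (norm (a k))\<^sup>2 * R)"
    by (intro sum_mono mult_left_mono row) auto
  also have "\<dots> = R * s" unfolding s_def by (simp add: sum_distrib_left mult.commute)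
  finally have WR: "(LINT x|M. (norm (W x))\<^sup>2) \<le> R * s" by simp
  have "s\<^sup>2 = (norm (LINT x|M. W x * h x))\<^sup>2" unfolding Wh by simp
  also have "\<dots> \<le> (LINT x|M. (norm (W x))\<^sup>2) * (LINT x|M. (norm (h x))\<^sup>2)"
    by (rule Cauchy_Schwarz_L2) (auto intro: Wint h)
  also have "\<dots> \<le> (R * s) * (LINT x|M. (norm (h x))\<^sup>2)"
    using WR by (intro mult_right_mono) auto
  finally have "s * s \<le> s * (R * (LINT x|M. (norm (h x))\<^sup>2))" by (simp add: power2_eq_square mult_ac)
  then have "s \<le> R * (LINT x|M. (norm (h x))\<^sup>2)"
    using s0 R0 by (cases "s = 0") auto
  then show ?thesis unfolding s_def a_def .
qed

section \<open>Row sums of the Gram matrix\<close>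

lemma harm_le_ln: "0 < n \<Longrightarrow> (\<Sum>k=1..n. 1 / real k) \<le> 1 + ln (real n)"
proof (induction n rule: nat_induct_non_zero)
  case (Suc n)
  have "1 / real (Suc n) \<le> ln (real (Suc n)) - ln (real n)"
  proof -
    have "ln (real n / real (Suc n)) \<le> real n / real (Suc n) - 1"
      using Suc.hyps by (intro ln_le_minus_one) auto
    also have "\<dots> = - (1 / real (Suc n))" by (simp add: field_simps)
    finally show ?thesis using Suc.hyps by (simp add: ln_div)
  qed
  with Suc.IH show ?case by simp
qed simp

text \<open>For K \<ge> 1 / \<tau> this is the minimum of K and 1 / t at the time t = j \<tau>, with
  1 / 0 read as infinity.\<close>

definition wave_weight :: "real \<Rightarrow> real \<Rightarrow> nat \<Rightarrow> real" where
  "wave_weight K \<tau> j = (if j = 0 then K else 1 / (real j * \<tau>))"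

text \<open>Each value of |k - l| occurs at most twice in a row, and w (k + l) \<le> w l by
  monotonicity; so a row is at most three sums of w over {0, ..., N}. One such sum times \<tau> is K
  \<tau> plus a harmonic sum, whose constant 1 is absorbed by K \<tau> \<ge> 1; hence 6 = 3 *
  2.\<close>

lemma wave_row_sum_le:
  fixes \<tau> K :: real
  assumes \<tau>: "0 < \<tau>" and K: "1 / \<tau> \<le> K" and k: "k \<le> N"
  defines "w \<equiv> wave_weight K \<tau>"
  shows "\<tau> * (\<Sum>l\<le>N. w (nat \<bar>int k - int l\<bar>) + w (k + l)) \<le> 6 * (K * \<tau> + ln (1 + K * real N * \<tau>))"
proof -
  have K\<tau>: "1 \<le> K * \<tau>" using \<tau> K by (simp add: divide_le_eq)
  define H where "H = (\<Sum>j=1..N. 1 / real j)"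
  have w0: "\<tau> * w 0 = K * \<tau>" by (simp add: w_def wave_weight_def)
  have wj: "\<tau> * w j = 1 / real j" if "0 < j" for j using that \<tau> by (simp add: w_def wave_weight_def)
  have K0: "0 < K" using K\<tau> \<tau> by (smt (verit) mult_nonpos_nonneg)
  have wpos: "0 \<le> w j" for j using K0 \<tau> by (simp add: w_def wave_weight_def)
  have mono: "w j \<le> w i" if "i \<le> j" for i j
  proof (cases "i = 0")
    case True
    have "1 / (real j * \<tau>) \<le> 1 / \<tau>" if "j \<noteq> 0"
      using that \<tau> by (intro divide_left_mono) auto
    then show ?thesis using True K by (auto simp: w_def wave_weight_def)
  next
    case False
    then show ?thesis using that \<tau> by (auto simp: w_def wave_weight_def intro!: divide_left_mono mult_right_mono)
  qed
  have S: "\<tau> * (\<Sum>l\<le>N. w l) = K * \<tau> + H"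
  proof -
    have "{..N} = insert 0 {1..N}" by auto
    then have "\<tau> * (\<Sum>l\<le>N. w l) = \<tau> * w 0 + (\<Sum>l=1..N. \<tau> * w l)"
      by (simp add: distrib_left sum_distrib_left)
    also have "(\<Sum>l=1..N. \<tau> * w l) = H" unfolding H_def by (intro sum.cong) (auto simp: wj)
    finally show ?thesis by (simp add: w0)
  qed
  have A: "(\<Sum>l\<le>N. w (k + l)) \<le> (\<Sum>l\<le>N. w l)"
    by (intro sum_mono mono) auto
  have B: "(\<Sum>l\<le>N. w (nat \<bar>int k - int l\<bar>)) \<le> 2 * (\<Sum>l\<le>N. w l)"
  proof -
    have "(\<Sum>l\<le>N. w (nat \<bar>int k - int l\<bar>)) = (\<Sum>l\<in>{..k}. w (nat \<bar>int k - int l\<bar>)) + (\<Sum>l\<in>{k<..N}. w (nat \<bar>int k - int l\<bar>))"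
      using k by (subst sum.union_disjoint[symmetric]) (auto intro!: sum.cong)
    also have "(\<Sum>l\<in>{..k}. w (nat \<bar>int k - int l\<bar>)) = (\<Sum>l\<in>{..k}. w l)"
      by (rule sum.reindex_bij_witness[of _ "\<lambda>l. k - l" "\<lambda>l. k - l"]) (auto intro!: arg_cong[where f=w])
    also have "\<dots> \<le> (\<Sum>l\<le>N. w l)" using k wpos by (intro sum_mono2) auto
    also have "(\<Sum>l\<in>{k<..N}. w (nat \<bar>int k - int l\<bar>)) = (\<Sum>l\<in>{1..N - k}. w l)"
      using k by (intro sum.reindex_bij_witness[of _ "\<lambda>l. k + l" "\<lambda>l. l - k"]) (auto intro!: arg_cong[where f=w])
    also have "\<dots> \<le> (\<Sum>l\<le>N. w l)" using wpos by (intro sum_mono2) auto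
    finally show ?thesis by simp
  qed
  have H: "H \<le> 1 + ln (1 + K * real N * \<tau>)"
  proof (cases "N = 0")
    case True then show ?thesis by (simp add: H_def)
  next
    case False
    then have "H \<le> 1 + ln (real N)" unfolding H_def by (intro harm_le_ln) auto
    also have "real N \<le> 1 + K * real N * \<tau>"
      using K\<tau> mult_right_mono[of 1 "K * \<tau>" "real N"] by (simp add: mult_ac)
    then have "ln (real N) \<le> ln (1 + K * real N * \<tau>)" using False by (intro ln_mono) auto
    finally show ?thesis by simp
  qed
  have L: "0 \<le> ln (1 + K * real N * \<tau>)" using K0 \<tau> by (intro ln_ge_zero) auto
  have "\<tau> * (\<Sum>l\<le>N. w (nat \<bar>int k - int l\<bar>) + w (k + l)) \<le> \<tau> * (3 * (\<Sum>l\<le>N. w l))"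
    using A B \<tau> by (intro mult_left_mono) (auto simp: sum.distrib)
  also have "\<dots> = 3 * (K * \<tau> + H)" using S by simp
  also have "\<dots> \<le> 3 * (2 * (K * \<tau>) + ln (1 + K * real N * \<tau>))" using H K\<tau> by (intro mult_left_mono) auto
  also have "\<dots> \<le> 3 * (2 * (K * \<tau>) + 2 * ln (1 + K * real N * \<tau>))" using L by (intro mult_left_mono) auto
  finally show ?thesis by simp
qed

section \<open>Point evaluations of the half-wave flow\<close>

lemma wave_kernel_weight_bound:
  obtains C where "1 \<le> C" and "\<And>K \<tau> j z. 0 < \<tau> \<Longrightarrow> 0 \<le> K \<Longrightarrow>
    norm (wave_kernel K (real j * \<tau>) z) \<le> C * wave_weight K \<tau> j"
proof -
  obtain C where C: "1 \<le> C" "\<And>K t z. 0 \<le> K \<Longrightarrow> norm (wave_kernel K t z) \<le> C * K"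
    "\<And>K t z. 0 \<le> K \<Longrightarrow> 0 < t \<Longrightarrow> norm (wave_kernel K t z) \<le> C / t"
    using wave_kernel_bound by blast
  have "norm (wave_kernel K (real j * \<tau>) z) \<le> C * wave_weight K \<tau> j" if "0 < \<tau>" "0 \<le> K" for K \<tau> j z
    using C(2)[OF that(2), of "real j * \<tau>" z] C(3)[OF that(2), of "real j * \<tau>" z] that
    by (cases "j = 0") (auto simp: wave_weight_def)
  with C(1) show thesis by (rule that)
qed

text \<open>Products of two cosines and of two sines both expand into cosines of (s - t)|\<xi>| and
  (s + t)|\<xi>|, whereas the Gram matrix of the exponentials would also contain sin((s -
  t)|\<xi>|). The price is the additional time s + t.\<close>

lemma wave_gram:
  fixes z z' :: R3
  assumes K: "0 \<le> K"
  defines "e \<equiv> (\<lambda>g t z \<xi>. complex_of_real (indicator (ball 0 K) \<xi> / norm \<xi> * g (t * norm \<xi>)) * cis (z \<bullet> \<xi>))"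
  shows "(LINT \<xi>|lborel. e cos s z \<xi> * cnj (e cos t z' \<xi>)) = (wave_kernel K (s - t) (z - z') + wave_kernel K (s + t) (z - z')) / 2"
    and "(LINT \<xi>|lborel. e sin s z \<xi> * cnj (e sin t z' \<xi>)) = (wave_kernel K (s - t) (z - z') - wave_kernel K (s + t) (z - z')) / 2"
proof -
  let ?k = "\<lambda>t \<xi>. complex_of_real (indicator (ball 0 K) \<xi> * cos (t * norm \<xi>) / (norm \<xi>)\<^sup>2) * cis ((z - z') \<bullet> \<xi>)"
  have *: "e g s z \<xi> * cnj (e g t z' \<xi>)
      = complex_of_real (indicator (ball 0 K) \<xi> / (norm \<xi>)\<^sup>2 * (g (s * norm \<xi>) * g (t * norm \<xi>))) * cis ((z - z') \<bullet> \<xi>)" for g \<xi>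
  proof -
    have "cis (z \<bullet> \<xi>) * cnj (cis (z' \<bullet> \<xi>)) = cis ((z - z') \<bullet> \<xi>)"
      by (simp add: cis_cnj cis_mult inner_diff_left)
    moreover have "complex_of_real (indicator (ball 0 K) \<xi> / norm \<xi> * g (s * norm \<xi>)) * complex_of_real (indicator (ball 0 K) \<xi> / norm \<xi> * g (t * norm \<xi>))
       = complex_of_real (indicator (ball 0 K) \<xi> / (norm \<xi>)\<^sup>2 * (g (s * norm \<xi>) * g (t * norm \<xi>)))"
      unfolding of_real_mult[symmetric] by (intro arg_cong[where f=complex_of_real]) (auto simp: power2_eq_square split: split_indicator)
    moreover have "(a * c) * (b * d) = p * q" if "c * d = q" "a * b = p" for a b c d p q :: complex
      unfolding that[symmetric] by simp
    ultimately show ?thesis unfolding e_def complex_cnj_mult complex_cnj_complex_of_real by blast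
  qed
  have c: "e cos s z \<xi> * cnj (e cos t z' \<xi>) = (?k (s - t) \<xi> + ?k (s + t) \<xi>) / 2" for \<xi>
  proof -
    have "complex_of_real (u / v * ((a + b) / 2)) * c = (complex_of_real (u * a / v) * c + complex_of_real (u * b / v) * c) / 2"
      for u v a b c by (simp add: add_divide_distrib distrib_left distrib_right)
    then show ?thesis unfolding * cos_times_cos left_diff_distrib[symmetric] distrib_right[symmetric] .
  qed
  have s: "e sin s z \<xi> * cnj (e sin t z' \<xi>) = (?k (s - t) \<xi> - ?k (s + t) \<xi>) / 2" for \<xi>
  proof -
    have "complex_of_real (u / v * ((a - b) / 2)) * c = (complex_of_real (u * a / v) * c - complex_of_real (u * b / v) * c) / 2"
      for u v a b c by (simp add: diff_divide_distrib right_diff_distrib left_diff_distrib)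
    then show ?thesis unfolding * sin_times_sin left_diff_distrib[symmetric] distrib_right[symmetric] .
  qed
  show "(LINT \<xi>|lborel. e cos s z \<xi> * cnj (e cos t z' \<xi>)) = (wave_kernel K (s - t) (z - z') + wave_kernel K (s + t) (z - z')) / 2"
    unfolding c wave_kernel_def
    by (subst integral_divide_zero, subst Bochner_Integration.integral_add) (rule wave_kernel_integrable[OF K] refl)+
  show "(LINT \<xi>|lborel. e sin s z \<xi> * cnj (e sin t z' \<xi>)) = (wave_kernel K (s - t) (z - z') - wave_kernel K (s + t) (z - z')) / 2"
    unfolding s wave_kernel_def
    by (subst integral_divide_zero, subst Bochner_Integration.integral_diff) (rule wave_kernel_integrable[OF K] refl)+
qed

lemma wave_kernel_minus: "wave_kernel K (- t) z = wave_kernel K t z"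
  by (simp add: wave_kernel_def)

text \<open>With h standing for |\<xi>| times a Fourier transform, the integrals are, up to
  normalisation, values of the projected half-wave flow at the space-time points (k \<tau>, z k).
  The points are arbitrary because the kernel bound is uniform in space.\<close>

lemma discrete_Strichartz_points:
  obtains C where "0 \<le> C" and
    "\<And>\<tau> K N (z :: nat \<Rightarrow> R3) h. \<lbrakk>0 < \<tau>; 1 / \<tau> \<le> K; h \<in> borel_measurable borel;
        integrable lborel (\<lambda>\<xi>. (norm (h \<xi>))\<^sup>2)\<rbrakk> \<Longrightarrow>
      \<tau> * (\<Sum>k\<le>N. (norm (LINT \<xi>|lborel. complex_of_real (indicator (ball 0 K) \<xi> / norm \<xi>)
            * cis (real k * \<tau> * norm \<xi>) * cis (z k \<bullet> \<xi>) * h \<xi>))\<^sup>2)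
        \<le> C * (K * \<tau> + ln (1 + K * real N * \<tau>)) * (LINT \<xi>|lborel. (norm (h \<xi>))\<^sup>2)"
proof -
  obtain C where C1: "1 \<le> C" and C: "\<And>K \<tau> j z. 0 < \<tau> \<Longrightarrow> 0 \<le> K \<Longrightarrow>
    norm (wave_kernel K (real j * \<tau>) z) \<le> C * wave_weight K \<tau> j"
    by (rule wave_kernel_weight_bound) blast
  \<comment> \<open>24 = 6 * 4: the 6 comes from the row sums, the 4 from |a + i b|^2 \<le> 2 |a|^2
    + 2 |b|^2 with the same bound for the cosine and the sine family.\<close>
  have "\<tau> * (\<Sum>k\<le>N. (norm (LINT \<xi>|lborel. complex_of_real (indicator (ball 0 K) \<xi> / norm \<xi>)
            * cis (real k * \<tau> * norm \<xi>) * cis (z k \<bullet> \<xi>) * h \<xi>))\<^sup>2)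
        \<le> 24 * C * (K * \<tau> + ln (1 + K * real N * \<tau>)) * (LINT \<xi>|lborel. (norm (h \<xi>))\<^sup>2)"
    if \<tau>: "0 < \<tau>" and K: "1 / \<tau> \<le> K" and [measurable]: "h \<in> borel_measurable borel"
      and h: "integrable lborel (\<lambda>\<xi>. (norm (h \<xi>))\<^sup>2)"
    for \<tau> K N and z :: "nat \<Rightarrow> R3" and h
  proof -
    have K0: "0 \<le> K" using K \<tau> by (meson order_trans less_imp_le zero_le_divide_1_iff)
    define e where "e = (\<lambda>g k \<xi>. complex_of_real (indicator (ball 0 K) \<xi> / norm \<xi> * g (real k * \<tau> * norm \<xi>)) * cis (z k \<bullet> \<xi>))"
    define A where "A = K * \<tau> + ln (1 + K * real N * \<tau>)"
    \<comment> \<open>The kernel is even in time, so its value at (k - l) \<tau> is controlled by |k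
      - l|. The factor 1/2 of the Gram formula is given away.\<close>
    define m where "m k l = C * (wave_weight K \<tau> (nat \<bar>int k - int l\<bar>) + wave_weight K \<tau> (k + l))" for k l
    have wpos: "0 \<le> wave_weight K \<tau> j" for j using K0 \<tau> by (simp add: wave_weight_def)
    have row: "(\<Sum>l\<le>N. m k l) \<le> 6 * C * A / \<tau>" if "k \<le> N" for k
    proof -
      have "\<tau> * (\<Sum>l\<le>N. m k l) = C * (\<tau> * (\<Sum>l\<le>N. wave_weight K \<tau> (nat \<bar>int k - int l\<bar>) + wave_weight K \<tau> (k + l)))"
        unfolding m_def by (simp add: sum_distrib_left mult_ac)
      also have "\<dots> \<le> C * (6 * A)"
        unfolding A_def using C1 by (intro mult_left_mono wave_row_sum_le \<tau> K that) auto
      finally show ?thesis using \<tau> by (simp add: field_simps)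
    qed
    have sym: "m k l = m l k" for k l unfolding m_def by (simp add: abs_minus_commute add.commute)
    have diff: "norm (wave_kernel K (real k * \<tau> - real l * \<tau>) y) \<le> C * wave_weight K \<tau> (nat \<bar>int k - int l\<bar>)" for k l y
    proof -
      have "wave_kernel K (real k * \<tau> - real l * \<tau>) y = wave_kernel K (real (nat \<bar>int k - int l\<bar>) * \<tau>) y"
      proof (cases "l \<le> k")
        case True
        then show ?thesis by (simp add: nat_diff_distrib of_nat_diff left_diff_distrib)
      next
        case False
        then show ?thesis using wave_kernel_minus[of K "real l * \<tau> - real k * \<tau>" y]
          by (simp add: nat_diff_distrib of_nat_diff left_diff_distrib)
      qed
      then show ?thesis using C[OF \<tau> K0, of "nat \<bar>int k - int l\<bar>" y] by (simp only:)
    qed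
    have add: "norm (wave_kernel K (real k * \<tau> + real l * \<tau>) y) \<le> C * wave_weight K \<tau> (k + l)" for k l y
      using C[OF \<tau> K0, of "k + l" y] by (simp add: distrib_right)
    have [measurable]: "e cos k \<in> borel_measurable borel" "e sin k \<in> borel_measurable borel" for k
      unfolding e_def by measurable
    have gram: "norm (LINT \<xi>|lborel. e g k \<xi> * cnj (e g l \<xi>)) \<le> m k l" if g: "g = cos \<or> g = sin" for g k l
    proof -
      let ?a = "wave_kernel K (real k * \<tau> - real l * \<tau>) (z k - z l)" and ?b = "wave_kernel K (real k * \<tau> + real l * \<tau>) (z k - z l)"
      have "norm (LINT \<xi>|lborel. e g k \<xi> * cnj (e g l \<xi>)) \<le> (norm ?a + norm ?b) / 2"
        using g unfolding e_def
      proof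
        assume "g = cos"
        then show "norm (LINT \<xi>|lborel. complex_of_real (indicat_real (ball 0 K) \<xi> / norm \<xi> * g (real k * \<tau> * norm \<xi>)) * cis (z k \<bullet> \<xi>) *
          cnj (complex_of_real (indicat_real (ball 0 K) \<xi> / norm \<xi> * g (real l * \<tau> * norm \<xi>)) * cis (z l \<bullet> \<xi>))) \<le> (norm ?a + norm ?b) / 2"
          using norm_triangle_ineq[of ?a ?b] by (simp only: wave_gram[OF K0] norm_divide) simp
      next
        assume "g = sin"
        then show "norm (LINT \<xi>|lborel. complex_of_real (indicat_real (ball 0 K) \<xi> / norm \<xi> * g (real k * \<tau> * norm \<xi>)) * cis (z k \<bullet> \<xi>) *
          cnj (complex_of_real (indicat_real (ball 0 K) \<xi> / norm \<xi> * g (real l * \<tau> * norm \<xi>)) * cis (z l \<bullet> \<xi>))) \<le> (norm ?a + norm ?b) / 2"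
          using norm_triangle_ineq4[of ?a ?b] by (simp only: wave_gram[OF K0] norm_divide) simp
      qed
      also have "\<dots> \<le> norm ?a + norm ?b" by simp
      also have "\<dots> \<le> m k l" unfolding m_def distrib_left by (intro add_mono diff add)
      finally show ?thesis .
    qed
    have eint: "integrable lborel (\<lambda>\<xi>. (norm (e g k \<xi>))\<^sup>2)" if g: "g = cos \<or> g = sin" for g k
    proof (rule Bochner_Integration.integrable_bound[OF inverse_square_ball(1)[OF K0]])
      show "(\<lambda>\<xi>. (norm (e g k \<xi>))\<^sup>2) \<in> borel_measurable lborel" using g by auto
      have "\<bar>g t\<bar>\<^sup>2 \<le> 1" for t using g by (auto simp: abs_square_le_1)
      then have "(norm (e g k \<xi>))\<^sup>2 \<le> indicat_real (ball 0 K) \<xi> / (norm \<xi>)\<^sup>2" for \<xi>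
        unfolding e_def norm_mult norm_cis norm_of_real
        by (auto simp: abs_mult abs_divide power_mult_distrib power_divide divide_right_mono split: split_indicator)
      then show "AE \<xi> in lborel. norm ((norm (e g k \<xi>))\<^sup>2) \<le> norm (indicat_real (ball 0 K) \<xi> / (norm \<xi>)\<^sup>2)"
        by (intro AE_I2) simp
    qed
    define I where "I = (LINT \<xi>|lborel. (norm (h \<xi>))\<^sup>2)"
    have main: "(\<Sum>k\<le>N. (norm (LINT \<xi>|lborel. e g k \<xi> * h \<xi>))\<^sup>2) \<le> 6 * C * A / \<tau> * I" if g: "g = cos \<or> g = sin" for g
      unfolding I_def by (rule analysis_operator_bound[where m=m]) (use g h gram[OF g] sym row eint[OF g] in auto)
    have "(norm (LINT \<xi>|lborel. complex_of_real (indicator (ball 0 K) \<xi> / norm \<xi>)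
            * cis (real k * \<tau> * norm \<xi>) * cis (z k \<bullet> \<xi>) * h \<xi>))\<^sup>2
       \<le> 2 * (norm (LINT \<xi>|lborel. e cos k \<xi> * h \<xi>))\<^sup>2 + 2 * (norm (LINT \<xi>|lborel. e sin k \<xi> * h \<xi>))\<^sup>2" for k
    proof -
      have i: "integrable lborel (\<lambda>\<xi>. e g k \<xi> * h \<xi>)" if "g = cos \<or> g = sin" for g
        by (rule integrable_mult_L2) (use that h eint in auto)
      have "(LINT \<xi>|lborel. complex_of_real (indicator (ball 0 K) \<xi> / norm \<xi>)
            * cis (real k * \<tau> * norm \<xi>) * cis (z k \<bullet> \<xi>) * h \<xi>)
          = (LINT \<xi>|lborel. e cos k \<xi> * h \<xi> + \<i> * (e sin k \<xi> * h \<xi>))"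
        unfolding e_def by (intro Bochner_Integration.integral_cong refl) (simp add: cis_conv_exp[symmetric] complex_eq_iff algebra_simps add_divide_distrib diff_divide_distrib)
      also have "\<dots> = (LINT \<xi>|lborel. e cos k \<xi> * h \<xi>) + \<i> * (LINT \<xi>|lborel. e sin k \<xi> * h \<xi>)"
        using i[of cos] i[of sin] by (subst Bochner_Integration.integral_add) auto
      also have "norm \<dots> \<le> norm (LINT \<xi>|lborel. e cos k \<xi> * h \<xi>) + norm (LINT \<xi>|lborel. e sin k \<xi> * h \<xi>)"
        by (rule order_trans[OF norm_triangle_ineq]) (simp add: norm_mult)
      finally have "(norm (LINT \<xi>|lborel. complex_of_real (indicator (ball 0 K) \<xi> / norm \<xi>)
            * cis (real k * \<tau> * norm \<xi>) * cis (z k \<bullet> \<xi>) * h \<xi>))\<^sup>2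
        \<le> (norm (LINT \<xi>|lborel. e cos k \<xi> * h \<xi>) + norm (LINT \<xi>|lborel. e sin k \<xi> * h \<xi>))\<^sup>2"
        by (intro power_mono) auto
      also have "\<dots> \<le> 2 * (norm (LINT \<xi>|lborel. e cos k \<xi> * h \<xi>))\<^sup>2 + 2 * (norm (LINT \<xi>|lborel. e sin k \<xi> * h \<xi>))\<^sup>2"
        using sum_squares_bound[of "norm (LINT \<xi>|lborel. e cos k \<xi> * h \<xi>)" "norm (LINT \<xi>|lborel. e sin k \<xi> * h \<xi>)"]
        unfolding power2_sum by linarith
      finally show ?thesis .
    qed
    then have "(\<Sum>k\<le>N. (norm (LINT \<xi>|lborel. complex_of_real (indicator (ball 0 K) \<xi> / norm \<xi>)
            * cis (real k * \<tau> * norm \<xi>) * cis (z k \<bullet> \<xi>) * h \<xi>))\<^sup>2)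
        \<le> (\<Sum>k\<le>N. 2 * (norm (LINT \<xi>|lborel. e cos k \<xi> * h \<xi>))\<^sup>2 + 2 * (norm (LINT \<xi>|lborel. e sin k \<xi> * h \<xi>))\<^sup>2)"
      by (rule sum_mono)
    also have "\<dots> \<le> 24 * C * A / \<tau> * I"
    proof -
      have "2 * x + 2 * y \<le> 4 * w" if "x \<le> w" "y \<le> w" for x y w :: real using that by linarith
      from this[OF main[OF disjI1[OF refl]] main[OF disjI2[OF refl]]]
      show ?thesis unfolding sum.distrib sum_distrib_left[symmetric] by simp
    qed
    finally show ?thesis unfolding A_def[symmetric] I_def[symmetric]
      using \<tau> by (simp add: pos_le_divide_eq mult.commute)
  qed
  then show thesis using C1 by (intro that[of "24 * C"]) auto
qed

section \<open>Uniqueness of the representing function\<close>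

definition exp_cutoff :: "real poly \<Rightarrow> real \<Rightarrow> real" where
  "exp_cutoff p x = (if 0 < x then exp (- (1 / x)) * poly p (1 / x) else 0)"

lemma exp_cutoff_tendsto_0: "(exp_cutoff p \<longlongrightarrow> 0) (at 0)"
proof -
  have "((\<lambda>y. \<Sum>i\<le>degree p. coeff p i * (y ^ i / exp y)) \<longlongrightarrow> (\<Sum>i\<le>degree p. coeff p i * 0)) at_top"
    by (intro tendsto_sum tendsto_mult tendsto_const tendsto_power_div_exp_0)
  then have "((\<lambda>y. poly p y * exp (- y)) \<longlongrightarrow> 0) at_top"
    by (simp add: poly_altdef sum_distrib_right exp_minus divide_inverse mult.assoc)
  then have "((\<lambda>x. poly p (1 / x) * exp (- (1 / x))) \<longlongrightarrow> 0) (at_right 0)"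
    using filterlim_compose[OF _ filterlim_inverse_at_top_right] by (auto simp: inverse_eq_divide)
  then have "(exp_cutoff p \<longlongrightarrow> 0) (at_right 0)"
    by (rule tendsto_cong[THEN iffD1, rotated])
       (auto simp: eventually_at_filter exp_cutoff_def intro!: always_eventually)
  moreover have "(exp_cutoff p \<longlongrightarrow> 0) (at_left 0)"
    by (rule tendsto_eventually) (auto simp: eventually_at_filter exp_cutoff_def intro!: always_eventually)
  ultimately show ?thesis by (simp add: filterlim_split_at)
qed

text \<open>In the variable y = 1 / x, differentiation turns exp(-y) p(y) into exp(-y) y^2 (p -
  p')(y). The polynomial parameter makes the family closed under differentiation, also across the
  origin.\<close>

lemma exp_cutoff_deriv:
  "(exp_cutoff p has_real_derivative exp_cutoff ([:0, 0, 1:] * (p - pderiv p)) x) (at x)"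
proof -
  consider "0 < x" | "x < 0" | "x = 0" by linarith
  then show ?thesis
  proof cases
    case 1
    have "((\<lambda>x. exp (- (1 / x)) * poly p (1 / x)) has_real_derivative exp_cutoff ([:0, 0, 1:] * (p - pderiv p)) x) (at x)"
      using 1 by (auto intro!: derivative_eq_intros DERIV_chain2[OF poly_DERIV] simp: exp_cutoff_def field_simps power2_eq_square)
    then show ?thesis
      by (rule has_field_derivative_transform_within_open[where S="{0<..}"]) (use 1 in \<open>auto simp: exp_cutoff_def\<close>)
  next
    case 2
    have "((\<lambda>x::real. 0) has_real_derivative exp_cutoff ([:0, 0, 1:] * (p - pderiv p)) x) (at x)"
      using 2 by (auto simp: exp_cutoff_def)
    then show ?thesis
      by (rule has_field_derivative_transform_within_open[where S="{..<0}"]) (use 2 in \<open>auto simp: exp_cutoff_def\<close>)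
  next
    case 3
    \<comment> \<open>Dividing by h multiplies p by its variable, so the difference quotient at 0 is
      again a cutoff of this family.\<close>
    have "((\<lambda>h. exp_cutoff (pCons 0 p) h) \<longlongrightarrow> 0) (at 0)" by (rule exp_cutoff_tendsto_0)
    then have "((\<lambda>h. (exp_cutoff p (0 + h) - exp_cutoff p 0) / h) \<longlongrightarrow> 0) (at 0)"
      by (rule tendsto_cong[THEN iffD1, rotated])
        (auto simp: exp_cutoff_def eventually_at_filter intro!: always_eventually)
    then show ?thesis unfolding 3 DERIV_def by (simp add: exp_cutoff_def)
  qed
qed

text \<open>A class of functions closed under partial derivatives: one differentiability proof by
  induction then covers all iterated derivatives, as \<open>smooth\<close> demands.\<close>

inductive_set bump_algebra :: "(R3 \<Rightarrow> complex) set" where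
  const: "(\<lambda>x. c) \<in> bump_algebra"
| cutoff: "(\<lambda>x. complex_of_real (exp_cutoff p (c * (x $ i) + d))) \<in> bump_algebra"
| add: "f \<in> bump_algebra \<Longrightarrow> g \<in> bump_algebra \<Longrightarrow> (\<lambda>x. f x + g x) \<in> bump_algebra"
| mult: "f \<in> bump_algebra \<Longrightarrow> g \<in> bump_algebra \<Longrightarrow> (\<lambda>x. f x * g x) \<in> bump_algebra"

lemma bump_algebra_derivative:
  assumes "f \<in> bump_algebra"
  shows "\<exists>D. (\<forall>x. (f has_derivative D x) (at x)) \<and> (\<forall>v. (\<lambda>x. D x v) \<in> bump_algebra)"
  using assms
proof induction
  case (const c)
  show ?case by (rule exI[of _ "\<lambda>x v. 0"]) (auto intro: bump_algebra.const)
next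
  case (cutoff p c i d)
  let ?q = "[:0, 0, 1:] * (p - pderiv p)"
  have "((\<lambda>x. complex_of_real (exp_cutoff p (c * (x $ i) + d))) has_derivative
     (\<lambda>v. complex_of_real (c * (v $ i)) * complex_of_real (exp_cutoff ?q (c * (x $ i) + d)))) (at x)" for x :: R3
  proof -
    have "((\<lambda>x::R3. c * (x $ i) + d) has_derivative (\<lambda>v. c * (v $ i))) (at x)"
      by (auto intro!: derivative_eq_intros bounded_linear_imp_has_derivative[OF bounded_linear_vec_nth])
    from has_derivative_compose[OF this exp_cutoff_deriv[unfolded has_field_derivative_def]]
    have "((\<lambda>x. exp_cutoff p (c * (x $ i) + d)) has_derivative
       (\<lambda>v. exp_cutoff ?q (c * (x $ i) + d) * (c * (v $ i)))) (at x)" .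
    from bounded_linear.has_derivative[OF bounded_linear_of_real this]
    show ?thesis by (simp add: mult.commute)
  qed
  then show ?case
    by (intro exI[of _ "\<lambda>x v. complex_of_real (c * (v $ i)) * complex_of_real (exp_cutoff ?q (c * (x $ i) + d))"])
       (auto intro!: bump_algebra.intros simp del: of_real_mult mult_pCons_left)
next
  case (add f g)
  then obtain D E where "\<And>x. (f has_derivative D x) (at x)" "\<And>v. (\<lambda>x. D x v) \<in> bump_algebra"
    "\<And>x. (g has_derivative E x) (at x)" "\<And>v. (\<lambda>x. E x v) \<in> bump_algebra" by blast
  then show ?case
    by (intro exI[of _ "\<lambda>x v. D x v + E x v"]) (auto intro!: has_derivative_add bump_algebra.add)
next
  case (mult f g)
  then obtain D E where DE: "\<And>x. (f has_derivative D x) (at x)" "\<And>v. (\<lambda>x. D x v) \<in> bump_algebra"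
    "\<And>x. (g has_derivative E x) (at x)" "\<And>v. (\<lambda>x. E x v) \<in> bump_algebra" by blast
  then show ?case using mult.hyps
    by (intro exI[of _ "\<lambda>x v. f x * E x v + D x v * g x"])
       (auto intro!: has_derivative_mult bump_algebra.add bump_algebra.mult)
qed

lemma bump_algebra_smooth:
  assumes "f \<in> bump_algebra" shows "smooth f"
proof -
  have "partials is f \<in> bump_algebra" for "is"
  proof (induction "is")
    case (Cons i "is")
    then obtain D where D: "\<And>x. (partials is f has_derivative D x) (at x)" "\<And>v. (\<lambda>x. D x v) \<in> bump_algebra"
      using bump_algebra_derivative by blast
    have "partial i (partials is f) = (\<lambda>x. D x (axis i 1))"
      unfolding partial_def using frechet_derivative_at[OF D(1)] by (simp add: fun_eq_iff)
    then show ?case using D(2) by simp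
  qed (simp add: assms)
  then show ?thesis unfolding smooth_def differentiable_def using bump_algebra_derivative by blast
qed

lemma bump_algebra_prod:
  assumes "finite I" "\<And>i. i \<in> I \<Longrightarrow> f i \<in> bump_algebra"
  shows "(\<lambda>x. \<Prod>i\<in>I. f i x) \<in> bump_algebra"
  using assms by (induction I) (auto intro: bump_algebra.intros)

text \<open>Since exp(-1 / ((n + 1) t)) tends to 1 for each t > 0, these functions, bounded by 1 and
  supported in the closed box for every n, converge pointwise to the indicator of the open
  box.\<close>

definition box_bump :: "nat \<Rightarrow> R3 \<Rightarrow> R3 \<Rightarrow> R3 \<Rightarrow> complex" where
  "box_bump n a b x = (\<Prod>i\<in>UNIV. complex_of_real (exp_cutoff 1 (real (Suc n) * (x $ i - a $ i)))
     * complex_of_real (exp_cutoff 1 (real (Suc n) * (b $ i - x $ i))))"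

lemma box_bump_outside:
  assumes "x \<notin> box a b" shows "box_bump n a b x = 0"
proof -
  obtain i where i: "x $ i - a $ i \<le> 0 \<or> b $ i - x $ i \<le> 0" using assms by (auto simp: mem_box_cart not_less)
  then have "real (Suc n) * (x $ i - a $ i) \<le> 0 \<or> real (Suc n) * (b $ i - x $ i) \<le> 0"
    by (metis mult_nonneg_nonpos of_nat_0_le_iff)
  then have "exp_cutoff 1 (real (Suc n) * (x $ i - a $ i)) = 0 \<or> exp_cutoff 1 (real (Suc n) * (b $ i - x $ i)) = 0"
    unfolding exp_cutoff_def by auto
  then show ?thesis unfolding box_bump_def by (intro prod_zero) auto
qed

lemma test_function_box_bump: "test_function (box_bump n a b)"
  unfolding test_function_def
proof
  show "smooth (box_bump n a b)"
  proof -
    have "box_bump n a b = (\<lambda>x. \<Prod>i\<in>UNIV. complex_of_real (exp_cutoff 1 (real (Suc n) * (x $ i) + - (real (Suc n) * (a $ i))))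
       * complex_of_real (exp_cutoff 1 (- real (Suc n) * (x $ i) + real (Suc n) * (b $ i))))"
    proof -
      have "real (Suc n) * (x $ i - a $ i) = real (Suc n) * (x $ i) + - (real (Suc n) * (a $ i))"
        "real (Suc n) * (b $ i - x $ i) = - real (Suc n) * (x $ i) + real (Suc n) * (b $ i)" for x i
      proof -
        have *: "m * (x - a) = m * x + - (m * a)" "m * (b - x) = - m * x + m * b" for m x a b :: real
          by (simp_all add: right_diff_distrib)
        show "real (Suc n) * (x $ i - a $ i) = real (Suc n) * (x $ i) + - (real (Suc n) * (a $ i))" by (rule *)
        show "real (Suc n) * (b $ i - x $ i) = - real (Suc n) * (x $ i) + real (Suc n) * (b $ i)" by (rule *)
      qed
      then show ?thesis unfolding box_bump_def by (simp only:)
    qed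
    then show ?thesis
      by (simp only:) (intro bump_algebra_smooth bump_algebra_prod bump_algebra.mult bump_algebra.cutoff finite_class.finite_UNIV)
  qed
  have "box_bump n a b x = 0" if "x \<notin> cbox a b" for x
    by (rule box_bump_outside) (use that box_subset_cbox[of a b] in blast)
  then show "\<exists>S. compact S \<and> (\<forall>x. x \<notin> S \<longrightarrow> box_bump n a b x = 0)"
    using compact_cbox by blast
qed

lemma box_bump_le_1: "norm (box_bump n a b x) \<le> 1"
proof -
  have c: "0 \<le> exp_cutoff 1 t" "exp_cutoff 1 t \<le> 1" for t by (auto simp: exp_cutoff_def)
  show ?thesis unfolding box_bump_def prod_norm[symmetric] norm_mult norm_of_real
    by (intro prod_le_1) (auto simp: c mult_le_one)
qed

lemma box_bump_tendsto: "(\<lambda>n. box_bump n a b x) \<longlonglongrightarrow> indicator (box a b) x"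
proof (cases "x \<in> box a b")
  case False
  then show ?thesis by (simp add: box_bump_outside)
next
  case True
  have lim: "(\<lambda>n. complex_of_real (exp_cutoff 1 (real (Suc n) * t))) \<longlonglongrightarrow> 1" if "0 < t" for t
  proof -
    have "(\<lambda>n. exp (- (1 / t * (1 / real (Suc n))))) \<longlonglongrightarrow> exp (- (1 / t * 0))"
      by (intro tendsto_intros) (use LIMSEQ_inverse_real_of_nat in \<open>simp add: inverse_eq_divide\<close>)
    then have "(\<lambda>n. exp_cutoff 1 (real (Suc n) * t)) \<longlonglongrightarrow> 1"
      using that by (simp add: exp_cutoff_def mult.commute)
    from tendsto_of_real[OF this] show ?thesis by simp
  qed
  have "(\<lambda>n. box_bump n a b x) \<longlonglongrightarrow> (\<Prod>i\<in>(UNIV :: 3 set). 1 * 1)"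
    unfolding box_bump_def
  proof (intro tendsto_prod tendsto_mult)
    fix i
    show "(\<lambda>n. complex_of_real (exp_cutoff 1 (real (Suc n) * (x $ i - a $ i)))) \<longlonglongrightarrow> 1"
      using True by (intro lim) (simp add: mem_box_cart)
    show "(\<lambda>n. complex_of_real (exp_cutoff 1 (real (Suc n) * (b $ i - x $ i)))) \<longlonglongrightarrow> 1"
      using True by (intro lim) (simp add: mem_box_cart)
  qed
  then show ?thesis using True by simp
qed

section \<open>Locally integrable functions determined by their integrals against test
  functions\<close>

lemma test_function_continuous: "test_function \<phi> \<Longrightarrow> continuous_on UNIV \<phi>"
  unfolding test_function_def smooth_def
  by (metis partials.simps(1) differentiable_imp_continuous_within continuous_at_imp_continuous_on)

lemma test_function_measurable: "test_function \<phi> \<Longrightarrow> \<phi> \<in> borel_measurable borel"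
  by (intro borel_measurable_continuous_onI test_function_continuous)

text \<open>Boxes form an intersection-stable generator of the Borel sets, so a Dynkin argument
  carries vanishing integrals to all Borel sets. It is run for g cut off to a large box
  \<open>B m\<close>, because g is integrable only locally, and the cut-off keeps the class of boxes
  stable.\<close>

lemma AE_zero_of_box_integrals:
  fixes g :: "R3 \<Rightarrow> complex"
  assumes g: "locally_integrable g" and zero: "\<And>a b. (LINT x:box a b|lborel. g x) = 0"
  shows "AE x in lborel. g x = 0"
proof -
  have [measurable]: "g \<in> borel_measurable borel" using g by (simp add: locally_integrable_def)
  define B where "B m = box (- real m *\<^sub>R One) (real m *\<^sub>R One :: R3)" for m :: nat
  have gint: "integrable lborel (\<lambda>x. indicator (B m) x *\<^sub>R g x)" for m
  proof -
    have "set_integrable lborel (cbox (- real m *\<^sub>R One) (real m *\<^sub>R One :: R3)) g"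
      using g compact_cbox unfolding locally_integrable_def by blast
    then have "set_integrable lborel (B m) g"
      by (rule set_integrable_subset) (auto simp: B_def box_subset_cbox)
    then show ?thesis by (simp add: set_integrable_def)
  qed
  have key: "AE x in lborel. indicator (B m) x *\<^sub>R g x = 0" for m
  proof (rule sigma_finite_measure.density_zero[OF sigma_finite_lborel gint])
    let ?g = "\<lambda>x. indicator (B m) x *\<^sub>R g x"
    have gi: "set_integrable lborel A ?g" if "A \<in> sets borel" for A
      unfolding set_integrable_def using integrable_mult_indicator[OF _ gint, of A m] that by simp
    fix A :: "R3 set" assume "A \<in> sets lborel"
    then have A: "A \<in> sigma_sets UNIV (range (\<lambda>(a, b). box a b))"
      by (simp add: borel_eq_box)
    have stable: "Int_stable (range (\<lambda>(a, b). box a b :: R3 set))"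
      by (auto simp: Int_stable_def box_Int_box)
    have Pow: "range (\<lambda>(a, b). box a b :: R3 set) \<subseteq> Pow UNIV" by auto
    show "(LINT x:A|lborel. ?g x) = 0"
      using stable Pow A
    proof (induction rule: sigma_sets_induct_disjoint)
      fix A assume "A \<in> range (\<lambda>(a, b). box a b :: R3 set)"
      then obtain a b where A: "A = box a b" by auto
      obtain c d where cd: "A \<inter> B m = box c d" unfolding A B_def box_Int_box by blast
      have "(LINT x:A|lborel. ?g x) = (LINT x:box c d|lborel. g x)"
        unfolding set_lebesgue_integral_def cd[symmetric] by (auto intro!: Bochner_Integration.integral_cong split: split_indicator)
      then show "(LINT x:A|lborel. ?g x) = 0" by (simp add: zero)
    next
      show "(LINT x:{}|lborel. ?g x) = 0" by (simp add: set_lebesgue_integral_def)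
    next
      fix A assume A: "A \<in> sigma_sets UNIV (range (\<lambda>(a, b). box a b :: R3 set))" and IH: "(LINT x:A|lborel. ?g x) = 0"
      have [measurable]: "A \<in> sets borel" using A by (simp add: borel_eq_box)
      have "(LINT x|lborel. ?g x) = (LINT x:A \<union> (UNIV - A)|lborel. ?g x)"
        by (simp add: set_lebesgue_integral_def)
      also have "\<dots> = (LINT x:A|lborel. ?g x) + (LINT x:UNIV - A|lborel. ?g x)"
        by (intro set_integral_Un gi) auto
      finally have "(LINT x:UNIV - A|lborel. ?g x) = (LINT x|lborel. ?g x)" using IH by simp
      \<comment> \<open>The integral over the whole space is the integral of g over the box
        \<open>B m\<close>, which is zero by hypothesis.\<close>
      also have "\<dots> = 0" using zero unfolding B_def set_lebesgue_integral_def .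
      finally show "(LINT x:UNIV - A|lborel. ?g x) = 0" .
    next
      fix A :: "nat \<Rightarrow> R3 set"
      assume d: "disjoint_family A" and A: "range A \<subseteq> sigma_sets UNIV (range (\<lambda>(a, b). box a b :: R3 set))"
        and IH: "\<And>i. (LINT x:A i|lborel. ?g x) = 0"
      have [measurable]: "A i \<in> sets borel" for i using A by (auto simp: borel_eq_box)
      have "(LINT x:(\<Union>i. A i)|lborel. ?g x) = (\<Sum>i. (LINT x:A i|lborel. ?g x))"
        using d by (intro lebesgue_integral_countable_add gi) (auto simp: disjoint_family_on_def)
      then show "(LINT x:(\<Union>i. A i)|lborel. ?g x) = 0" by (simp add: IH)
    qed
  qed
  then have "AE x in lborel. \<forall>m. indicator (B m) x *\<^sub>R g x = 0" unfolding AE_all_countable by blast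
  then show ?thesis
  proof eventually_elim
    fix x assume *: "\<forall>m. indicator (B m) x *\<^sub>R g x = 0"
    obtain m :: nat where m: "norm x < real m" using reals_Archimedean2 by blast
    have "x \<in> B m" unfolding B_def mem_box using m Basis_le_norm[of _ x] by (force simp: abs_le_iff)
    then show "g x = 0" using * by (auto dest: spec[of _ m])
  qed
qed

text \<open>The box bumps are test functions tending to box indicators, with |f - g| on the closed
  box as an integrable majorant. This makes the choice inside \<open>dist_fun\<close> harmless:
  norms may be computed from any explicit representative.\<close>

lemma represents_unique:
  assumes "represents f u" "represents g u"
  shows "AE x in lborel. f x = g x"
proof -
  have f: "locally_integrable f" and g: "locally_integrable g"
    using assms by (auto simp: represents_def)
  have [measurable]: "f \<in> borel_measurable borel" "g \<in> borel_measurable borel" using f g by (auto simp: locally_integrable_def)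
  have fg: "locally_integrable (\<lambda>x. f x - g x)"
    using f g unfolding locally_integrable_def by (auto intro: set_integral_diff)
  have "(LINT x:box a b|lborel. f x - g x) = 0" for a b
  proof -
    let ?d = "\<lambda>x. f x - g x"
    have ci: "integrable lborel (\<lambda>x. indicator (cbox a b) x *\<^sub>R ?d x)"
      using fg compact_cbox unfolding locally_integrable_def set_integrable_def by blast
    have "(\<lambda>n. LINT x|lborel. ?d x * box_bump n a b x) \<longlonglongrightarrow> (LINT x|lborel. ?d x * indicator (box a b) x)"
    proof (rule integral_dominated_convergence)
      show "integrable lborel (\<lambda>x. norm (indicator (cbox a b) x *\<^sub>R ?d x))" using ci by (rule integrable_norm)
      show "(\<lambda>x. ?d x * box_bump n a b x) \<in> borel_measurable lborel" for n
        using test_function_measurable[OF test_function_box_bump] by measurable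
      show "AE x in lborel. (\<lambda>n. ?d x * box_bump n a b x) \<longlonglongrightarrow> ?d x * indicator (box a b) x"
        by (intro AE_I2 tendsto_intros box_bump_tendsto)
      show "AE x in lborel. norm (?d x * box_bump n a b x) \<le> norm (indicator (cbox a b) x *\<^sub>R ?d x)" for n
      proof (rule AE_I2)
        fix x
        show "norm (?d x * box_bump n a b x) \<le> norm (indicator (cbox a b) x *\<^sub>R ?d x)"
          using box_bump_le_1[of n a b x] box_bump_outside[of x a b n] box_subset_cbox[of a b]
          by (cases "x \<in> box a b") (auto simp: norm_mult mult_left_le)
      qed
    qed auto
    moreover have "(LINT x|lborel. ?d x * box_bump n a b x) = 0" for n
    proof -
      have bi: "integrable lborel (\<lambda>x. h x * box_bump n a b x)" if h: "locally_integrable h" for h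
      proof (rule Bochner_Integration.integrable_bound)
        show "integrable lborel (\<lambda>x. indicator (cbox a b) x *\<^sub>R h x)"
          using h compact_cbox unfolding locally_integrable_def set_integrable_def by blast
        show "(\<lambda>x. h x * box_bump n a b x) \<in> borel_measurable lborel"
          using h test_function_measurable[OF test_function_box_bump] by (auto simp: locally_integrable_def)
        show "AE x in lborel. norm (h x * box_bump n a b x) \<le> norm (indicator (cbox a b) x *\<^sub>R h x)"
          using box_bump_le_1[of n a b] box_bump_outside[of _ a b n] box_subset_cbox[of a b]
          by (intro AE_I2) (case_tac "x \<in> box a b"; auto simp: norm_mult mult_left_le)
      qed
      have "fun_dist f (box_bump n a b) = fun_dist g (box_bump n a b)"
        using assms test_function_box_bump unfolding represents_def by metis
      then show ?thesis unfolding fun_dist_def left_diff_distrib using bi[OF f] bi[OF g] by simp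
    qed
    ultimately have "(LINT x|lborel. ?d x * indicator (box a b) x) = 0" by (simp add: LIMSEQ_const_iff)
    moreover have "(LINT x:box a b|lborel. ?d x) = (LINT x|lborel. ?d x * indicator (box a b) x)"
      unfolding set_lebesgue_integral_def by (intro Bochner_Integration.integral_cong) (auto split: split_indicator)
    ultimately show ?thesis by simp
  qed
  from AE_zero_of_box_integrals[OF fg this] show ?thesis by eventually_elim simp
qed

lemma represents_dist_fun: "represents g u \<Longrightarrow> represents (dist_fun u) u"
  unfolding dist_fun_def by (rule someI[of "\<lambda>g. represents g u"])

lemma dist_fun_AE: "represents g u \<Longrightarrow> AE x in lborel. dist_fun u x = g x"
  by (rule represents_unique[OF represents_dist_fun])

section \<open>Fourier inversion\<close>

lemma integral_Fubini_bounded_kernel: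
  fixes F \<phi> :: "R3 \<Rightarrow> complex" and e :: "R3 \<Rightarrow> R3 \<Rightarrow> complex"
  assumes F: "integrable lborel F" and \<phi>: "integrable lborel \<phi>"
    and e[measurable]: "(\<lambda>(x, y). e x y) \<in> borel_measurable (borel \<Otimes>\<^sub>M borel)"
    and e1: "\<And>x y. norm (e x y) \<le> 1"
  shows "(LINT x|lborel. F x * (LINT y|lborel. e x y * \<phi> y)) = (LINT y|lborel. \<phi> y * (LINT x|lborel. e x y * F x))"
proof -
  have [measurable]: "F \<in> borel_measurable borel" "\<phi> \<in> borel_measurable borel"
    using F \<phi> by (auto dest: borel_measurable_integrable)
  have [measurable]: "(\<lambda>p. e (fst p) (snd p)) \<in> borel_measurable (borel \<Otimes>\<^sub>M borel)"
    using e by (simp add: case_prod_beta')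
  have "integrable (lborel \<Otimes>\<^sub>M lborel) (\<lambda>p. F (fst p) * \<phi> (snd p))"
    using F \<phi> by (intro lborel_pair.Fubini_integrable) (auto simp: norm_mult)
  then have int: "integrable (lborel \<Otimes>\<^sub>M lborel) (\<lambda>(x, y). F x * (e x y * \<phi> y))"
  proof (rule Bochner_Integration.integrable_bound)
    show "AE p in lborel \<Otimes>\<^sub>M lborel. norm (case p of (x, y) \<Rightarrow> F x * (e x y * \<phi> y)) \<le> norm (F (fst p) * \<phi> (snd p))"
      by (rule AE_I2) (auto simp: norm_mult intro!: mult_left_mono mult_left_le_one_le e1)
    have "(\<lambda>p. F (fst p) * (e (fst p) (snd p) * \<phi> (snd p))) \<in> borel_measurable (lborel \<Otimes>\<^sub>M lborel)"
      by measurable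
    then show "(\<lambda>(x, y). F x * (e x y * \<phi> y)) \<in> borel_measurable (lborel \<Otimes>\<^sub>M lborel)"
      by (simp add: case_prod_beta')
  qed
  have "(LINT x|lborel. F x * (LINT y|lborel. e x y * \<phi> y)) = (LINT x|lborel. LINT y|lborel. F x * (e x y * \<phi> y))"
    by simp
  also have "\<dots> = (LINT y|lborel. LINT x|lborel. F x * (e x y * \<phi> y))"
    by (rule lborel_pair.Fubini_integral[OF int, symmetric])
  also have "\<dots> = (LINT y|lborel. LINT x|lborel. \<phi> y * (e x y * F x))"
    by (simp add: mult_ac)
  finally show ?thesis by simp
qed

lemma measurable_fourier_kernel:
  "(\<lambda>(x, y). cis (c * (x \<bullet> y))) \<in> borel_measurable (borel \<Otimes>\<^sub>M (borel :: R3 measure))"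
  unfolding borel_prod case_prod_beta' by (intro borel_measurable_continuous_onI continuous_intros)

lemma fun_dist_fourier:
  assumes "integrable lborel F" "integrable lborel \<phi>"
  shows "fun_dist F (fourier \<phi>) = fun_dist (fourier F) \<phi>"
  using integral_Fubini_bounded_kernel[OF assms, of "\<lambda>x y. cis (- 1 * (x \<bullet> y))"] measurable_fourier_kernel[of "-1"]
  by (simp add: fun_dist_def fourier_def inner_commute mult.commute)

lemma fun_dist_inv_fourier:
  assumes "integrable lborel F" "integrable lborel \<phi>"
  shows "fun_dist F (inv_fourier \<phi>) = fun_dist (inv_fourier F) \<phi>"
  using integral_Fubini_bounded_kernel[OF assms, of "\<lambda>x y. cis (1 * (x \<bullet> y))"] measurable_fourier_kernel[of 1]
  by (simp add: fun_dist_def inv_fourier_def inner_commute mult_ac)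

lemma fourier_measurable:
  assumes "F \<in> borel_measurable borel"
  shows "fourier F \<in> borel_measurable borel" "inv_fourier F \<in> borel_measurable borel"
proof -
  have [measurable]: "F \<in> borel_measurable borel" by fact
  have [measurable]: "(\<lambda>(\<xi>, x). cis (- (x \<bullet> \<xi>))) \<in> borel_measurable (borel \<Otimes>\<^sub>M (borel :: R3 measure))"
    "(\<lambda>(\<xi>, x). cis (\<xi> \<bullet> x)) \<in> borel_measurable (borel \<Otimes>\<^sub>M (borel :: R3 measure))"
    unfolding borel_prod case_prod_beta' by (intro borel_measurable_continuous_onI continuous_intros)+
  have [measurable]: "(\<lambda>p. cis (- (snd p \<bullet> fst p))) \<in> borel_measurable (borel \<Otimes>\<^sub>M (borel :: R3 measure))"
    "(\<lambda>p. cis (fst p \<bullet> snd p)) \<in> borel_measurable (borel \<Otimes>\<^sub>M (borel :: R3 measure))"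
    unfolding borel_prod by (intro borel_measurable_continuous_onI continuous_intros)+
  show "fourier F \<in> borel_measurable borel"
    unfolding fourier_def by (intro lborel.borel_measurable_lebesgue_integral) (simp add: case_prod_beta')
  show "inv_fourier F \<in> borel_measurable borel"
    unfolding inv_fourier_def by (intro borel_measurable_times borel_measurable_const lborel.borel_measurable_lebesgue_integral) (simp add: case_prod_beta')
qed

lemma integrable_cis_mult:
  fixes F :: "R3 \<Rightarrow> complex"
  assumes F: "integrable lborel F" and [measurable]: "g \<in> borel_measurable borel"
  shows "integrable lborel (\<lambda>x. cis (g x) * F x)"
proof -
  have [measurable]: "F \<in> borel_measurable borel" using F by (auto dest: borel_measurable_integrable)
  show ?thesis by (rule Bochner_Integration.integrable_bound[OF F]) (auto simp: norm_mult)
qed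

lemma norm_fourier_le: "norm (fourier F \<xi>) \<le> (LINT x|lborel. norm (F x))"
  unfolding fourier_def by (rule order_trans[OF integral_norm_bound]) (simp add: norm_mult)

lemma norm_inv_fourier_le: "norm (inv_fourier F x) \<le> (LINT \<xi>|lborel. norm (F \<xi>))"
proof -
  have "norm (inv_fourier F x) \<le> norm (LINT \<xi>|lborel. cis (x \<bullet> \<xi>) * F \<xi>)"
  proof -
    have "(1::real) ^ 3 \<le> (2 * pi) ^ 3" using pi_ge_two by (intro power_mono) auto
    then show ?thesis unfolding inv_fourier_def norm_mult norm_of_real
      by (intro mult_left_le_one_le) auto
  qed
  also have "\<dots> \<le> (LINT \<xi>|lborel. norm (F \<xi>))"
    by (rule order_trans[OF integral_norm_bound]) (simp add: norm_mult)
  finally show ?thesis .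
qed

lemma integral_affine_R3:
  fixes f :: "R3 \<Rightarrow> complex"
  assumes c: "c \<noteq> 0" and [measurable]: "f \<in> borel_measurable borel"
  shows "(LINT x|lborel. f x) = complex_of_real (\<bar>c\<bar> ^ 3) * (LINT x|lborel. f (t + c *\<^sub>R x))"
proof -
  have "(LINT x|lborel. f x) = (LINT x|density (distr lborel borel (\<lambda>x. t + c *\<^sub>R x)) (\<lambda>x. ennreal (\<bar>c\<bar> ^ DIM(R3))). f x)"
    by (subst lborel_affine[OF c, of t]) simp
  also have "\<dots> = (LINT x|distr lborel borel (\<lambda>x. t + c *\<^sub>R x). (\<bar>c\<bar> ^ 3) *\<^sub>R f x)"
    by (subst integral_density) auto
  also have "\<dots> = (LINT x|lborel. (\<bar>c\<bar> ^ 3) *\<^sub>R f (t + c *\<^sub>R x))"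
    by (subst integral_distr) auto
  finally show ?thesis by (simp add: scaleR_conv_of_real)
qed

lemma integral_translate_R3:
  fixes f :: "R3 \<Rightarrow> complex"
  assumes "f \<in> borel_measurable borel"
  shows "(LINT x|lborel. f (t + x)) = (LINT x|lborel. f x)"
  using integral_affine_R3[of 1 f t] assms by simp

section \<open>Gaussian integrals and the inversion formula\<close>

lemma integral_prod_Basis:
  fixes f :: "'a::euclidean_space \<Rightarrow> real \<Rightarrow> 'b::{real_normed_field, banach, second_countable_topology}"
  assumes f: "\<And>b. b \<in> Basis \<Longrightarrow> integrable lborel (f b)"
  shows "integrable lborel (\<lambda>x::'a. \<Prod>b\<in>Basis. f b (x \<bullet> b))"
    and "(LINT x|lborel. (\<Prod>b\<in>Basis. f b (x \<bullet> b))) = (\<Prod>b\<in>Basis. (LINT t|lborel. f b t))"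
proof -
  interpret product_sigma_finite "\<lambda>b::'a. lborel :: real measure" ..
  let ?T = "\<lambda>g. \<Sum>b\<in>(Basis::'a set). g b *\<^sub>R b"
  have T: "(\<Prod>b\<in>Basis. f b (?T g \<bullet> b)) = (\<Prod>b\<in>Basis. f b (g b))" for g
    by (intro prod.cong refl) (simp add: inner_sum_left inner_Basis sum.delta if_distrib[of "\<lambda>x. _ * x"] cong: if_cong)
  have [measurable]: "f b \<in> borel_measurable borel" if "b \<in> Basis" for b
    using f[OF that] by (auto dest: borel_measurable_integrable)
  have m: "(\<lambda>x::'a. \<Prod>b\<in>Basis. f b (x \<bullet> b)) \<in> borel_measurable borel" by measurable
  have Tm: "?T \<in> measurable (\<Pi>\<^sub>M b\<in>Basis. lborel) borel" by measurable
  have "integrable (\<Pi>\<^sub>M b\<in>Basis. lborel) (\<lambda>g. \<Prod>b\<in>Basis. f b (g b))"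
    by (intro product_integrable_prod f) auto
  then show "integrable lborel (\<lambda>x::'a. \<Prod>b\<in>Basis. f b (x \<bullet> b))"
    by (subst lborel_eq, subst integrable_distr_eq[OF Tm m]) (simp add: T)
  have "(LINT x|lborel. (\<Prod>b\<in>Basis. f b (x \<bullet> b))) = (LINT g|(\<Pi>\<^sub>M b\<in>Basis. lborel). (\<Prod>b\<in>Basis. f b (g b)))"
    by (subst lborel_eq, subst integral_distr[OF Tm m]) (simp add: T)
  also have "\<dots> = (\<Prod>b\<in>Basis. (LINT t|lborel. f b t))"
    by (intro product_integral_prod f) auto
  finally show "(LINT x|lborel. (\<Prod>b\<in>Basis. f b (x \<bullet> b))) = (\<Prod>b\<in>Basis. (LINT t|lborel. f b t))" .
qed

text \<open>This is the characteristic function of the standard normal distribution, with the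
  density's factor 1 / sqrt(2 \<pi>) moved to the other side.\<close>

lemma integral_gaussian_cis_real:
  fixes t :: real
  shows "integrable lborel (\<lambda>x. cis (t * x) * complex_of_real (exp (- x\<^sup>2 / 2)))"
    and "(LINT x|lborel. cis (t * x) * complex_of_real (exp (- x\<^sup>2 / 2))) = complex_of_real (sqrt (2 * pi) * exp (- t\<^sup>2 / 2))"
proof -
  have sn: "cis (t * x) * complex_of_real (exp (- x\<^sup>2 / 2))
      = complex_of_real (sqrt (2 * pi)) * (cis (t * x) * complex_of_real (std_normal_density x))" for x
    by (simp add: normal_density_def)
  have i: "integrable lborel (\<lambda>x. cis (t * x) * complex_of_real (std_normal_density x))"
    by (rule Bochner_Integration.integrable_bound[OF integrable_normal_density[of 1 0]]) (auto simp: norm_mult)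
  then show "integrable lborel (\<lambda>x. cis (t * x) * complex_of_real (exp (- x\<^sup>2 / 2)))"
    unfolding sn by (rule integrable_mult_right)
  have "complex_of_real (exp (- t\<^sup>2 / 2)) = char std_normal_distribution t" by (simp add: char_std_normal_distribution)
  also have "\<dots> = (LINT x|lborel. std_normal_density x *\<^sub>R cis (t * x))"
    unfolding char_def by (subst integral_density) (auto simp: cis_conv_exp)
  finally have "(LINT x|lborel. cis (t * x) * complex_of_real (std_normal_density x)) = complex_of_real (exp (- t\<^sup>2 / 2))"
    by (simp add: scaleR_conv_of_real mult.commute)
  then show "(LINT x|lborel. cis (t * x) * complex_of_real (exp (- x\<^sup>2 / 2))) = complex_of_real (sqrt (2 * pi) * exp (- t\<^sup>2 / 2))"
    unfolding sn by simp
qed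

definition gauss :: "R3 \<Rightarrow> real" where
  "gauss z = exp (- (norm z)\<^sup>2 / 2)"

lemma gauss_measurable [measurable]: "gauss \<in> borel_measurable borel"
  unfolding gauss_def by measurable

lemma gauss_pos: "0 < gauss z" and gauss_le_1: "gauss z \<le> 1"
  by (simp_all add: gauss_def)

lemma integral_gauss_cis:
  shows "integrable lborel (\<lambda>\<xi>. cis (z \<bullet> \<xi>) * complex_of_real (gauss \<xi>))"
    and "(LINT \<xi>|lborel. cis (z \<bullet> \<xi>) * complex_of_real (gauss \<xi>)) = complex_of_real (sqrt (2 * pi) ^ 3 * gauss z)"
proof -
  have sq: "(norm x)\<^sup>2 = (\<Sum>b\<in>Basis. (x \<bullet> b)\<^sup>2)" for x :: R3
    unfolding power2_norm_eq_inner by (subst euclidean_inner) (simp add: power2_eq_square)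
  have gp: "gauss x = (\<Prod>b\<in>Basis. exp (- (x \<bullet> b)\<^sup>2 / 2))" for x
    unfolding gauss_def sq by (simp add: exp_sum[symmetric] sum_negf sum_divide_distrib)
  have cp: "cis (\<Sum>b\<in>B. g b) = (\<Prod>b\<in>B. cis (g b))" if "finite B" for g :: "R3 \<Rightarrow> real" and B
    using that by (induction B) (auto simp: cis_mult[symmetric])
  have eq: "cis (z \<bullet> \<xi>) * complex_of_real (gauss \<xi>)
     = (\<Prod>b\<in>Basis. cis ((z \<bullet> b) * (\<xi> \<bullet> b)) * complex_of_real (exp (- (\<xi> \<bullet> b)\<^sup>2 / 2)))" for \<xi>
    unfolding gp prod.distrib of_real_prod cp[OF finite_Basis, symmetric] by (subst euclidean_inner) simp
  show "integrable lborel (\<lambda>\<xi>. cis (z \<bullet> \<xi>) * complex_of_real (gauss \<xi>))"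
    unfolding eq by (rule integral_prod_Basis(1)) (rule integral_gaussian_cis_real)
  have "(LINT \<xi>|lborel. cis (z \<bullet> \<xi>) * complex_of_real (gauss \<xi>))
     = (\<Prod>b\<in>Basis. complex_of_real (sqrt (2 * pi) * exp (- (z \<bullet> b)\<^sup>2 / 2)))"
    unfolding eq by (subst integral_prod_Basis(2)) (simp_all only: integral_gaussian_cis_real)
  also have "\<dots> = complex_of_real (sqrt (2 * pi) ^ 3 * gauss z)"
    unfolding of_real_prod[symmetric] prod.distrib gp by simp
  finally show "(LINT \<xi>|lborel. cis (z \<bullet> \<xi>) * complex_of_real (gauss \<xi>)) = complex_of_real (sqrt (2 * pi) ^ 3 * gauss z)" .
qed

lemma integrable_gauss: "integrable lborel (\<lambda>\<xi>. complex_of_real (gauss \<xi>))"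
  using integral_gauss_cis(1)[of 0] by simp

lemma gauss_scaled_fourier:
  assumes e: "0 < \<epsilon>"
  shows "integrable lborel (\<lambda>\<xi>. complex_of_real (gauss (\<epsilon> *\<^sub>R \<xi>)))"
    and "fourier (\<lambda>\<xi>. complex_of_real (gauss (\<epsilon> *\<^sub>R \<xi>))) y
      = complex_of_real (\<bar>1 / \<epsilon>\<bar> ^ 3 * (sqrt (2 * pi) ^ 3 * gauss ((1 / \<epsilon>) *\<^sub>R y)))"
proof -
  have "integrable (density (distr lborel borel (\<lambda>x. 0 + (1 / \<epsilon>) *\<^sub>R x)) (\<lambda>x. ennreal (\<bar>1 / \<epsilon>\<bar> ^ DIM(R3)))) (\<lambda>\<xi>::R3. complex_of_real (gauss (\<epsilon> *\<^sub>R \<xi>)))"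
    using e integrable_gauss by (subst integrable_density) (auto simp: integrable_distr_eq)
  then show "integrable lborel (\<lambda>\<xi>. complex_of_real (gauss (\<epsilon> *\<^sub>R \<xi>)))"
    using e by (subst lborel_affine[of "1 / \<epsilon>" 0]) auto
  have "fourier (\<lambda>\<xi>. complex_of_real (gauss (\<epsilon> *\<^sub>R \<xi>))) y
    = complex_of_real (\<bar>1 / \<epsilon>\<bar> ^ 3) * (LINT x|lborel. cis (- ((0 + (1 / \<epsilon>) *\<^sub>R x) \<bullet> y)) * complex_of_real (gauss (\<epsilon> *\<^sub>R (0 + (1 / \<epsilon>) *\<^sub>R x))))"
    unfolding fourier_def using e by (intro integral_affine_R3) auto
  also have "(LINT x|lborel. cis (- ((0 + (1 / \<epsilon>) *\<^sub>R x) \<bullet> y)) * complex_of_real (gauss (\<epsilon> *\<^sub>R (0 + (1 / \<epsilon>) *\<^sub>R x))))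
     = (LINT x|lborel. cis ((- (1 / \<epsilon>) *\<^sub>R y) \<bullet> x) * complex_of_real (gauss x))"
    using e by (intro Bochner_Integration.integral_cong) (auto simp: inner_commute)
  also have "\<dots> = complex_of_real (sqrt (2 * pi) ^ 3 * gauss ((1 / \<epsilon>) *\<^sub>R y))"
    unfolding integral_gauss_cis by (simp add: gauss_def)
  finally show "fourier (\<lambda>\<xi>. complex_of_real (gauss (\<epsilon> *\<^sub>R \<xi>))) y
      = complex_of_real (\<bar>1 / \<epsilon>\<bar> ^ 3 * (sqrt (2 * pi) ^ 3 * gauss ((1 / \<epsilon>) *\<^sub>R y)))" by simp
qed

text \<open>Inversion at the origin by Gaussian regularisation: damp the integral by a wide Gaussian
  and transpose the transform onto it. The transformed Gaussian concentrates at 0, and after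
  rescaling only the values \<psi>(\<epsilon> z) remain, which tend to \<psi>(0).\<close>

lemma integral_fourier:
  fixes \<psi> :: "R3 \<Rightarrow> complex"
  assumes int: "integrable lborel \<psi>" and cont: "continuous_on UNIV \<psi>" and bd: "\<And>x. norm (\<psi> x) \<le> B"
    and fint: "integrable lborel (fourier \<psi>)"
  shows "(LINT \<xi>|lborel. fourier \<psi> \<xi>) = complex_of_real ((2 * pi) ^ 3) * \<psi> 0"
proof -
  define \<epsilon> where "\<epsilon> n = 1 / real (Suc n)" for n
  have \<epsilon>0: "0 < \<epsilon> n" for n by (simp add: \<epsilon>_def)
  have \<epsilon>lim: "\<epsilon> \<longlonglongrightarrow> 0" unfolding \<epsilon>_def using LIMSEQ_inverse_real_of_nat by (simp add: inverse_eq_divide)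
  \<comment> \<open>This constant enters twice, as the factor in the transform of the Gaussian and
    as its total mass; c * c is the final (2 \<pi>)^3.\<close>
  define c where "c = sqrt (2 * pi) ^ 3"
  have "c * c = (sqrt (2 * pi) * sqrt (2 * pi)) ^ 3" unfolding c_def by (rule power_mult_distrib[symmetric])
  then have cc: "c * c = (2 * pi) ^ 3" using abs_of_pos[of "2 * pi"] pi_gt_zero by (simp only: real_sqrt_mult_self)
  have [measurable]: "\<psi> \<in> borel_measurable borel" using cont by (rule borel_measurable_continuous_onI)
  have [measurable]: "fourier \<psi> \<in> borel_measurable borel" by (rule fourier_measurable) simp
  have isc: "isCont gauss 0" unfolding gauss_def by (intro continuous_intros) simp
  have c0: "isCont \<psi> 0" using cont by (simp add: continuous_on_eq_continuous_at)
  have eq: "(LINT \<xi>|lborel. complex_of_real (gauss (\<epsilon> n *\<^sub>R \<xi>)) * fourier \<psi> \<xi>)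
     = complex_of_real c * (LINT z|lborel. \<psi> (\<epsilon> n *\<^sub>R z) * complex_of_real (gauss z))" for n
  proof -
    have "(LINT \<xi>|lborel. complex_of_real (gauss (\<epsilon> n *\<^sub>R \<xi>)) * fourier \<psi> \<xi>)
        = (LINT y|lborel. fourier (\<lambda>\<xi>. complex_of_real (gauss (\<epsilon> n *\<^sub>R \<xi>))) y * \<psi> y)"
      using fun_dist_fourier[OF gauss_scaled_fourier(1)[OF \<epsilon>0] int] unfolding fun_dist_def .
    also have "\<dots> = complex_of_real (\<bar>\<epsilon> n\<bar> ^ 3) * (LINT z|lborel. fourier (\<lambda>\<xi>. complex_of_real (gauss (\<epsilon> n *\<^sub>R \<xi>))) (0 + \<epsilon> n *\<^sub>R z) * \<psi> (0 + \<epsilon> n *\<^sub>R z))"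
      using \<epsilon>0[of n] by (intro integral_affine_R3) (auto intro!: borel_measurable_times fourier_measurable)
    also have "(LINT z|lborel. fourier (\<lambda>\<xi>. complex_of_real (gauss (\<epsilon> n *\<^sub>R \<xi>))) (0 + \<epsilon> n *\<^sub>R z) * \<psi> (0 + \<epsilon> n *\<^sub>R z))
       = (LINT z|lborel. complex_of_real (\<bar>1 / \<epsilon> n\<bar> ^ 3 * c) * (\<psi> (\<epsilon> n *\<^sub>R z) * complex_of_real (gauss z)))"
      using \<epsilon>0[of n] unfolding gauss_scaled_fourier(2)[OF \<epsilon>0] c_def[symmetric]
      by (intro Bochner_Integration.integral_cong) (auto simp: mult_ac)
    also have "complex_of_real (\<bar>\<epsilon> n\<bar> ^ 3) * \<dots> = complex_of_real c * (LINT z|lborel. \<psi> (\<epsilon> n *\<^sub>R z) * complex_of_real (gauss z))"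
      using \<epsilon>0[of n] by (simp add: power_divide)
    finally show ?thesis .
  qed
  have "(\<lambda>n. LINT \<xi>|lborel. complex_of_real (gauss (\<epsilon> n *\<^sub>R \<xi>)) * fourier \<psi> \<xi>) \<longlonglongrightarrow> (LINT \<xi>|lborel. fourier \<psi> \<xi>)"
  proof (rule integral_dominated_convergence[OF _ _ integrable_norm[OF fint]])
    show "AE \<xi> in lborel. (\<lambda>n. complex_of_real (gauss (\<epsilon> n *\<^sub>R \<xi>)) * fourier \<psi> \<xi>) \<longlonglongrightarrow> fourier \<psi> \<xi>"
    proof (rule AE_I2)
      fix \<xi> :: R3
      have "(\<lambda>n. \<epsilon> n *\<^sub>R \<xi>) \<longlonglongrightarrow> 0 *\<^sub>R \<xi>" by (intro tendsto_intros \<epsilon>lim)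
      then have "(\<lambda>n. gauss (\<epsilon> n *\<^sub>R \<xi>)) \<longlonglongrightarrow> gauss 0" by (intro isCont_tendsto_compose[OF isc]) simp
      then have "(\<lambda>n. complex_of_real (gauss (\<epsilon> n *\<^sub>R \<xi>)) * fourier \<psi> \<xi>) \<longlonglongrightarrow> complex_of_real (gauss 0) * fourier \<psi> \<xi>"
        by (intro tendsto_intros)
      then show "(\<lambda>n. complex_of_real (gauss (\<epsilon> n *\<^sub>R \<xi>)) * fourier \<psi> \<xi>) \<longlonglongrightarrow> fourier \<psi> \<xi>"
        by (simp add: gauss_def)
    qed
    show "AE \<xi> in lborel. norm (complex_of_real (gauss (\<epsilon> n *\<^sub>R \<xi>)) * fourier \<psi> \<xi>) \<le> norm (fourier \<psi> \<xi>)" for n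
      by (intro AE_I2) (simp add: norm_mult abs_of_pos[OF gauss_pos] mult_left_le_one_le gauss_le_1 less_imp_le[OF gauss_pos])
  qed auto
  moreover have "(\<lambda>n. LINT z|lborel. \<psi> (\<epsilon> n *\<^sub>R z) * complex_of_real (gauss z)) \<longlonglongrightarrow> (LINT z|lborel. \<psi> 0 * complex_of_real (gauss z))"
  proof (rule integral_dominated_convergence)
    show "integrable lborel (\<lambda>z. B * norm (complex_of_real (gauss z)))"
      by (intro integrable_mult_right integrable_norm integrable_gauss)
    show "AE z in lborel. (\<lambda>n. \<psi> (\<epsilon> n *\<^sub>R z) * complex_of_real (gauss z)) \<longlonglongrightarrow> \<psi> 0 * complex_of_real (gauss z)"
    proof (rule AE_I2)
      fix z :: R3
      have "(\<lambda>n. \<epsilon> n *\<^sub>R z) \<longlonglongrightarrow> 0 *\<^sub>R z" by (intro tendsto_intros \<epsilon>lim)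
      then show "(\<lambda>n. \<psi> (\<epsilon> n *\<^sub>R z) * complex_of_real (gauss z)) \<longlonglongrightarrow> \<psi> 0 * complex_of_real (gauss z)"
        by (intro tendsto_intros isCont_tendsto_compose[OF c0]) simp
    qed
    show "AE z in lborel. norm (\<psi> (\<epsilon> n *\<^sub>R z) * complex_of_real (gauss z)) \<le> B * norm (complex_of_real (gauss z))" for n
      by (intro AE_I2) (auto simp: norm_mult intro!: mult_right_mono bd)
  qed auto
  then have "(\<lambda>n. complex_of_real c * (LINT z|lborel. \<psi> (\<epsilon> n *\<^sub>R z) * complex_of_real (gauss z)))
      \<longlonglongrightarrow> complex_of_real c * (LINT z|lborel. \<psi> 0 * complex_of_real (gauss z))"
    by (intro tendsto_intros)
  ultimately have "(LINT \<xi>|lborel. fourier \<psi> \<xi>) = complex_of_real c * (LINT z|lborel. \<psi> 0 * complex_of_real (gauss z))"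
    unfolding eq by (rule LIMSEQ_unique)
  also have "(LINT z|lborel. \<psi> 0 * complex_of_real (gauss z)) = \<psi> 0 * complex_of_real c"
    using integral_gauss_cis(2)[of 0] by (simp add: c_def gauss_def)
  also have "complex_of_real c * (\<psi> 0 * complex_of_real c) = complex_of_real ((2 * pi) ^ 3) * \<psi> 0"
    unfolding cc[symmetric] by simp
  finally show ?thesis .
qed

text \<open>A translation by x multiplies the transform by \<open>cis (x \<bullet> \<xi>)\<close>,
  so inversion at x is inversion at the origin for the translated function.\<close>

lemma inv_fourier_fourier:
  fixes \<phi> :: "R3 \<Rightarrow> complex"
  assumes int: "integrable lborel \<phi>" and cont: "continuous_on UNIV \<phi>" and bd: "\<And>x. norm (\<phi> x) \<le> B"
    and fint: "integrable lborel (fourier \<phi>)"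
  shows "inv_fourier (fourier \<phi>) x = \<phi> x"
proof -
  have [measurable]: "\<phi> \<in> borel_measurable borel" using cont by (rule borel_measurable_continuous_onI)
  have f: "fourier (\<lambda>y. \<phi> (x + y)) \<xi> = cis (x \<bullet> \<xi>) * fourier \<phi> \<xi>" for \<xi>
  proof -
    have "fourier (\<lambda>y. \<phi> (x + y)) \<xi> = (LINT y|lborel. cis (x \<bullet> \<xi>) * (cis (- ((x + y) \<bullet> \<xi>)) * \<phi> (x + y)))"
      unfolding fourier_def mult.assoc[symmetric] cis_mult by (simp add: inner_add_left)
    also have "\<dots> = cis (x \<bullet> \<xi>) * (LINT y|lborel. cis (- ((x + y) \<bullet> \<xi>)) * \<phi> (x + y))" by simp
    also have "(LINT y|lborel. cis (- ((x + y) \<bullet> \<xi>)) * \<phi> (x + y)) = fourier \<phi> \<xi>"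
      unfolding fourier_def by (rule integral_translate_R3) measurable
    finally show ?thesis .
  qed
  have "(LINT \<xi>|lborel. fourier (\<lambda>y. \<phi> (x + y)) \<xi>) = complex_of_real ((2 * pi) ^ 3) * \<phi> (x + 0)"
  proof (rule integral_fourier)
    have "integrable (distr lborel borel (\<lambda>y. x + y)) \<phi>" using int by (simp add: lborel_distr_plus)
    then show "integrable lborel (\<lambda>y. \<phi> (x + y))" by (subst (asm) integrable_distr_eq) auto
    show "continuous_on UNIV (\<lambda>y. \<phi> (x + y))"
      by (intro continuous_on_compose2[OF cont]) (auto intro!: continuous_intros)
    show "integrable lborel (fourier (\<lambda>y. \<phi> (x + y)))"
      unfolding f[abs_def] by (intro integrable_cis_mult fint) measurable
  qed (rule bd)
  then show ?thesis unfolding inv_fourier_def f by simp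
qed

section \<open>Fourier transforms of test functions\<close>

lemma partials_append: "partials (is @ js) \<phi> = partials is (partials js \<phi>)"
  by (induction "is") auto

lemma test_function_partial:
  assumes "test_function \<phi>" shows "test_function (partial i \<phi>)"
proof -
  obtain S where S: "compact S" "\<And>x. x \<notin> S \<Longrightarrow> \<phi> x = 0" and sm: "smooth \<phi>"
    using assms unfolding test_function_def by blast
  have "smooth (partial i \<phi>)"
    unfolding smooth_def
  proof (intro allI)
    fix "is" x
    \<comment> \<open>The head of the list is the outermost derivative, so a derivative taken
      beforehand is appended at the end.\<close>
    have "partials is (partial i \<phi>) = partials (is @ [i]) \<phi>" by (simp add: partials_append)
    then show "partials is (partial i \<phi>) differentiable at x" using sm by (simp only: smooth_def)
  qed
  moreover have "partial i \<phi> x = 0" if "x \<notin> S" for x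
  proof -
    have "((\<lambda>x. 0) has_derivative (\<lambda>v. 0)) (at x)" by simp
    then have "(\<phi> has_derivative (\<lambda>v. 0)) (at x)"
      by (rule has_derivative_transform_within_open[OF _ open_Compl[OF compact_imp_closed[OF S(1)]]])
         (use that S in auto)
    then show ?thesis unfolding partial_def using frechet_derivative_at[of \<phi> "\<lambda>v. 0" x] by metis
  qed
  ultimately show ?thesis using S(1) unfolding test_function_def by blast
qed

lemma test_function_partials: "test_function \<phi> \<Longrightarrow> test_function (partials is \<phi>)"
  by (induction "is") (auto intro: test_function_partial)

lemma test_function_bounded_support:
  assumes "test_function \<phi>"
  obtains B R where "0 \<le> B" "\<And>x. norm (\<phi> x) \<le> B" "0 \<le> R" "\<And>x. R < norm x \<Longrightarrow> \<phi> x = 0"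
proof -
  obtain S where S: "compact S" "\<And>x. x \<notin> S \<Longrightarrow> \<phi> x = 0" using assms unfolding test_function_def by blast
  obtain R where R: "\<And>x. x \<in> S \<Longrightarrow> norm x \<le> R" using compact_imp_bounded[OF S(1)] by (auto simp: bounded_iff)
  have c: "compact (\<phi> ` S)"
    using S(1) test_function_continuous[OF assms] by (intro compact_continuous_image) (auto intro: continuous_on_subset)
  then obtain B where B: "\<And>x. x \<in> S \<Longrightarrow> norm (\<phi> x) \<le> B" using compact_imp_bounded[OF c] by (auto simp: bounded_iff)
  show thesis
  proof (rule that[of "max 0 B" "max 0 R"])
    show "norm (\<phi> x) \<le> max 0 B" for x using B[of x] S(2)[of x] by (cases "x \<in> S") auto
    show "\<phi> x = 0" if "max 0 R < norm x" for x using R[of x] S(2)[of x] that by (cases "x \<in> S") auto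
  qed auto
qed

lemma integrable_indicator_cball: "integrable lborel (indicator (cball 0 R :: R3 set) :: R3 \<Rightarrow> real)"
  using emeasure_lborel_cball_finite[of 0 R] by (intro integrable_real_indicator) auto

lemma test_function_integrable:
  assumes "test_function \<phi>" shows "integrable lborel \<phi>"
proof -
  obtain B R where BR: "0 \<le> B" "\<And>x. norm (\<phi> x) \<le> B" "0 \<le> R" "\<And>x. R < norm x \<Longrightarrow> \<phi> x = 0"
    using test_function_bounded_support[OF assms] by metis
  have "integrable lborel (\<lambda>x::R3. B * indicator (cball 0 R) x)"
    by (intro integrable_mult_right integrable_indicator_cball)
  then show ?thesis
  proof (rule Bochner_Integration.integrable_bound)
    show "AE x in lborel. norm (\<phi> x) \<le> norm (B * indicator (cball 0 R) x)"
      using BR by (intro AE_I2) (auto split: split_indicator simp: not_le)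
  qed (use test_function_measurable[OF assms] in simp)
qed

text \<open>Obtained by differentiating under the integral sign along a translation, which avoids an
  integration by parts in a single variable.\<close>

lemma fourier_partial:
  assumes \<phi>: "test_function \<phi>"
  shows "fourier (partial i \<phi>) \<xi> = \<i> * (\<xi> $ i) * fourier \<phi> \<xi>"
proof -
  define v where "v = (axis i 1 :: R3)"
  have v1: "norm v = 1" by (simp add: v_def)
  have v\<xi>: "v \<bullet> \<xi> = \<xi> $ i" by (simp add: v_def inner_axis')
  define \<epsilon> where "\<epsilon> n = 1 / real (Suc n)" for n
  have \<epsilon>0: "0 < \<epsilon> n" "\<epsilon> n \<le> 1" for n by (simp_all add: \<epsilon>_def)
  have \<epsilon>lim: "\<epsilon> \<longlonglongrightarrow> 0" unfolding \<epsilon>_def using LIMSEQ_inverse_real_of_nat by (simp add: inverse_eq_divide)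
  have \<epsilon>at: "filterlim \<epsilon> (at 0) sequentially"
    using \<epsilon>lim \<epsilon>0 by (auto simp: filterlim_at intro!: always_eventually) (metis less_irrefl)
  have [measurable]: "\<phi> \<in> borel_measurable borel" by (rule test_function_measurable[OF \<phi>])
  have der: "((\<lambda>t. \<phi> (x + t *\<^sub>R v)) has_vector_derivative partial i \<phi> (x + s *\<^sub>R v)) (at s)" for x s
  proof -
    have "\<phi> differentiable at (x + s *\<^sub>R v)" using \<phi> unfolding test_function_def smooth_def by (metis partials.simps(1))
    then have d: "(\<phi> has_derivative frechet_derivative \<phi> (at (x + s *\<^sub>R v))) (at (x + s *\<^sub>R v))"
      by (simp add: frechet_derivative_works)
    have "((\<lambda>t. x + t *\<^sub>R v) has_derivative (\<lambda>t. t *\<^sub>R v)) (at s)" by (auto intro!: derivative_eq_intros)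
    from has_derivative_compose[OF this d] show ?thesis
      unfolding has_vector_derivative_def partial_def v_def[symmetric]
      using linear_frechet_derivative[OF \<open>\<phi> differentiable at (x + s *\<^sub>R v)\<close>] by (simp add: linear_scale)
  qed
  obtain B where B: "0 \<le> B" "\<And>x. norm (partial i \<phi> x) \<le> B"
    using test_function_bounded_support[OF test_function_partial[OF \<phi>]] by metis
  obtain R where R: "0 \<le> R" "\<And>x. R < norm x \<Longrightarrow> \<phi> x = 0"
    using test_function_bounded_support[OF \<phi>] by metis
  define q where "q n x = (\<phi> (x + \<epsilon> n *\<^sub>R v) - \<phi> x) /\<^sub>R \<epsilon> n" for n x
  have [measurable]: "q n \<in> borel_measurable borel" for n unfolding q_def by measurable
  have qlim: "(\<lambda>n. q n x) \<longlonglongrightarrow> partial i \<phi> x" for x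
  proof -
    have "((\<lambda>h. (\<phi> (x + h *\<^sub>R v) - \<phi> x) /\<^sub>R h) \<longlongrightarrow> partial i \<phi> x) (at 0)"
    proof -
      have "((\<lambda>h. norm (\<phi> (x + h *\<^sub>R v) - \<phi> x - h *\<^sub>R partial i \<phi> x) / norm h) \<longlongrightarrow> 0) (at 0)"
        using der[of x 0] by (simp add: has_vector_derivative_def has_derivative_at)
      then have "((\<lambda>h. norm ((\<phi> (x + h *\<^sub>R v) - \<phi> x) /\<^sub>R h - partial i \<phi> x)) \<longlongrightarrow> 0) (at 0)"
      proof (rule tendsto_cong[THEN iffD1, rotated], unfold eventually_at_filter, intro always_eventually allI impI)
        fix h :: real assume h: "h \<noteq> 0"
        have "(\<phi> (x + h *\<^sub>R v) - \<phi> x) /\<^sub>R h - partial i \<phi> x = (\<phi> (x + h *\<^sub>R v) - \<phi> x - h *\<^sub>R partial i \<phi> x) /\<^sub>R h"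
          using h by (simp add: scaleR_diff_right)
        then show "norm (\<phi> (x + h *\<^sub>R v) - \<phi> x - h *\<^sub>R partial i \<phi> x) / norm h = norm ((\<phi> (x + h *\<^sub>R v) - \<phi> x) /\<^sub>R h - partial i \<phi> x)"
          by (simp add: divide_inverse mult.commute)
      qed
      then show ?thesis by (subst Lim_null) (rule tendsto_norm_zero_cancel)
    qed
    from filterlim_compose[OF this \<epsilon>at] show ?thesis unfolding q_def .
  qed
  \<comment> \<open>An integrable majorant independent of n: B comes from the mean value inequality,
    and the radius grows by 1 because the steps \<open>\<epsilon> n\<close> along the unit vector v
    have length at most 1.\<close>
  have qbd: "norm (q n x) \<le> B * indicator (cball 0 (R + 1)) x" for n x
  proof (cases "norm x \<le> R + 1")
    case True
    have "norm (\<phi> (x + \<epsilon> n *\<^sub>R v) - \<phi> (x + 0 *\<^sub>R v)) \<le> B * norm (\<epsilon> n - 0)"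
    proof (rule differentiable_bound[of "{0..\<epsilon> n}"])
      show "((\<lambda>t. \<phi> (x + t *\<^sub>R v)) has_derivative (\<lambda>h. h *\<^sub>R partial i \<phi> (x + s *\<^sub>R v))) (at s within {0..\<epsilon> n})" for s
        using has_vector_derivative_at_within[OF der] unfolding has_vector_derivative_def .
      show "onorm (\<lambda>h. h *\<^sub>R partial i \<phi> (x + s *\<^sub>R v)) \<le> B" for s
        by (intro onorm_le) (simp add: mult.commute[of B] mult_left_mono[OF B(2)])
    qed (use B \<epsilon>0[of n] in auto)
    then show ?thesis using True \<epsilon>0[of n] by (simp add: q_def divide_simps mult.commute)
  next
    case False
    have "norm x \<le> norm (x + \<epsilon> n *\<^sub>R v) + norm (\<epsilon> n *\<^sub>R v)" using norm_triangle_ineq4[of "x + \<epsilon> n *\<^sub>R v" "\<epsilon> n *\<^sub>R v"] by simp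
    then have "R < norm (x + \<epsilon> n *\<^sub>R v)" using False \<epsilon>0[of n] v1 by simp
    then show ?thesis using False R by (simp add: q_def)
  qed
  have L1: "(\<lambda>n. LINT x|lborel. cis (- (x \<bullet> \<xi>)) * q n x) \<longlonglongrightarrow> (LINT x|lborel. cis (- (x \<bullet> \<xi>)) * partial i \<phi> x)"
  proof (rule integral_dominated_convergence)
    show "integrable lborel (\<lambda>x::R3. B * indicator (cball 0 (R + 1)) x :: real)"
      by (intro integrable_mult_right integrable_indicator_cball)
    show "(\<lambda>x. cis (- (x \<bullet> \<xi>)) * partial i \<phi> x) \<in> borel_measurable lborel"
      using test_function_measurable[OF test_function_partial[OF \<phi>]] by measurable
    show "AE x in lborel. (\<lambda>n. cis (- (x \<bullet> \<xi>)) * q n x) \<longlonglongrightarrow> cis (- (x \<bullet> \<xi>)) * partial i \<phi> x"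
      by (intro AE_I2 tendsto_intros qlim)
    show "AE x in lborel. norm (cis (- (x \<bullet> \<xi>)) * q n x) \<le> B * indicator (cball 0 (R + 1)) x" for n
      using qbd by (intro AE_I2) (simp add: norm_mult)
  qed measurable
  \<comment> \<open>Translation invariance moves the difference quotient from \<phi> to the phase,
    where its limit is the factor i (v \<bullet> \<xi>).\<close>
  have E: "(LINT x|lborel. cis (- (x \<bullet> \<xi>)) * q n x) = ((cis (\<epsilon> n * (v \<bullet> \<xi>)) - 1) /\<^sub>R \<epsilon> n) * fourier \<phi> \<xi>" for n
  proof -
    have 1: "integrable lborel (\<lambda>x. cis (- (x \<bullet> \<xi>)) * \<phi> x)"
      by (intro integrable_cis_mult test_function_integrable \<phi>) measurable
    have "integrable (distr lborel borel (\<lambda>y. \<epsilon> n *\<^sub>R v + y)) (\<lambda>x. cis (- (x \<bullet> \<xi>)) * \<phi> x)" using 1 by (simp add: lborel_distr_plus)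
    then have "integrable lborel (\<lambda>y. cis (- ((\<epsilon> n *\<^sub>R v + y) \<bullet> \<xi>)) * \<phi> (\<epsilon> n *\<^sub>R v + y))" by (subst (asm) integrable_distr_eq) auto
    then have 2: "integrable lborel (\<lambda>y. cis (\<epsilon> n * (v \<bullet> \<xi>)) * (cis (- ((\<epsilon> n *\<^sub>R v + y) \<bullet> \<xi>)) * \<phi> (\<epsilon> n *\<^sub>R v + y)))"
      by (rule integrable_mult_right)
    have "(LINT x|lborel. cis (- (x \<bullet> \<xi>)) * q n x)
       = (LINT x|lborel. (cis (\<epsilon> n * (v \<bullet> \<xi>)) * (cis (- ((\<epsilon> n *\<^sub>R v + x) \<bullet> \<xi>)) * \<phi> (\<epsilon> n *\<^sub>R v + x)) - cis (- (x \<bullet> \<xi>)) * \<phi> x) /\<^sub>R \<epsilon> n)"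
    proof (intro Bochner_Integration.integral_cong refl)
      fix x
      have "cis (\<epsilon> n * (v \<bullet> \<xi>)) * (cis (- ((\<epsilon> n *\<^sub>R v + x) \<bullet> \<xi>)) * \<phi> (\<epsilon> n *\<^sub>R v + x)) = cis (- (x \<bullet> \<xi>)) * \<phi> (x + \<epsilon> n *\<^sub>R v)"
        unfolding mult.assoc[symmetric] cis_mult by (simp add: inner_add_left add.commute)
      then show "cis (- (x \<bullet> \<xi>)) * q n x = (cis (\<epsilon> n * (v \<bullet> \<xi>)) * (cis (- ((\<epsilon> n *\<^sub>R v + x) \<bullet> \<xi>)) * \<phi> (\<epsilon> n *\<^sub>R v + x)) - cis (- (x \<bullet> \<xi>)) * \<phi> x) /\<^sub>R \<epsilon> n"
        by (simp add: q_def right_diff_distrib)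
    qed
    also have "\<dots> = ((LINT x|lborel. cis (\<epsilon> n * (v \<bullet> \<xi>)) * (cis (- ((\<epsilon> n *\<^sub>R v + x) \<bullet> \<xi>)) * \<phi> (\<epsilon> n *\<^sub>R v + x))) - fourier \<phi> \<xi>) /\<^sub>R \<epsilon> n"
      unfolding fourier_def integral_scaleR_right Bochner_Integration.integral_diff[OF 2 1] ..
    also have "(LINT x|lborel. cis (\<epsilon> n * (v \<bullet> \<xi>)) * (cis (- ((\<epsilon> n *\<^sub>R v + x) \<bullet> \<xi>)) * \<phi> (\<epsilon> n *\<^sub>R v + x)))
      = cis (\<epsilon> n * (v \<bullet> \<xi>)) * (LINT x|lborel. cis (- ((\<epsilon> n *\<^sub>R v + x) \<bullet> \<xi>)) * \<phi> (\<epsilon> n *\<^sub>R v + x))" by simp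
    also have "(LINT x|lborel. cis (- ((\<epsilon> n *\<^sub>R v + x) \<bullet> \<xi>)) * \<phi> (\<epsilon> n *\<^sub>R v + x)) = fourier \<phi> \<xi>"
      unfolding fourier_def by (rule integral_translate_R3) measurable
    finally show ?thesis by (simp add: left_diff_distrib)
  qed
  have L2: "(\<lambda>n. ((cis (\<epsilon> n * (v \<bullet> \<xi>)) - 1) /\<^sub>R \<epsilon> n) * fourier \<phi> \<xi>) \<longlonglongrightarrow> (\<i> * (v \<bullet> \<xi>)) * fourier \<phi> \<xi>"
  proof -
    have "((\<lambda>h. (exp (h * (\<i> * complex_of_real (v \<bullet> \<xi>))) - 1) / h) \<longlongrightarrow> \<i> * complex_of_real (v \<bullet> \<xi>)) (at 0)"
    proof -
      have "((\<lambda>h. exp (h * (\<i> * complex_of_real (v \<bullet> \<xi>)))) has_field_derivative \<i> * complex_of_real (v \<bullet> \<xi>)) (at 0)"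
        by (auto intro!: derivative_eq_intros)
      then show ?thesis by (simp add: DERIV_def)
    qed
    moreover have "filterlim (\<lambda>n. complex_of_real (\<epsilon> n)) (at 0) sequentially"
      using tendsto_of_real[OF \<epsilon>lim, where 'a=complex] \<epsilon>0 by (auto simp: filterlim_at intro!: always_eventually) (metis less_irrefl)
    ultimately have "(\<lambda>n. (exp (complex_of_real (\<epsilon> n) * (\<i> * complex_of_real (v \<bullet> \<xi>))) - 1) / complex_of_real (\<epsilon> n)) \<longlonglongrightarrow> \<i> * complex_of_real (v \<bullet> \<xi>)"
      by (rule filterlim_compose)
    then have "(\<lambda>n. (cis (\<epsilon> n * (v \<bullet> \<xi>)) - 1) /\<^sub>R \<epsilon> n) \<longlonglongrightarrow> \<i> * complex_of_real (v \<bullet> \<xi>)"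
      by (simp add: cis_conv_exp scaleR_conv_of_real divide_inverse mult_ac)
    then show ?thesis by (intro tendsto_intros)
  qed
  have "(LINT x|lborel. cis (- (x \<bullet> \<xi>)) * partial i \<phi> x) = (\<i> * (v \<bullet> \<xi>)) * fourier \<phi> \<xi>"
    by (rule LIMSEQ_unique[OF L1[unfolded E] L2])
  then show ?thesis unfolding v\<xi> by (simp add: fourier_def)
qed

lemma fourier_partials:
  assumes "test_function \<phi>"
  shows "fourier (partials is \<phi>) \<xi> = (\<Prod>i\<leftarrow>is. \<i> * (\<xi> $ i)) * fourier \<phi> \<xi>"
  using fourier_partial[OF test_function_partials[OF assms]] by (induction "is") (simp_all add: mult.assoc)

text \<open>A product weight reduces integrability in space to that of 1 / (1 + t^2) on the line.
  Its reciprocal is a polynomial, which suits both transforms of derivatives and Schwartz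
  seminorms.\<close>

lemma integrable_prod_inverse_square:
  "integrable lborel (\<lambda>x::R3. 1 / ((1 + (x $ 1)\<^sup>2) * (1 + (x $ 2)\<^sup>2) * (1 + (x $ 3)\<^sup>2)))"
proof -
  have "integrable lborel (\<lambda>t::real. inverse (1 + t\<^sup>2))"
    using integrable_inverse_1_plus_square by (simp add: set_integrable_def)
  from integral_prod_Basis(1)[where 'a=R3 and f="\<lambda>b t. inverse (1 + t\<^sup>2)", OF this]
  show ?thesis unfolding prod_Basis_R3 by (simp add: inner_axis divide_inverse)
qed

lemma integrable_of_moments:
  fixes F :: "R3 \<Rightarrow> complex"
  assumes [measurable]: "F \<in> borel_measurable borel"
    and le: "\<And>x. norm (F x) * ((1 + (x $ 1)\<^sup>2) * (1 + (x $ 2)\<^sup>2) * (1 + (x $ 3)\<^sup>2)) \<le> C"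
  shows "integrable lborel F"
    and "(LINT x|lborel. norm (F x)) \<le> C * (LINT x|(lborel :: R3 measure). 1 / ((1 + (x $ 1)\<^sup>2) * (1 + (x $ 2)\<^sup>2) * (1 + (x $ 3)\<^sup>2)))"
proof -
  have pos: "0 < (1 + (x $ 1)\<^sup>2) * (1 + (x $ 2)\<^sup>2) * (1 + (x $ 3)\<^sup>2)" for x :: R3
    by (intro mult_pos_pos add_pos_nonneg) auto
  have n: "norm (F x) \<le> C * (1 / ((1 + (x $ 1)\<^sup>2) * (1 + (x $ 2)\<^sup>2) * (1 + (x $ 3)\<^sup>2)))" for x
    using le[of x] pos[of x] by (simp only: times_divide_eq_right mult_1_right pos_le_divide_eq)
  have i: "integrable lborel (\<lambda>x::R3. C * (1 / ((1 + (x $ 1)\<^sup>2) * (1 + (x $ 2)\<^sup>2) * (1 + (x $ 3)\<^sup>2))))"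
    by (intro integrable_mult_right integrable_prod_inverse_square)
  then show F: "integrable lborel F"
    by (rule Bochner_Integration.integrable_bound)
       (simp, rule AE_I2, unfold real_norm_def, rule order_trans[OF n abs_ge_self])
  show "(LINT x|lborel. norm (F x)) \<le> C * (LINT x|(lborel :: R3 measure). 1 / ((1 + (x $ 1)\<^sup>2) * (1 + (x $ 2)\<^sup>2) * (1 + (x $ 3)\<^sup>2)))"
    using integral_mono[OF integrable_norm[OF F] i n] unfolding integral_mult_right_zero .
qed

text \<open>The product weight expands into eight monomials in the coordinates. Each of them times
  |fourier \<phi>| is the modulus of the transform of a derivative of \<phi>, hence bounded by the
  integral of that derivative's modulus.\<close>

lemma test_function_fourier_integrable:
  assumes \<phi>: "test_function \<phi>" shows "integrable lborel (fourier \<phi>)"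
proof -
  define M where "M is = (LINT x|lborel. norm (partials is \<phi> x))" for "is"
  have M: "norm (fourier \<phi> \<xi>) * (\<Prod>i\<leftarrow>is. \<bar>\<xi> $ i\<bar>) \<le> M is" for "is" \<xi>
  proof -
    have "norm (\<Prod>i\<leftarrow>is. \<i> * complex_of_real (\<xi> $ i)) = (\<Prod>i\<leftarrow>is. \<bar>\<xi> $ i\<bar>)"
      by (induction "is") (auto simp: norm_mult)
    then have "norm (fourier \<phi> \<xi>) * (\<Prod>i\<leftarrow>is. \<bar>\<xi> $ i\<bar>) = norm (fourier (partials is \<phi>) \<xi>)"
      unfolding fourier_partials[OF \<phi>] norm_mult by simp
    then show ?thesis unfolding M_def using norm_fourier_le[of "partials is \<phi>" \<xi>] by simp
  qed
  show ?thesis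
  proof (rule integrable_of_moments(1))
    show "fourier \<phi> \<in> borel_measurable borel" by (intro fourier_measurable test_function_measurable \<phi>)
    fix \<xi> :: R3
    have "norm (fourier \<phi> \<xi>) * ((1 + (\<xi> $ 1)\<^sup>2) * (1 + (\<xi> $ 2)\<^sup>2) * (1 + (\<xi> $ 3)\<^sup>2))
      = norm (fourier \<phi> \<xi>) * (\<Prod>i\<leftarrow>[]. \<bar>\<xi> $ i\<bar>) + norm (fourier \<phi> \<xi>) * (\<Prod>i\<leftarrow>[1,1]. \<bar>\<xi> $ i\<bar>)
      + norm (fourier \<phi> \<xi>) * (\<Prod>i\<leftarrow>[2,2]. \<bar>\<xi> $ i\<bar>) + norm (fourier \<phi> \<xi>) * (\<Prod>i\<leftarrow>[3,3]. \<bar>\<xi> $ i\<bar>)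
      + norm (fourier \<phi> \<xi>) * (\<Prod>i\<leftarrow>[1,1,2,2]. \<bar>\<xi> $ i\<bar>) + norm (fourier \<phi> \<xi>) * (\<Prod>i\<leftarrow>[1,1,3,3]. \<bar>\<xi> $ i\<bar>)
      + norm (fourier \<phi> \<xi>) * (\<Prod>i\<leftarrow>[2,2,3,3]. \<bar>\<xi> $ i\<bar>) + norm (fourier \<phi> \<xi>) * (\<Prod>i\<leftarrow>[1,1,2,2,3,3]. \<bar>\<xi> $ i\<bar>)"
      by (simp add: power2_eq_square algebra_simps flip: abs_mult)
    also have "\<dots> \<le> M [] + M [1,1] + M [2,2] + M [3,3] + M [1,1,2,2] + M [1,1,3,3] + M [2,2,3,3] + M [1,1,2,2,3,3]"
      by (intro add_mono M)
    finally show "norm (fourier \<phi> \<xi>) * ((1 + (\<xi> $ 1)\<^sup>2) * (1 + (\<xi> $ 2)\<^sup>2) * (1 + (\<xi> $ 3)\<^sup>2))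
       \<le> M [] + M [1,1] + M [2,2] + M [3,3] + M [1,1,2,2] + M [1,1,3,3] + M [2,2,3,3] + M [1,1,2,2,3,3]" .
  qed
qed

lemma test_function_inv_fourier_fourier:
  assumes "test_function \<phi>" shows "inv_fourier (fourier \<phi>) = \<phi>"
proof
  fix x
  obtain B where "\<And>x. norm (\<phi> x) \<le> B" using test_function_bounded_support[OF assms] by metis
  then show "inv_fourier (fourier \<phi>) x = \<phi> x"
    using assms by (intro inv_fourier_fourier test_function_integrable test_function_continuous test_function_fourier_integrable)
qed

section \<open>The Strichartz estimates\<close>

lemma schwartz_integral_bound:
  assumes \<phi>: "\<phi> \<in> schwartz"
  shows "integrable lborel \<phi>"
    and "(LINT x|lborel. norm (\<phi> x)) \<le> schwartz_seminorm 6 [] \<phi> *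
       (LINT x|(lborel :: R3 measure). 1 / ((1 + (x $ 1)\<^sup>2) * (1 + (x $ 2)\<^sup>2) * (1 + (x $ 3)\<^sup>2)))"
proof -
  have sm: "smooth \<phi>" and bd: "bdd_above (range (\<lambda>x. (1 + norm x) ^ 6 * norm (partials [] \<phi> x)))"
    using \<phi> unfolding schwartz_def mem_Collect_eq by (blast, metis)
  have "\<phi> differentiable at x" for x using sm unfolding smooth_def by (metis partials.simps(1))
  then have "continuous_on UNIV \<phi>"
    by (simp add: continuous_at_imp_continuous_on differentiable_imp_continuous_within)
  then have m: "\<phi> \<in> borel_measurable borel" by (rule borel_measurable_continuous_onI)
  have le: "norm (\<phi> x) * ((1 + (x $ 1)\<^sup>2) * (1 + (x $ 2)\<^sup>2) * (1 + (x $ 3)\<^sup>2)) \<le> schwartz_seminorm 6 [] \<phi>" for x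
  proof -
    \<comment> \<open>Each of the three factors of the weight costs two powers of 1 + |x|, whence
      the exponent 6.\<close>
    have c: "1 + (x $ i)\<^sup>2 \<le> (1 + norm x)\<^sup>2" for i
    proof -
      have "(x $ i)\<^sup>2 \<le> (norm x)\<^sup>2" using component_le_norm_cart[of x i] by (metis abs_ge_zero power2_abs power_mono)
      then show ?thesis using norm_ge_zero[of x] by (simp add: power2_sum add_increasing2)
    qed
    have "(1 + (x $ 1)\<^sup>2) * (1 + (x $ 2)\<^sup>2) * (1 + (x $ 3)\<^sup>2) \<le> (1 + norm x)\<^sup>2 * (1 + norm x)\<^sup>2 * (1 + norm x)\<^sup>2"
      by (intro mult_mono c) auto
    also have "\<dots> = (1 + norm x) ^ 6" by (simp add: power_add[symmetric])
    finally have "norm (\<phi> x) * ((1 + (x $ 1)\<^sup>2) * (1 + (x $ 2)\<^sup>2) * (1 + (x $ 3)\<^sup>2)) \<le> norm (\<phi> x) * (1 + norm x) ^ 6"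
      by (intro mult_left_mono) auto
    also have "\<dots> = (1 + norm x) ^ 6 * norm (partials [] \<phi> x)" by simp
    also have "\<dots> \<le> schwartz_seminorm 6 [] \<phi>"
      unfolding schwartz_seminorm_def by (rule cSUP_upper[OF UNIV_I bd])
    finally show ?thesis .
  qed
  show "integrable lborel \<phi>" by (rule integrable_of_moments(1)[OF m le])
  show "(LINT x|lborel. norm (\<phi> x)) \<le> schwartz_seminorm 6 [] \<phi> *
       (LINT x|(lborel :: R3 measure). 1 / ((1 + (x $ 1)\<^sup>2) * (1 + (x $ 2)\<^sup>2) * (1 + (x $ 3)\<^sup>2)))"
    by (rule integrable_of_moments(2)[OF m le])
qed

lemma schwartz_seminorm_nonneg:
  assumes "\<phi> \<in> schwartz" shows "0 \<le> schwartz_seminorm m is \<phi>"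
proof -
  have bd: "bdd_above (range (\<lambda>x. (1 + norm x) ^ m * norm (partials is \<phi> x)))" using assms by (simp add: schwartz_def)
  have "0 \<le> (1 + norm (0::R3)) ^ m * norm (partials is \<phi> 0)" by simp
  also have "\<dots> \<le> schwartz_seminorm m is \<phi>" unfolding schwartz_seminorm_def by (rule cSUP_upper[OF UNIV_I bd])
  finally show ?thesis .
qed

lemma integrable_bounded_mult:
  fixes g \<phi> :: "R3 \<Rightarrow> complex"
  assumes [measurable]: "g \<in> borel_measurable borel" and g: "\<And>x. norm (g x) \<le> M" and \<phi>: "integrable lborel \<phi>"
  shows "integrable lborel (\<lambda>x. g x * \<phi> x)"
proof -
  have [measurable]: "\<phi> \<in> borel_measurable borel" using \<phi> by (auto dest: borel_measurable_integrable)
  have "integrable lborel (\<lambda>x. M * norm (\<phi> x))" using \<phi> by (intro integrable_mult_right integrable_norm)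
  then show ?thesis
  proof (rule Bochner_Integration.integrable_bound)
    have "norm (g x * \<phi> x) \<le> \<bar>M * norm (\<phi> x)\<bar>" for x
      unfolding norm_mult by (rule order_trans[OF mult_right_mono[OF g] abs_ge_self]) simp
    then show "AE x in lborel. norm (g x * \<phi> x) \<le> norm (M * norm (\<phi> x))" by simp
  qed simp
qed

text \<open>The zeroth order seminorm with exponent 6 controls the integral of a Schwartz function's
  modulus, and the other seminorms in the sum are nonnegative. The hypothesis asks for agreement on
  integrable functions, which is where the transposition formulas hold.\<close>

lemma tempered_bounded_density:
  fixes g :: "R3 \<Rightarrow> complex"
  assumes g: "g \<in> borel_measurable borel" "\<And>x. norm (g x) \<le> M"
    and u: "\<And>\<phi>. integrable lborel \<phi> \<Longrightarrow> u \<phi> = fun_dist g \<phi>"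
  shows "u \<in> tempered"
proof -
  define D where "D = (LINT x|(lborel :: R3 measure). 1 / ((1 + (x $ 1)\<^sup>2) * (1 + (x $ 2)\<^sup>2) * (1 + (x $ 3)\<^sup>2)))"
  have D0: "0 \<le> D" unfolding D_def by (intro integral_nonneg_AE AE_I2) (auto intro!: mult_nonneg_nonneg)
  have M0: "0 \<le> M" using g(2)[of 0] norm_ge_zero order_trans by blast
  note gi = integrable_bounded_mult[OF g]
  have "u (\<lambda>x. \<phi> x + \<psi> x) = u \<phi> + u \<psi>" if "\<phi> \<in> schwartz" "\<psi> \<in> schwartz" for \<phi> \<psi>
    using schwartz_integral_bound(1)[OF that(1)] schwartz_integral_bound(1)[OF that(2)]
    by (simp add: u fun_dist_def distrib_left gi)
  moreover have "u (\<lambda>x. c * \<phi> x) = c * u \<phi>" if "\<phi> \<in> schwartz" for c \<phi>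
    using schwartz_integral_bound(1)[OF that] by (simp add: u fun_dist_def mult.left_commute[of _ c])
  moreover have "norm (u \<phi>) \<le> (M * D) * (\<Sum>is\<in>{is. length is \<le> 6}. schwartz_seminorm 6 is \<phi>)" if \<phi>: "\<phi> \<in> schwartz" for \<phi>
  proof -
    have i: "integrable lborel \<phi>" by (rule schwartz_integral_bound(1)[OF \<phi>])
    have "norm (u \<phi>) \<le> (LINT x|lborel. norm (g x * \<phi> x))" unfolding u[OF i] fun_dist_def by (rule integral_norm_bound)
    also have "\<dots> \<le> (LINT x|lborel. M * norm (\<phi> x))"
      using i by (intro integral_mono integrable_norm gi integrable_mult_right) (auto simp: norm_mult intro!: mult_right_mono g)
    also have "\<dots> = M * (LINT x|lborel. norm (\<phi> x))" by simp
    also have "\<dots> \<le> M * (schwartz_seminorm 6 [] \<phi> * D)"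
      using schwartz_integral_bound(2)[OF \<phi>] M0 unfolding D_def by (intro mult_left_mono)
    also have "\<dots> \<le> M * ((\<Sum>is\<in>{is. length is \<le> 6}. schwartz_seminorm 6 is \<phi>) * D)"
    proof (intro mult_left_mono mult_right_mono M0 D0)
      have "finite {is :: 3 list. length is \<le> 6}" using finite_lists_length_le[of "UNIV :: 3 set" 6] by simp
      then show "schwartz_seminorm 6 [] \<phi> \<le> (\<Sum>is\<in>{is. length is \<le> 6}. schwartz_seminorm 6 is \<phi>)"
        by (intro member_le_sum) (auto intro: schwartz_seminorm_nonneg[OF \<phi>])
    qed
    finally show ?thesis by (simp add: mult_ac)
  qed
  ultimately show ?thesis unfolding tempered_def by blast
qed

lemma locally_integrable_bounded:
  fixes g :: "R3 \<Rightarrow> complex"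
  assumes g: "g \<in> borel_measurable borel" "\<And>x. norm (g x) \<le> M"
  shows "locally_integrable g"
  unfolding locally_integrable_def
proof (intro conjI allI impI g)
  fix S :: "R3 set" assume "compact S"
  then have S: "S \<in> sets borel" "emeasure lborel S < \<infinity>"
    using emeasure_compact_finite[of S] by (auto intro: borel_closed compact_imp_closed)
  then have "integrable lborel (\<lambda>x. complex_of_real (indicator S x))"
    by (intro integrable_of_real integrable_real_indicator) auto
  from integrable_bounded_mult[OF g this] show "set_integrable lborel S g"
    unfolding set_integrable_def by (simp add: scaleR_conv_of_real mult.commute)
qed

lemma locally_integrable_mult:
  fixes g :: "R3 \<Rightarrow> complex"
  assumes a: "a \<in> borel_measurable borel" "\<And>x. norm (a x) \<le> M" and g: "locally_integrable g"
  shows "locally_integrable (\<lambda>x. a x * g x)"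
  unfolding locally_integrable_def
proof (intro conjI allI impI)
  show "(\<lambda>x. a x * g x) \<in> borel_measurable borel" using a(1) g by (auto simp: locally_integrable_def)
  fix S :: "R3 set" assume "compact S"
  then have "integrable lborel (\<lambda>x. indicator S x *\<^sub>R g x)" using g unfolding locally_integrable_def set_integrable_def by blast
  from integrable_bounded_mult[OF a this] show "set_integrable lborel S (\<lambda>x. a x * g x)"
    unfolding set_integrable_def by simp
qed

lemma locally_integrable_integrable:
  fixes g :: "R3 \<Rightarrow> complex"
  assumes "integrable lborel g" shows "locally_integrable g"
  unfolding locally_integrable_def set_integrable_def
  using assms by (auto simp: compact_imp_closed borel_closed intro!: integrable_mult_indicator dest: borel_measurable_integrable)

text \<open>By transposition, testing the left side with \<phi> means testing G with
  \<open>inv_fourier (fourier \<phi>)\<close>, which is \<phi>. Multipliers therefore multiply the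
  representing function of the Fourier transform, even when it is merely locally integrable.\<close>

lemma represents_fourier_inv_fourier_dist:
  "locally_integrable G \<Longrightarrow> represents G (fourier_dist (inv_fourier_dist (fun_dist G)))"
  by (simp add: represents_def fourier_dist_def inv_fourier_dist_def test_function_inv_fourier_fourier)

text \<open>Each multiplier chooses a representative anew, so the composed symbol is known only
  almost everywhere. Keeping the chosen G makes the identity between the functionals exact.\<close>

lemma freq_proj_half_wave_symbol:
  assumes g: "represents g (fourier_dist u)"
  shows "\<exists>G. G \<in> borel_measurable borel \<and> freq_proj K (half_wave t u) = inv_fourier_dist (fun_dist G) \<and>
    (AE \<xi> in lborel. G \<xi> = indicator (ball 0 K) \<xi> * cis (t * norm \<xi>) * g \<xi>)"
proof -
  define W where "W \<xi> = cis (t * norm \<xi>) * dist_fun (fourier_dist u) \<xi>" for \<xi>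
  have "locally_integrable (dist_fun (fourier_dist u))"
    using represents_dist_fun[OF g] by (simp add: represents_def)
  then have "locally_integrable W"
    unfolding W_def by (intro locally_integrable_mult[where M=1]) auto
  then have W: "represents W (fourier_dist (half_wave t u))"
    unfolding half_wave_def multiplier_def W_def by (rule represents_fourier_inv_fourier_dist)
  define G where "G \<xi> = indicator (ball 0 K) \<xi> * dist_fun (fourier_dist (half_wave t u)) \<xi>" for \<xi>
  show ?thesis
  proof (intro exI conjI)
    have [measurable]: "dist_fun (fourier_dist (half_wave t u)) \<in> borel_measurable borel"
      using represents_dist_fun[OF W] by (simp add: represents_def locally_integrable_def)
    show "G \<in> borel_measurable borel" unfolding G_def by measurable
    show "freq_proj K (half_wave t u) = inv_fourier_dist (fun_dist G)"
      unfolding freq_proj_def multiplier_def G_def ..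
    show "AE \<xi> in lborel. G \<xi> = indicator (ball 0 K) \<xi> * cis (t * norm \<xi>) * g \<xi>"
      using dist_fun_AE[OF W] dist_fun_AE[OF g] by eventually_elim (simp add: G_def W_def)
  qed
qed

section \<open>From point evaluations to the two norms\<close>

lemma disc_norm_2:
  assumes "0 \<le> \<tau>" "\<And>n. 0 \<le> nrm (F n)"
  shows "disc_norm 2 \<tau> N nrm F = sqrt (\<tau> * (\<Sum>n\<le>N. (nrm (F n))\<^sup>2))"
  unfolding disc_norm_def atMost_atLeast0 using assms
  by (simp add: powr_half_sqrt sum_nonneg)

text \<open>Some value exceeds half of a positive supremum. Such a point replaces the supremum norm
  at the cost of a factor 2, which is the 2 in \<open>2 * sqrt A\<close> below.\<close>

lemma bounded_almost_attained:
  fixes g :: "'a \<Rightarrow> complex"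
  assumes "\<And>x. norm (g x) \<le> M"
  obtains z where "\<And>x. norm (g x) \<le> 2 * norm (g z)"
proof (cases "\<forall>x. g x = 0")
  case True then show ?thesis using that by simp
next
  case False
  then obtain y where y: "g y \<noteq> 0" by blast
  have bd: "bdd_above (range (\<lambda>x. norm (g x)))" using assms by (intro bdd_aboveI2)
  define S where "S = (SUP x. norm (g x))"
  have le: "norm (g x) \<le> S" for x unfolding S_def by (rule cSUP_upper[OF UNIV_I bd])
  have "0 < S" using le[of y] y by (smt (verit) zero_less_norm_iff)
  then have "S / 2 < S" by simp
  then obtain z where "S / 2 < norm (g z)"
    using less_cSUP_iff[OF UNIV_not_empty bd, of "S / 2"] unfolding S_def[symmetric] by blast
  then have "norm (g x) \<le> 2 * norm (g z)" for x using le[of x] by linarith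
  then show ?thesis by (rule that)
qed

text \<open>For an integrable symbol the distribution is represented by the bounded function
  \<open>inv_fourier G\<close>, so a pointwise bound, valid everywhere, controls the essential
  supremum of whichever representative is chosen.\<close>

lemma Linfty_inv_fourier_dist:
  assumes G: "integrable lborel G" and M: "\<And>x. norm (inv_fourier G x) \<le> M"
  shows "inv_fourier_dist (fun_dist G) \<in> Linfty" and "Linfty_norm (inv_fourier_dist (fun_dist G)) \<le> M"
proof -
  let ?u = "inv_fourier_dist (fun_dist G)" and ?g = "inv_fourier G"
  have u: "?u \<phi> = fun_dist ?g \<phi>" if "integrable lborel \<phi>" for \<phi>
    unfolding inv_fourier_dist_def by (rule fun_dist_inv_fourier[OF G that])
  have [measurable]: "?g \<in> borel_measurable borel"
    using G by (intro fourier_measurable) (auto dest: borel_measurable_integrable)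
  have rep: "represents ?g ?u"
    unfolding represents_def using u test_function_integrable locally_integrable_bounded[OF _ M] by auto
  have M0: "0 \<le> M" using M[of 0] norm_ge_zero order_trans by blast
  have [measurable]: "dist_fun ?u \<in> borel_measurable borel"
    using represents_dist_fun[OF rep] by (simp add: represents_def locally_integrable_def)
  have le: "Linfty_enorm ?u \<le> ennreal M"
    unfolding Linfty_enorm_def
  proof (rule esssup_I)
    show "AE x in lborel. ennreal (norm (dist_fun ?u x)) \<le> ennreal M"
      using dist_fun_AE[OF rep] by eventually_elim (simp add: M ennreal_leI)
  qed measurable
  have "Linfty_enorm ?u < \<infinity>" by (rule le_less_trans[OF le]) simp
  moreover have "?u \<in> tempered" by (rule tempered_bounded_density[OF _ M u]) measurable
  ultimately show "?u \<in> Linfty"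
    unfolding Linfty_def mem_Collect_eq using rep by (intro conjI exI)
  show "Linfty_norm ?u \<le> M"
    unfolding Linfty_norm_def using le M0 by (simp add: enn2real_leI)
qed

lemma indicator_norm_inverse_L2:
  assumes "0 \<le> K"
  shows "integrable (lborel :: R3 measure) (\<lambda>\<xi>. (norm (complex_of_real (indicator (ball 0 K) \<xi> / norm \<xi>)))\<^sup>2)"
proof -
  have "(norm (complex_of_real (indicator (ball 0 K) \<xi> / norm \<xi>)))\<^sup>2 = indicator (ball 0 K) \<xi> / (norm \<xi>)\<^sup>2" for \<xi> :: R3
    unfolding norm_of_real by (auto simp: power_divide split: split_indicator)
  then show ?thesis using inverse_square_ball(1)[OF assms] by simp
qed

text \<open>For each time a separate point \<open>z n\<close> is chosen where the solution nearly
  attains its supremum; then \<open>est\<close> is applied once to this whole sequence of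
  points.\<close>

lemma homogeneous_Strichartz:
  assumes \<tau>: "0 < \<tau>" and K: "0 \<le> K" and f: "f \<in> hdot 1"
    and est: "\<And>(z :: nat \<Rightarrow> R3) h. h \<in> borel_measurable borel \<Longrightarrow> integrable lborel (\<lambda>\<xi>. (norm (h \<xi>))\<^sup>2) \<Longrightarrow>
      \<tau> * (\<Sum>k\<le>N. (norm (LINT \<xi>|lborel. complex_of_real (indicator (ball 0 K) \<xi> / norm \<xi>)
            * cis (real k * \<tau> * norm \<xi>) * cis (z k \<bullet> \<xi>) * h \<xi>))\<^sup>2)
        \<le> A * (LINT \<xi>|lborel. (norm (h \<xi>))\<^sup>2)"
  shows "freq_proj K (half_wave (real n * \<tau>) f) \<in> Linfty"
    and "disc_norm 2 \<tau> N Linfty_norm (\<lambda>n. freq_proj K (half_wave (real n * \<tau>) f)) \<le> 2 * sqrt A * hdot_norm 1 f"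
proof -
  define g where "g = dist_fun (fourier_dist f)"
  have rep: "represents g (fourier_dist f)"
    using f represents_dist_fun unfolding hdot_def g_def mem_Collect_eq by (elim conjE exE)
  have [measurable]: "g \<in> borel_measurable borel" using rep by (simp add: represents_def locally_integrable_def)
  \<comment> \<open>The weight of the norm goes into h, so that the \<open>L2\<close> norm of h is
    \<open>hdot_norm 1 f\<close>; the factor 1 / |\<xi>| in \<open>est\<close> takes it
    back.\<close>
  define h where "h \<xi> = complex_of_real (norm \<xi>) * g \<xi>" for \<xi>
  have [measurable]: "h \<in> borel_measurable borel" unfolding h_def by measurable
  have hsq: "(norm \<xi> powr 1 * norm (dist_fun (fourier_dist f) \<xi>))\<^sup>2 = (norm (h \<xi>))\<^sup>2" for \<xi>
    by (simp add: h_def g_def norm_mult)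
  have hint: "integrable lborel (\<lambda>\<xi>. (norm (h \<xi>))\<^sup>2)" using f unfolding hdot_def hsq mem_Collect_eq by (elim conjE)
  have hn: "hdot_norm 1 f = sqrt (LINT \<xi>|lborel. (norm (h \<xi>))\<^sup>2)" unfolding hdot_norm_def hsq ..
  have "\<forall>n. \<exists>G. G \<in> borel_measurable borel \<and> freq_proj K (half_wave (real n * \<tau>) f) = inv_fourier_dist (fun_dist G) \<and>
    (AE \<xi> in lborel. G \<xi> = indicator (ball 0 K) \<xi> * cis (real n * \<tau> * norm \<xi>) * g \<xi>)"
    by (intro allI freq_proj_half_wave_symbol[OF rep])
  from choice[OF this] obtain G where GG: "\<forall>n. G n \<in> borel_measurable borel \<and>
    freq_proj K (half_wave (real n * \<tau>) f) = inv_fourier_dist (fun_dist (G n)) \<and>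
    (AE \<xi> in lborel. G n \<xi> = indicator (ball 0 K) \<xi> * cis (real n * \<tau> * norm \<xi>) * g \<xi>)" ..
  note [measurable] = GG[THEN spec, THEN conjunct1]
    and Gu = GG[THEN spec, THEN conjunct2, THEN conjunct1]
    and G' = GG[THEN spec, THEN conjunct2, THEN conjunct2]
  \<comment> \<open>At the origin the right-hand side is 0, so that point is excluded when the two
    weights are cancelled.\<close>
  have GA: "AE \<xi> in lborel. G n \<xi> = complex_of_real (indicator (ball 0 K) \<xi> / norm \<xi>) * cis (real n * \<tau> * norm \<xi>) * h \<xi>" for n
    using G'[rule_format, of n] AE_lborel_singleton[of "0::R3"]
  proof eventually_elim
    case (elim \<xi>)
    then show ?case by (simp add: h_def split: split_indicator)
  qed
  have "integrable lborel (\<lambda>\<xi>. cis (real n * \<tau> * norm \<xi>) * (complex_of_real (indicator (ball 0 K) \<xi> / norm \<xi>) * h \<xi>))" for n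
    by (intro integrable_cis_mult integrable_mult_L2 indicator_norm_inverse_L2 K hint) measurable
  then have "integrable lborel (\<lambda>\<xi>. complex_of_real (indicator (ball 0 K) \<xi> / norm \<xi>) * cis (real n * \<tau> * norm \<xi>) * h \<xi>)" for n
    by (simp add: mult_ac)
  then have Gint: "integrable lborel (G n)" for n
    by (subst integrable_cong_AE[OF _ _ GA]) auto
  have "\<exists>z. \<forall>x. norm (inv_fourier (G n) x) \<le> 2 * norm (inv_fourier (G n) z)" for n
    using bounded_almost_attained[OF norm_inv_fourier_le[of "G n"]] by metis
  then obtain z where z: "\<And>n x. norm (inv_fourier (G n) x) \<le> 2 * norm (inv_fourier (G n) (z n))" by metis
  define I where "I n = (LINT \<xi>|lborel. complex_of_real (indicator (ball 0 K) \<xi> / norm \<xi>)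
            * cis (real n * \<tau> * norm \<xi>) * cis (z n \<bullet> \<xi>) * h \<xi>)" for n
  have zI: "norm (inv_fourier (G n) (z n)) \<le> norm (I n)" for n
  proof -
    have eq: "(LINT \<xi>|lborel. cis (z n \<bullet> \<xi>) * G n \<xi>) = I n"
      unfolding I_def
    proof (rule integral_cong_AE)
      show "AE \<xi> in lborel. cis (z n \<bullet> \<xi>) * G n \<xi> = complex_of_real (indicator (ball 0 K) \<xi> / norm \<xi>)
            * cis (real n * \<tau> * norm \<xi>) * cis (z n \<bullet> \<xi>) * h \<xi>"
        using GA[of n] by eventually_elim simp
    qed measurable
    \<comment> \<open>The normalising factor of the inverse transform is at most 1 and is
      dropped.\<close>
    have "(1::real) ^ 3 \<le> (2 * pi) ^ 3" using pi_ge_two by (intro power_mono) auto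
    then show ?thesis unfolding inv_fourier_def norm_mult norm_of_real eq
      by (intro mult_left_le_one_le) auto
  qed
  have M: "norm (inv_fourier (G n) x) \<le> 2 * norm (I n)" for n x
    using z[of n x] zI[of n] by linarith
  show "freq_proj K (half_wave (real n * \<tau>) f) \<in> Linfty"
    unfolding Gu by (rule Linfty_inv_fourier_dist(1)[OF Gint M])
  have s: "0 \<le> Linfty_norm u" for u by (simp add: Linfty_norm_def)
  have "disc_norm 2 \<tau> N Linfty_norm (\<lambda>n. freq_proj K (half_wave (real n * \<tau>) f))
     = sqrt (\<tau> * (\<Sum>n\<le>N. (Linfty_norm (inv_fourier_dist (fun_dist (G n))))\<^sup>2))"
    unfolding Gu using \<tau> s by (intro disc_norm_2) auto
  also have "\<dots> \<le> sqrt (\<tau> * (\<Sum>n\<le>N. (2 * norm (I n))\<^sup>2))"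
    using \<tau> by (intro real_sqrt_le_mono mult_left_mono sum_mono power_mono Linfty_inv_fourier_dist(2)[OF Gint M] s) auto
  also have "\<tau> * (\<Sum>n\<le>N. (2 * norm (I n))\<^sup>2) = 4 * (\<tau> * (\<Sum>n\<le>N. (norm (I n))\<^sup>2))"
    by (simp add: power_mult_distrib sum_distrib_left mult.left_commute)
  also have "sqrt (4 * (\<tau> * (\<Sum>n\<le>N. (norm (I n))\<^sup>2))) \<le> sqrt (4 * (A * (LINT \<xi>|lborel. (norm (h \<xi>))\<^sup>2)))"
    unfolding I_def by (intro real_sqrt_le_mono mult_left_mono est hint) auto
  also have "\<dots> = 2 * sqrt A * hdot_norm 1 f"
    unfolding hn by (simp add: real_sqrt_mult)
  finally show "disc_norm 2 \<tau> N Linfty_norm (\<lambda>n. freq_proj K (half_wave (real n * \<tau>) f)) \<le> 2 * sqrt A * hdot_norm 1 f" .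
qed

text \<open>Duality in concrete form: with T the weighted transform of S, the squared norm X of T is
  the pairing of T with itself. Moved onto the functions \<open>f k\<close>, it is bounded by their
  \<open>L1\<close> norms times values of the flow with data T at suitable points, and
  \<open>est\<close> bounds these values by X again.\<close>

lemma inhomogeneous_Strichartz:
  assumes \<tau>: "0 < \<tau>" and K: "0 \<le> K" and A: "0 \<le> A" and F: "F \<in> l2_L1"
    and est: "\<And>(z :: nat \<Rightarrow> R3) h. h \<in> borel_measurable borel \<Longrightarrow> integrable lborel (\<lambda>\<xi>. (norm (h \<xi>))\<^sup>2) \<Longrightarrow>
      \<tau> * (\<Sum>k\<le>N. (norm (LINT \<xi>|lborel. complex_of_real (indicator (ball 0 K) \<xi> / norm \<xi>)
            * cis (real k * \<tau> * norm \<xi>) * cis (z k \<bullet> \<xi>) * h \<xi>))\<^sup>2)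
        \<le> A * (LINT \<xi>|lborel. (norm (h \<xi>))\<^sup>2)"
  defines "S \<equiv> (\<lambda>\<phi>. complex_of_real \<tau> *
      (\<Sum>k=0..N. freq_proj K (half_wave (- real k * \<tau>) (fun_dist (F (int k)))) \<phi>))"
  shows "S \<in> hdot (- 1)"
    and "hdot_norm (- 1) S \<le> 2 * sqrt A * disc_norm 2 \<tau> N L1_norm (\<lambda>k. F (int k))"
proof -
  define f where "f k = F (int k)" for k :: nat
  have fint: "integrable lborel (f k)" for k using F by (simp add: f_def l2_L1_def L1_def)
  have [measurable]: "f k \<in> borel_measurable borel" for k using fint by (auto dest: borel_measurable_integrable)
  define w where "w \<xi> = complex_of_real (indicator (ball 0 K) \<xi> / norm \<xi>)" for \<xi> :: R3
  have w2: "integrable lborel (\<lambda>\<xi>. (norm (w \<xi>))\<^sup>2)" unfolding w_def by (rule indicator_norm_inverse_L2[OF K])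
  have [measurable]: "w \<in> borel_measurable borel" unfolding w_def by measurable
  have [measurable]: "fourier (f k) \<in> borel_measurable borel" for k by (intro fourier_measurable) measurable
  define P where "P k = L1_norm (f k)" for k
  have P0: "0 \<le> P k" for k by (simp add: P_def L1_norm_def)
  have fP: "norm (fourier (f k) \<xi>) \<le> P k" for k \<xi>
    using norm_fourier_le[of "f k" \<xi>] by (simp add: P_def L1_norm_def)
  have rep: "represents (fourier (f k)) (fourier_dist (fun_dist (f k)))" for k
    unfolding represents_def fourier_dist_def
    using locally_integrable_bounded[OF _ fP] fun_dist_fourier[OF fint test_function_integrable] by auto
  have "\<forall>k. \<exists>G. G \<in> borel_measurable borel \<and> freq_proj K (half_wave (- real k * \<tau>) (fun_dist (f k))) = inv_fourier_dist (fun_dist G) \<and>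
    (AE \<xi> in lborel. G \<xi> = indicator (ball 0 K) \<xi> * cis (- real k * \<tau> * norm \<xi>) * fourier (f k) \<xi>)"
    by (intro allI freq_proj_half_wave_symbol[OF rep])
  from choice[OF this] obtain G where GG: "\<forall>k. G k \<in> borel_measurable borel \<and>
    freq_proj K (half_wave (- real k * \<tau>) (fun_dist (f k))) = inv_fourier_dist (fun_dist (G k)) \<and>
    (AE \<xi> in lborel. G k \<xi> = indicator (ball 0 K) \<xi> * cis (- real k * \<tau> * norm \<xi>) * fourier (f k) \<xi>)" ..
  note [measurable] = GG[THEN spec, THEN conjunct1]
    and Gu = GG[THEN spec, THEN conjunct2, THEN conjunct1]
    and G' = GG[THEN spec, THEN conjunct2, THEN conjunct2]
  define E where "E k \<xi> = cis (- real k * \<tau> * norm \<xi>) * fourier (f k) \<xi>" for k and \<xi> :: R3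
  have [measurable]: "E k \<in> borel_measurable borel" for k unfolding E_def by measurable
  have EP: "norm (E k \<xi>) \<le> P k" for k \<xi> using fP[of k \<xi>] by (simp add: E_def norm_mult)
  have GE: "AE \<xi> in lborel. G k \<xi> = indicator (ball 0 K) \<xi> * E k \<xi>" for k
    using G'[of k] by eventually_elim (simp add: E_def mult.assoc)
  have ball: "integrable lborel (\<lambda>\<xi>. complex_of_real (indicator (ball 0 K :: R3 set) \<xi>))"
    using emeasure_lborel_ball_finite[of 0 K] by (intro integrable_of_real integrable_real_indicator) auto
  have Gint: "integrable lborel (G k)" for k
  proof -
    have "integrable lborel (\<lambda>\<xi>. E k \<xi> * complex_of_real (indicator (ball 0 K) \<xi>))"
      by (rule integrable_bounded_mult[OF _ EP ball]) measurable
    then have "integrable lborel (\<lambda>\<xi>. indicator (ball 0 K) \<xi> * E k \<xi>)"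
      by (rule Bochner_Integration.integrable_cong[THEN iffD1, rotated -1]) (auto split: split_indicator)
    then show ?thesis by (subst integrable_cong_AE[OF _ _ GE]) auto
  qed
  have S: "S \<phi> = complex_of_real \<tau> * (\<Sum>k\<le>N. inv_fourier_dist (fun_dist (G k)) \<phi>)" for \<phi>
    unfolding S_def f_def[symmetric] Gu atMost_atLeast0 ..
  define H where "H \<xi> = complex_of_real \<tau> * (\<Sum>k\<le>N. G k \<xi>)" for \<xi>
  have Hint: "integrable lborel H" unfolding H_def by (intro integrable_mult_right Bochner_Integration.integrable_sum Gint)
  have [measurable]: "H \<in> borel_measurable borel" unfolding H_def by measurable
  \<comment> \<open>Exchanging sum and integral needs a bounded measurable
    \<open>inv_fourier \<phi>\<close>. This holds for integrable \<phi>, as temperedness requires,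
    and for the transform of a test function, as the representation requires.\<close>
  have SH: "S \<phi> = inv_fourier_dist (fun_dist H) \<phi>" if \<phi>: "inv_fourier \<phi> \<in> borel_measurable borel" "\<And>x. norm (inv_fourier \<phi> x) \<le> B" for \<phi> B
  proof -
    have i: "integrable lborel (\<lambda>\<xi>. G k \<xi> * inv_fourier \<phi> \<xi>)" for k
      using integrable_bounded_mult[OF \<phi> Gint[of k]] by (simp add: mult.commute)
    have "inv_fourier_dist (fun_dist H) \<phi> = (LINT \<xi>|lborel. complex_of_real \<tau> * (\<Sum>k\<le>N. G k \<xi> * inv_fourier \<phi> \<xi>))"
      unfolding inv_fourier_dist_def fun_dist_def H_def by (simp add: sum_distrib_right mult.assoc)
    also have "\<dots> = S \<phi>"
      unfolding S inv_fourier_dist_def fun_dist_def using i by (simp add: Bochner_Integration.integral_sum)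
    finally show ?thesis ..
  qed
  have temp: "S \<in> tempered"
  proof (rule tempered_bounded_density)
    show "norm (inv_fourier H x) \<le> (LINT \<xi>|lborel. norm (H \<xi>))" for x by (rule norm_inv_fourier_le)
    show "inv_fourier H \<in> borel_measurable borel" by (intro fourier_measurable) measurable
    fix \<phi> :: "R3 \<Rightarrow> complex" assume \<phi>: "integrable lborel \<phi>"
    have "S \<phi> = inv_fourier_dist (fun_dist H) \<phi>"
      by (rule SH[OF fourier_measurable(2) norm_inv_fourier_le]) (use \<phi> in \<open>auto dest: borel_measurable_integrable\<close>)
    then show "S \<phi> = fun_dist (inv_fourier H) \<phi>"
      unfolding inv_fourier_dist_def by (simp add: fun_dist_inv_fourier[OF Hint \<phi>])
  qed
  have repH: "represents H (fourier_dist S)"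
    unfolding represents_def
  proof (intro conjI allI impI locally_integrable_integrable Hint)
    fix \<phi> assume \<phi>: "test_function \<phi>"
    obtain B where B: "\<And>x. norm (\<phi> x) \<le> B" using test_function_bounded_support[OF \<phi>] by metis
    have "S (fourier \<phi>) = inv_fourier_dist (fun_dist H) (fourier \<phi>)"
      using B test_function_measurable[OF \<phi>]
      by (intro SH[of _ B]) (simp_all add: test_function_inv_fourier_fourier[OF \<phi>])
    then show "fourier_dist S \<phi> = fun_dist H \<phi>"
      by (simp add: fourier_dist_def inv_fourier_dist_def test_function_inv_fourier_fourier[OF \<phi>])
  qed
  \<comment> \<open>Off a null set this is the transform of S divided by |\<xi>|: w carries the
    cut-off and the singular weight, each \<open>E k\<close> is bounded.\<close>
  define T where "T \<xi> = w \<xi> * (complex_of_real \<tau> * (\<Sum>k\<le>N. E k \<xi>))" for \<xi>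
  have [measurable]: "T \<in> borel_measurable borel" unfolding T_def by measurable
  have [measurable]: "dist_fun (fourier_dist S) \<in> borel_measurable borel"
    using represents_dist_fun[OF repH] by (simp add: represents_def locally_integrable_def)
  have "AE \<xi> in lborel. \<forall>k. G k \<xi> = indicator (ball 0 K) \<xi> * E k \<xi>" unfolding AE_all_countable using GE by blast
  then have TA: "AE \<xi> in lborel. (norm \<xi> powr - 1 * norm (dist_fun (fourier_dist S) \<xi>))\<^sup>2 = (norm (T \<xi>))\<^sup>2"
    using dist_fun_AE[OF repH]
  proof eventually_elim
    case (elim \<xi>)
    have "norm \<xi> powr - 1 * norm (dist_fun (fourier_dist S) \<xi>) = norm (complex_of_real (norm \<xi> powr - 1) * H \<xi>)"
      unfolding elim(2) norm_mult norm_of_real by simp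
    also have "complex_of_real (norm \<xi> powr - 1) * H \<xi> = T \<xi>"
    proof -
      have "norm \<xi> powr - 1 = 1 / norm \<xi>" by (simp add: powr_minus divide_inverse)
      moreover have "(\<Sum>k\<le>N. G k \<xi>) = indicator (ball 0 K) \<xi> * (\<Sum>k\<le>N. E k \<xi>)"
        unfolding sum_distrib_left using elim(1) by (intro sum.cong refl) blast
      then have "H \<xi> = indicator (ball 0 K) \<xi> * (complex_of_real \<tau> * (\<Sum>k\<le>N. E k \<xi>))"
        unfolding H_def by (simp only: mult.left_commute)
      ultimately show ?thesis by (auto simp: T_def w_def split: split_indicator)
    qed
    finally show ?case by simp
  qed
  have sumP: "norm (complex_of_real \<tau> * (\<Sum>k\<le>N. E k \<xi>)) \<le> \<tau> * (\<Sum>k\<le>N. P k)" for \<xi>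
    using \<tau> order_trans[OF norm_sum sum_mono[OF EP]] by (simp add: norm_mult mult_left_mono)
  \<comment> \<open>A crude qualitative bound by plain sums of \<open>L1\<close> norms: finiteness
    of X must be known before \<open>est\<close> can be applied to T and a factor X
    cancelled.\<close>
  have T2: "integrable lborel (\<lambda>\<xi>. (norm (T \<xi>))\<^sup>2)"
  proof (rule Bochner_Integration.integrable_bound)
    show "integrable lborel (\<lambda>\<xi>. (\<tau> * (\<Sum>k\<le>N. P k))\<^sup>2 * (norm (w \<xi>))\<^sup>2)" by (intro integrable_mult_right w2)
    have "(norm (T \<xi>))\<^sup>2 \<le> (\<tau> * (\<Sum>k\<le>N. P k))\<^sup>2 * (norm (w \<xi>))\<^sup>2" for \<xi>
      unfolding T_def norm_mult[of "w \<xi>"] power_mult_distrib[of "norm (w \<xi>)"] mult.commute[of "(norm (w \<xi>))\<^sup>2"]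
      by (intro mult_right_mono power_mono sumP) auto
    then show "AE \<xi> in lborel. norm ((norm (T \<xi>))\<^sup>2) \<le> norm ((\<tau> * (\<Sum>k\<le>N. P k))\<^sup>2 * (norm (w \<xi>))\<^sup>2)"
      by (intro AE_I2) simp
  qed measurable
  have "integrable lborel (\<lambda>\<xi>. (norm \<xi> powr - 1 * norm (dist_fun (fourier_dist S) \<xi>))\<^sup>2)"
    using T2 by (subst integrable_cong_AE[OF _ _ TA]) auto
  then show "S \<in> hdot (- 1)" unfolding hdot_def using temp repH by blast
  define X where "X = (LINT \<xi>|lborel. (norm (T \<xi>))\<^sup>2)"
  have X0: "0 \<le> X" unfolding X_def by simp
  have hX: "hdot_norm (- 1) S = sqrt X"
    unfolding hdot_norm_def X_def by (intro arg_cong[where f=sqrt] integral_cong_AE TA) auto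
  \<comment> \<open>Chosen so that |T|^2 is \<tau> times the sum of
    \<open>fourier (f k) * q k\<close>. The conjugate on T makes \<open>fourier (q k)\<close> at a
    point the conjugate of an integral of the kind in \<open>est\<close> with data T.\<close>
  define q where "q k \<xi> = w \<xi> * (cis (- real k * \<tau> * norm \<xi>) * cnj (T \<xi>))" for k and \<xi> :: R3
  have qint: "integrable lborel (q k)" for k
    unfolding q_def by (intro integrable_mult_L2 w2) (use T2 in \<open>simp_all add: norm_mult\<close>)
  have "\<exists>z. \<forall>x. norm (fourier (q k) x) \<le> 2 * norm (fourier (q k) z)" for k
    using bounded_almost_attained[OF norm_fourier_le[of "q k"]] by metis
  then obtain z where z: "\<And>k x. norm (fourier (q k) x) \<le> 2 * norm (fourier (q k) (z k))" by metis
  define I where "I k = (LINT \<xi>|lborel. complex_of_real (indicator (ball 0 K) \<xi> / norm \<xi>)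
            * cis (real k * \<tau> * norm \<xi>) * cis (z k \<bullet> \<xi>) * T \<xi>)" for k
  have zI: "norm (fourier (q k) (z k)) = norm (I k)" for k
  proof -
    have "fourier (q k) (z k) = cnj (I k)"
    proof -
      have cnj_integral: "cnj (LINT x|lborel. p x) = (LINT x|lborel. cnj (p x))" for p :: "R3 \<Rightarrow> complex" by simp
      show ?thesis unfolding I_def cnj_integral fourier_def q_def w_def
        by (intro Bochner_Integration.integral_cong refl) (simp add: cis_cnj mult_ac inner_commute)
    qed
    then show ?thesis by simp
  qed
  have pair: "norm (fun_dist (fourier (f k)) (q k)) \<le> P k * (2 * norm (I k))" for k
  proof -
    have "fun_dist (fourier (f k)) (q k) = (LINT x|lborel. f k x * fourier (q k) x)"
      using fun_dist_fourier[OF fint qint] by (simp add: fun_dist_def)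
    also have "norm \<dots> \<le> (LINT x|lborel. norm (f k x * fourier (q k) x))" by (rule integral_norm_bound)
    also have "\<dots> \<le> (LINT x|lborel. norm (f k x) * (2 * norm (I k)))"
    proof (rule integral_mono)
      have [measurable]: "fourier (q k) \<in> borel_measurable borel"
        using qint by (intro fourier_measurable) (auto dest: borel_measurable_integrable)
      show "integrable lborel (\<lambda>x. norm (f k x * fourier (q k) x))"
        using integrable_bounded_mult[OF _ z[of k] fint[of k]] by (intro integrable_norm) (simp add: mult.commute)
      show "integrable lborel (\<lambda>x. norm (f k x) * (2 * norm (I k)))"
        by (intro integrable_mult_left integrable_norm fint)
      show "norm (f k x * fourier (q k) x) \<le> norm (f k x) * (2 * norm (I k))" for x
        unfolding norm_mult zI[symmetric] by (intro mult_left_mono z) auto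
    qed
    also have "\<dots> = P k * (2 * norm (I k))" by (simp add: P_def L1_norm_def)
    finally show ?thesis .
  qed
  have "complex_of_real X = (LINT \<xi>|lborel. T \<xi> * cnj (T \<xi>))"
    unfolding X_def integral_complex_of_real[symmetric] complex_norm_square ..
  also have "\<dots> = (LINT \<xi>|lborel. complex_of_real \<tau> * (\<Sum>k\<le>N. fourier (f k) \<xi> * q k \<xi>))"
  proof -
    have "T \<xi> * c = complex_of_real \<tau> * (\<Sum>k\<le>N. fourier (f k) \<xi> * (w \<xi> * (cis (- real k * \<tau> * norm \<xi>) * c)))" for c \<xi>
      by (simp add: T_def E_def sum_distrib_left sum_distrib_right mult_ac)
    then show ?thesis unfolding q_def by (intro Bochner_Integration.integral_cong refl)
  qed
  also have "\<dots> = complex_of_real \<tau> * (\<Sum>k\<le>N. fun_dist (fourier (f k)) (q k))"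
    unfolding fun_dist_def using integrable_bounded_mult[OF _ fP qint]
    by (simp add: Bochner_Integration.integral_sum)
  finally have "X = norm (complex_of_real \<tau> * (\<Sum>k\<le>N. fun_dist (fourier (f k)) (q k)))"
    using X0 by (metis abs_of_nonneg norm_of_real)
  also have "\<dots> \<le> \<tau> * (\<Sum>k\<le>N. P k * (2 * norm (I k)))"
    using \<tau> order_trans[OF norm_sum sum_mono[OF pair]] by (simp add: norm_mult mult_left_mono)
  also have "\<dots> = 2 * (\<tau> * (\<Sum>k\<le>N. P k * norm (I k)))" by (simp add: sum_distrib_left mult_ac)
  finally have X1: "X \<le> 2 * (\<tau> * (\<Sum>k\<le>N. P k * norm (I k)))" .
  define Q where "Q = \<tau> * (\<Sum>k\<le>N. (P k)\<^sup>2)"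
  have Q0: "0 \<le> Q" unfolding Q_def using \<tau> by (intro mult_nonneg_nonneg sum_nonneg) auto
  have "X\<^sup>2 \<le> (2 * (\<tau> * (\<Sum>k\<le>N. P k * norm (I k))))\<^sup>2" using X0 X1 by (intro power_mono)
  also have "\<dots> = 4 * \<tau>\<^sup>2 * (\<Sum>k\<le>N. P k * norm (I k))\<^sup>2" by (simp add: power_mult_distrib)
  also have "\<dots> \<le> 4 * \<tau>\<^sup>2 * ((\<Sum>k\<le>N. (P k)\<^sup>2) * (\<Sum>k\<le>N. (norm (I k))\<^sup>2))"
    by (intro mult_left_mono Cauchy_Schwarz_ineq_sum) auto
  also have "\<dots> = 4 * Q * (\<tau> * (\<Sum>k\<le>N. (norm (I k))\<^sup>2))" by (simp add: Q_def power2_eq_square)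
  \<comment> \<open>Here \<open>est\<close> is applied to T itself. The resulting X^2 \<le> 4 A Q X
    loses one factor X, and the square root gives the claim.\<close>
  also have "\<dots> \<le> 4 * Q * (A * X)"
    unfolding I_def X_def using Q0 by (intro mult_left_mono est T2) auto
  finally have "X * X \<le> X * (4 * A * Q)" by (simp add: power2_eq_square mult_ac)
  then have "X \<le> 4 * A * Q" using X0 A Q0 by (cases "X = 0") auto
  then have "sqrt X \<le> sqrt (4 * A * Q)" by (rule real_sqrt_le_mono)
  also have "\<dots> = 2 * sqrt A * sqrt Q" by (simp add: real_sqrt_mult)
  also have "sqrt Q = disc_norm 2 \<tau> N L1_norm (\<lambda>k. F (int k))"
    unfolding f_def[symmetric] Q_def P_def using \<tau> P0 unfolding P_def by (intro disc_norm_2[symmetric]) auto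
  finally show "hdot_norm (- 1) S \<le> 2 * sqrt A * disc_norm 2 \<tau> N L1_norm (\<lambda>k. F (int k))" unfolding hX .
qed

theorem theorem2p10:
  shows "\<exists>C::real. \<forall>\<tau> K :: real. \<forall>N :: nat. 0 < \<tau> \<and> \<tau> \<le> 1 \<and> K \<ge> 1 / \<tau> \<longrightarrow>
    (\<forall>f \<in> hdot 1.
       (\<forall>n\<le>N. freq_proj K (half_wave (real n * \<tau>) f) \<in> Linfty) \<and>
       disc_norm 2 \<tau> N Linfty_norm (\<lambda>n. freq_proj K (half_wave (real n * \<tau>) f))
         \<le> C * sqrt (K * \<tau> + ln (1 + K * real N * \<tau>)) * hdot_norm 1 f) \<and>
    (\<forall>F \<in> l2_L1.
       (let S = (\<lambda>\<phi>. complex_of_real \<tau> *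
              (\<Sum>k=0..N. freq_proj K (half_wave (- real k * \<tau>) (fun_dist (F (int k)))) \<phi>))
        in S \<in> hdot (- 1) \<and>
           hdot_norm (- 1) S
             \<le> C * sqrt (K * \<tau> + ln (1 + K * real N * \<tau>))
                 * disc_norm 2 \<tau> N L1_norm (\<lambda>k. F (int k))))"
proof -
  obtain C where C0: "0 \<le> C" and
    C: "\<And>\<tau> K N (z :: nat \<Rightarrow> R3) h. \<lbrakk>0 < \<tau>; 1 / \<tau> \<le> K; h \<in> borel_measurable borel;
        integrable lborel (\<lambda>\<xi>. (norm (h \<xi>))\<^sup>2)\<rbrakk> \<Longrightarrow>
      \<tau> * (\<Sum>k\<le>N. (norm (LINT \<xi>|lborel. complex_of_real (indicator (ball 0 K) \<xi> / norm \<xi>)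
            * cis (real k * \<tau> * norm \<xi>) * cis (z k \<bullet> \<xi>) * h \<xi>))\<^sup>2)
        \<le> C * (K * \<tau> + ln (1 + K * real N * \<tau>)) * (LINT \<xi>|lborel. (norm (h \<xi>))\<^sup>2)"
    by (rule discrete_Strichartz_points) blast
  show ?thesis
  \<comment> \<open>The 2 pays for the nearly maximal points, and sqrt C comes from A = C (K \<tau>
    + ln (1 + K N \<tau>)) in both estimates.\<close>
  proof (intro exI[of _ "2 * sqrt C"] allI impI, elim conjE, intro conjI ballI allI impI)
    fix \<tau> K :: real and N :: nat and f n
    assume \<tau>: "0 < \<tau>" and K: "1 / \<tau> \<le> K" and f: "f \<in> hdot 1"
    have K0: "0 \<le> K" using K \<tau> by (meson order_trans less_imp_le zero_le_divide_1_iff)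
    note hom = homogeneous_Strichartz[OF \<tau> K0 f C[OF \<tau> K]]
    show "freq_proj K (half_wave (real n * \<tau>) f) \<in> Linfty" by (rule hom(1))
    show "disc_norm 2 \<tau> N Linfty_norm (\<lambda>n. freq_proj K (half_wave (real n * \<tau>) f))
         \<le> 2 * sqrt C * sqrt (K * \<tau> + ln (1 + K * real N * \<tau>)) * hdot_norm 1 f"
      using hom(2)[of N] by (simp add: real_sqrt_mult)
  next
    fix \<tau> K :: real and N :: nat and F
    assume \<tau>: "0 < \<tau>" and K: "1 / \<tau> \<le> K" and F: "F \<in> l2_L1"
    have K0: "0 \<le> K" using K \<tau> by (meson order_trans less_imp_le zero_le_divide_1_iff)
    have "0 \<le> C * (K * \<tau> + ln (1 + K * real N * \<tau>))"
      using C0 K0 \<tau> by (intro mult_nonneg_nonneg add_nonneg_nonneg ln_ge_zero) auto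
    note inhom = inhomogeneous_Strichartz[OF \<tau> K0 this F C[OF \<tau> K]]
    show "let S = (\<lambda>\<phi>. complex_of_real \<tau> *
              (\<Sum>k=0..N. freq_proj K (half_wave (- real k * \<tau>) (fun_dist (F (int k)))) \<phi>))
        in S \<in> hdot (- 1) \<and>
           hdot_norm (- 1) S
             \<le> 2 * sqrt C * sqrt (K * \<tau> + ln (1 + K * real N * \<tau>))
                 * disc_norm 2 \<tau> N L1_norm (\<lambda>k. F (int k))"
      unfolding Let_def using inhom by (simp add: real_sqrt_mult)
  qed
qed

end
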